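(* Let $\alpha\geq 0$, $\delta,\gamma>0$, $\beta\neq 0$ and $c_s\neq 0$ be real constants, let $f$ be homogeneous of degree $p>1$, and assume that one of the following conditions holds: (i) $\beta<0$, $c_{s}-\alpha<0$; (ii) $\beta<0$, $0<c_{s}-\alpha<c^{*}=2\sqrt{\gamma\delta}$; (iii) $\beta>0$, $c_{s}-\alpha\leq-\frac{\beta^{2}}{4\delta}$; (iv) $\beta>0$ with $4\delta-\beta>0$, $\beta^{3}<\gamma(4\delta-\beta)^{2}$ and $0<c_{s}-\alpha<z_{+}$, where $$z_{+}=\frac{1}{2}\left(-\beta\left(1+\frac{\beta}{4\delta}\right)+(4\delta-\beta)\sqrt{\frac{\gamma}{\delta}+\left(\frac{\beta}{4\delta}\right)^{2}}\right).$$ Let $\lambda>0$ and let $\{u_n\}_n$ be a minimizing sequence in $H$ for $\lambda$, that is, $u_n\in H$, $K(u_n)=\lambda$ and $I(u_n)\to M_\lambda$. Then there exist a subsequence of $\{u_n\}_n$ (still denoted $\{u_n\}_n$), a sequence $\{y_n\}_n$ in $\mathbb{R}$ and $u\in H$ such that $u_n(\cdot+y_n)\to u$ strongly in $H$. Furthermore, the function $u$ achieves the minimum $I(u)=M_\lambda$ subject to $K(u)=\lambda$.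
   Context: Fourier transform: $\widehat f(k)=\int_{-\infty}^\infty e^{-ikx}f(x)\,dx$. $\mathcal{H}$ is the Hilbert transform on $\mathbb{R}$, $\mathcal{H}f(x)=\frac{1}{\pi}\,\mathrm{p.v.}\int_{-\infty}^{\infty}\frac{f(y)}{x-y}\,dy$, with $\widehat{\mathcal{H}f}(k)=-i\,\mathrm{sign}(k)\widehat{f}(k)$; $D_x^{1/2}$ has Fourier symbol $|k|^{1/2}$; $\partial_x^{-1}$ is given by $\widehat{\partial_x^{-1}f}(k)=(ik)^{-1}\widehat f(k)$ for $k\neq 0$ and $\widehat{\partial_x^{-1}f}(0)=0$. $\|\cdot\|$ is the $L^2(\mathbb{R})$ norm, and $H^{3/2}(\mathbb{R})$ is the Sobolev space of order $3/2$, with norm $\|\cdot\|_{H^{3/2}}$. The space is $$H=\{\varphi\in H^{3/2}(\mathbb{R}):\ \partial_x^{-1}\varphi\in L^2(\mathbb{R})\},\qquad \|\varphi\|_H=\|\varphi\|_{H^{3/2}}+\|\partial_x^{-1}\varphi\|;$$ the norm is also written in the paper, "equivalently", as $\|\varphi\|_H=\|\partial_x\varphi\|+\|D_x^{1/2}\varphi\|+\|\partial_x^{-1}\varphi\|$. Homogeneity of $f$ of degree $p$ means $f(\lambda s)=\lambda^pf(s)$ for $s,\lambda\neq0$; $F$ is defined by $F'=f$, $F(0)=0$. The functionals are $$I(u)=\int_{-\infty}^{\infty}\left(-(c_{s}-\alpha)u^{2}-\beta u\,\mathcal{H}u_{x}+\gamma(\partial_{x}^{-1}u)^{2}+\delta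 u_{x}^{2}\right)dx,\qquad K(u)=-(p+1)\int_{-\infty}^{\infty}F(u)\,dx,$$ and, for $\lambda>0$, $M_\lambda=\inf\{I(u):u\in H,\ K(u)=\lambda\}$.
   Formalization: Strong convergence in H is in the paper's second norm ‖∂ₓφ‖+‖D^{1/2}φ‖+‖∂ₓ⁻¹φ‖; it is not equivalent to ‖φ‖_{H^{3/2}}+‖∂ₓ⁻¹φ‖, for which the claim fails (perturb a minimizer by v_n→0 in H¹ with ‖v_n‖_{H^{3/2}}=1). The limit is still in H. *)

theory Defs
  imports "HOL-Analysis.Analysis"
begin

definition square_integrable :: "(real \<Rightarrow> 'a::{banach, second_countable_topology}) \<Rightarrow> bool" where
  "square_integrable f \<longleftrightarrow>
     f \<in> borel_measurable lborel \<and> integrable lborel (\<lambda>x. (norm (f x))\<^sup>2)"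

definition L2norm :: "(real \<Rightarrow> 'a::{banach, second_countable_topology}) \<Rightarrow> real" where
  "L2norm f = sqrt (LINT x|lborel. (norm (f x))\<^sup>2)"

text \<open>The Fourier transform of an \<open>L\<^sup>2\<close> function need not be given by an absolutely convergent
  integral. As usual it is the \<open>L\<^sup>2\<close> limit of the transforms of the truncations of \<open>f\<close> to
  \<open>[-R, R]\<close>. The distance is written with the nonnegative integral, because the Bochner integral
  of a non-integrable function is 0. The transform is determined up to null sets only.\<close>

definition is_fourier :: "(real \<Rightarrow> complex) \<Rightarrow> (real \<Rightarrow> complex) \<Rightarrow> bool" where
  "is_fourier f g \<longleftrightarrow> square_integrable g \<and>
     ((\<lambda>R. \<integral>\<^sup>+k. ennreal ((cmod (g k -
          (LINT x:{-R..R}|lborel. exp (- (\<i> * of_real k * of_real x)) * f x)))\<^sup>2) \<partial>lborel)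
       \<longlongrightarrow> 0) at_top"

definition fourier :: "(real \<Rightarrow> complex) \<Rightarrow> real \<Rightarrow> complex" where
  "fourier f = (SOME g. is_fourier f g)"

definition fourier_real :: "(real \<Rightarrow> real) \<Rightarrow> real \<Rightarrow> complex" where
  "fourier_real f = fourier (\<lambda>x. complex_of_real (f x))"

text \<open>\<open>has_symbol_image m f g\<close>: the operator with Fourier symbol \<open>m\<close> maps \<open>f\<close> to an \<open>L\<^sup>2\<close>
  function, namely \<open>g\<close> (up to null sets). The symbols below satisfy \<open>m (-k) = cnj (m k)\<close> for
  \<open>k \<noteq> 0\<close>, so they map real functions to real functions.\<close>

definition has_symbol_image :: "(real \<Rightarrow> complex) \<Rightarrow> (real \<Rightarrow> real) \<Rightarrow> (real \<Rightarrow> real) \<Rightarrow> bool" where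
  "has_symbol_image m f g \<longleftrightarrow> square_integrable g \<and>
     (AE k in lborel. fourier_real g k = m k * fourier_real f k)"

definition fourier_op :: "(real \<Rightarrow> complex) \<Rightarrow> (real \<Rightarrow> real) \<Rightarrow> real \<Rightarrow> real" where
  "fourier_op m f = (SOME g. has_symbol_image m f g)"

definition dx_symbol :: "real \<Rightarrow> complex" where
  "dx_symbol k = \<i> * of_real k"

text \<open>At \<open>k = 0\<close> this symbol is 0, since \<open>inverse 0 = 0\<close>.\<close>

definition dx_inv_symbol :: "real \<Rightarrow> complex" where
  "dx_inv_symbol k = inverse (\<i> * of_real k)"

definition half_symbol :: "real \<Rightarrow> complex" where
  "half_symbol k = of_real (sqrt \<bar>k\<bar>)"

definition hilbert_symbol :: "real \<Rightarrow> complex" where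
  "hilbert_symbol k = - \<i> * of_real (sgn k)"

abbreviation dx :: "(real \<Rightarrow> real) \<Rightarrow> real \<Rightarrow> real" where
  "dx \<equiv> fourier_op dx_symbol"

abbreviation dx_inv :: "(real \<Rightarrow> real) \<Rightarrow> real \<Rightarrow> real" where
  "dx_inv \<equiv> fourier_op dx_inv_symbol"

abbreviation D_half :: "(real \<Rightarrow> real) \<Rightarrow> real \<Rightarrow> real" where
  "D_half \<equiv> fourier_op half_symbol"

abbreviation hilbert :: "(real \<Rightarrow> real) \<Rightarrow> real \<Rightarrow> real" where
  "hilbert \<equiv> fourier_op hilbert_symbol"

definition sobolev :: "real \<Rightarrow> (real \<Rightarrow> real) set" where
  "sobolev s = {f. square_integrable f \<and>
     integrable lborel (\<lambda>k. (1 + k\<^sup>2) powr s * (cmod (fourier_real f k))\<^sup>2)}"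

definition H_space :: "(real \<Rightarrow> real) set" where
  "H_space = {\<phi> \<in> sobolev (3/2). \<exists>\<psi>. has_symbol_image dx_inv_symbol \<phi> \<psi>}"

text \<open>This is \<open>\<parallel>\<partial>\<^sub>x \<phi>\<parallel> + \<parallel>D\<^sub>x\<^bsup>1/2\<^esup> \<phi>\<parallel> + \<parallel>\<partial>\<^sub>x\<^bsup>-1\<^esup> \<phi>\<parallel>\<close>, the norm comparable with
  the square root of the quadratic functional below. On the space above it is strictly weaker than
  the norm \<open>\<parallel>\<phi>\<parallel>\<close> in \<open>H\<^bsup>3/2\<^esup>\<close> plus \<open>\<parallel>\<partial>\<^sub>x\<^bsup>-1\<^esup> \<phi>\<parallel>\<close>, for which minimizing sequences
  are in general not relatively compact modulo translations.\<close>

definition H_norm :: "(real \<Rightarrow> real) \<Rightarrow> real" where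
  "H_norm \<phi> = L2norm (dx \<phi>) + L2norm (D_half \<phi>) + L2norm (dx_inv \<phi>)"

definition I_fun :: "real \<Rightarrow> real \<Rightarrow> real \<Rightarrow> real \<Rightarrow> real \<Rightarrow> (real \<Rightarrow> real) \<Rightarrow> real" where
  "I_fun \<alpha> \<beta> \<gamma> \<delta> cs u = (LINT x|lborel.
     - (cs - \<alpha>) * (u x)\<^sup>2 - \<beta> * u x * hilbert (dx u) x + \<gamma> * (dx_inv u x)\<^sup>2 + \<delta> * (dx u x)\<^sup>2)"

definition K_fun :: "real \<Rightarrow> (real \<Rightarrow> real) \<Rightarrow> (real \<Rightarrow> real) \<Rightarrow> real" where
  "K_fun p F u = - (p + 1) * (LINT x|lborel. F (u x))"

definition M_inf ::
  "real \<Rightarrow> real \<Rightarrow> real \<Rightarrow> real \<Rightarrow> real \<Rightarrow> real \<Rightarrow> (real \<Rightarrow> real) \<Rightarrow> real \<Rightarrow> real" where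
  "M_inf \<alpha> \<beta> \<gamma> \<delta> cs p F l = Inf (I_fun \<alpha> \<beta> \<gamma> \<delta> cs ` {u \<in> H_space. K_fun p F u = l})"

text \<open>\<open>is_real_power x p y\<close>: for \<open>p \<ge> 0\<close> and \<open>x \<noteq> 0\<close>, the power \<open>x\<^sup>p\<close> is meaningful as a real
  number and equals \<open>y\<close>. For \<open>x < 0\<close> this requires \<open>p\<close> to be a fraction with odd denominator, in
  particular any natural number. The library function \<open>powr\<close> is only meant for positive base.\<close>

definition is_real_power :: "real \<Rightarrow> real \<Rightarrow> real \<Rightarrow> bool" where
  "is_real_power x p y \<longleftrightarrow> (x > 0 \<and> y = x powr p) \<or>
     (x < 0 \<and> (\<exists>m n :: nat. odd n \<and> p = real m / real n \<and> y = root n x ^ m))"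

definition homogeneous :: "real \<Rightarrow> (real \<Rightarrow> real) \<Rightarrow> bool" where
  "homogeneous p f \<longleftrightarrow>
     (\<forall>l s y. l \<noteq> 0 \<longrightarrow> s \<noteq> 0 \<longrightarrow> is_real_power l p y \<longrightarrow> f (l * s) = y * f s)"

definition z_plus :: "real \<Rightarrow> real \<Rightarrow> real \<Rightarrow> real" where
  "z_plus \<beta> \<gamma> \<delta> = (1/2) * (- \<beta> * (1 + \<beta> / (4 * \<delta>))
     + (4 * \<delta> - \<beta>) * sqrt (\<gamma> / \<delta> + (\<beta> / (4 * \<delta>))\<^sup>2))"

end

theory Submission
  imports Defs "HOL-Probability.Characteristic_Functions" "HOL-Probability.Sinc_Integral"
    "HOL-Library.Diagonal_Subsequence"
begin

text \<open>
  The conditions on the parameters make the symbol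
  \<open>q(k) = \<gamma> / k\<^sup>2 + \<delta> k\<^sup>2 - \<beta> \<bar>k\<bar> - (c\<^sub>s - \<alpha>)\<close> of the quadratic functional \<open>I\<close> coercive, so that
  minimizing sequences are bounded in the form domain of \<open>I\<close>, which embeds into \<open>L\<^sup>\<infinity>\<close>. Since
  \<open>K = \<lambda> > 0\<close> along the sequence, its members do not become uniformly small, and after translations
  a subsequence converges weakly and pointwise to some \<open>v \<noteq> 0\<close>. Both functionals split:
  \<open>I(u\<^sub>n) = I(v) + I(u\<^sub>n - v) + o(1)\<close>, and likewise for \<open>K\<close> by a Brezis-Lieb argument. By homogeneity
  \<open>I(w) \<ge> M\<^sub>\<lambda> (K(w) / \<lambda>)\<^bsup>2/(p+1)\<^esup>\<close> whenever \<open>K(w) > 0\<close>, and the exponent is less than \<open>1\<close>; strict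
  concavity then forces \<open>K(v) = \<lambda>\<close> and \<open>I(u\<^sub>n - v) \<longrightarrow> 0\<close>. That \<open>v\<close> has the regularity \<open>H\<^bsup>3/2\<^esup>\<close>, which
  the form domain does not give, follows from its minimality: it implies that \<open>q\<close> times the
  transform of \<open>v\<close> is square integrable.
\<close>

section \<open>Square-integrable functions\<close>

text \<open>All estimates are made in \<open>L^2\<close>: a function u is represented by G, the
  square root of the symbol times its Fourier transform, so that 2 \<pi> I(u) is exactly the squared
  norm of G. Coercivity makes 1 / sqrt q square integrable. By Cauchy-Schwarz this bounds u
  uniformly and makes point evaluations inner products with fixed functions. Uniform bounds also
  tame the nonlinearity: on bounded sets F(s) is at most a constant times s^2, although its degree p
  + 1 is larger.

  The obstacle is that I controls only one derivative, so the space over which the infimum is taken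
  is not complete for the norm given by I, and weak limits may leave it. The lower bound by the
  infimum is therefore first extended to all admissible G by density, and the missing regularity is
  recovered at the end from minimality.

  Positivity of the infimum comes out of the compactness argument: the translations keep a lower
  bound for the functions at the origin, so the limit is nonzero there, and the remainder has
  nonnegative energy.\<close>

lemma square_integrableD:
  "square_integrable f \<Longrightarrow> f \<in> borel_measurable lborel"
  by (simp add: square_integrable_def)

lemma square_integrable_sqD:
  "square_integrable f \<Longrightarrow> integrable lborel (\<lambda>x. (norm (f x))\<^sup>2)"
  by (simp add: square_integrable_def)

lemma L2norm_nonneg [simp]: "0 \<le> L2norm f"
  by (simp add: L2norm_def)

lemma L2norm_sq: "(L2norm f)\<^sup>2 = (LINT x|lborel. (norm (f x))\<^sup>2)"
  by (simp add: L2norm_def)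

lemma nn_integral_L2norm:
  assumes "square_integrable f"
  shows "(\<integral>\<^sup>+x. ennreal ((norm (f x))\<^sup>2) \<partial>lborel) = ennreal ((L2norm f)\<^sup>2)"
  unfolding L2norm_sq using assms by (intro nn_integral_eq_integral) (auto dest: square_integrable_sqD)

lemma square_integrable_iff_nn:
  "square_integrable f \<longleftrightarrow> f \<in> borel_measurable lborel
     \<and> (\<integral>\<^sup>+x. ennreal ((norm (f x))\<^sup>2) \<partial>lborel) < \<infinity>"
  unfolding square_integrable_def by (subst integrable_iff_bounded) auto

lemma square_integrable_nn_bound:
  assumes "f \<in> borel_measurable lborel" "(\<integral>\<^sup>+x. ennreal ((norm (f x))\<^sup>2) \<partial>lborel) \<le> ennreal (c\<^sup>2)" "0 \<le> c"
  shows "square_integrable f" "L2norm f \<le> c"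
proof -
  show sq: "square_integrable f"
    using assms by (auto simp: square_integrable_iff_nn intro: le_less_trans)
  have "(L2norm f)\<^sup>2 \<le> c\<^sup>2"
    using assms(2) unfolding nn_integral_L2norm[OF sq] by simp
  then show "L2norm f \<le> c"
    using assms(3) by (rule power2_le_imp_le)
qed

lemma L2norm_cong_AE:
  assumes "AE x in lborel. f x = g x" "f \<in> borel_measurable lborel" "g \<in> borel_measurable lborel"
  shows "L2norm f = L2norm g"
  unfolding L2norm_def using assms
  by (intro arg_cong[where f=sqrt] integral_cong_AE) auto

lemma square_integrable_bound:
  assumes f: "square_integrable f" and g: "g \<in> borel_measurable lborel"
    and le: "AE x in lborel. norm (g x) \<le> c * norm (f x)"
  shows "square_integrable g"
  unfolding square_integrable_def
proof
  show "integrable lborel (\<lambda>x. (norm (g x))\<^sup>2)"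
  proof (rule Bochner_Integration.integrable_bound)
    show "integrable lborel (\<lambda>x. c\<^sup>2 * (norm (f x))\<^sup>2)"
      using square_integrable_sqD[OF f] by simp
    show "AE x in lborel. norm ((norm (g x))\<^sup>2) \<le> norm (c\<^sup>2 * (norm (f x))\<^sup>2)"
      using le
    proof eventually_elim
      case (elim x)
      from power_mono[OF elim norm_ge_zero, of 2] show ?case
        by (simp add: power_mult_distrib)
    qed
  qed (use g in measurable)
qed fact

lemma L2norm_mono:
  assumes f: "square_integrable f" and g: "g \<in> borel_measurable lborel"
    and le: "AE x in lborel. norm (g x) \<le> norm (f x)"
  shows "L2norm g \<le> L2norm f"
proof -
  have "square_integrable g"
    using square_integrable_bound[OF f g, of 1] le by simp
  then show ?thesis
    unfolding L2norm_def using f le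
    by (intro real_sqrt_le_mono integral_mono_AE)
       (auto dest!: square_integrable_sqD elim!: eventually_mono intro: power_mono)
qed

lemma square_integrable_scaleR:
  "square_integrable f \<Longrightarrow> square_integrable (\<lambda>x. c *\<^sub>R f x)"
  by (rule square_integrable_bound[where f=f and c="\<bar>c\<bar>"])
     (auto simp: square_integrable_def)

lemma square_integrable_cmult:
  fixes f :: "real \<Rightarrow> complex"
  shows "square_integrable f \<Longrightarrow> square_integrable (\<lambda>x. c * f x)"
  by (rule square_integrable_bound[where f=f and c="cmod c"])
     (auto simp: norm_mult square_integrable_def)

lemma L2norm_scaleR: "L2norm (\<lambda>x. c *\<^sub>R f x) = \<bar>c\<bar> * L2norm f"
  by (simp add: L2norm_def power_mult_distrib real_sqrt_mult)

lemma L2norm_cmult: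
  fixes f :: "real \<Rightarrow> complex"
  shows "L2norm (\<lambda>x. c * f x) = cmod c * L2norm f"
  by (simp add: L2norm_def norm_mult power_mult_distrib real_sqrt_mult)

lemma L2norm_cong_norm: "(\<And>x. norm (f x) = norm (g x)) \<Longrightarrow> L2norm f = L2norm g"
  by (simp add: L2norm_def)

lemma square_integrable_add:
  assumes "square_integrable f" "square_integrable g"
  shows "square_integrable (\<lambda>x. f x + g x)"
  unfolding square_integrable_def
proof
  note [measurable] = assms[THEN square_integrableD]
  show "(\<lambda>x. f x + g x) \<in> borel_measurable lborel" by measurable
  show "integrable lborel (\<lambda>x. (norm (f x + g x))\<^sup>2)"
  proof (rule Bochner_Integration.integrable_bound)
    show "integrable lborel (\<lambda>x. 2 * (norm (f x))\<^sup>2 + 2 * (norm (g x))\<^sup>2)"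
      using assms[THEN square_integrable_sqD] by simp
    have "(norm (f x + g x))\<^sup>2 \<le> 2 * (norm (f x))\<^sup>2 + 2 * (norm (g x))\<^sup>2" for x
    proof -
      have "(norm (f x + g x))\<^sup>2 \<le> (norm (f x) + norm (g x))\<^sup>2"
        by (intro power_mono norm_triangle_ineq) auto
      also have "\<dots> \<le> 2 * (norm (f x))\<^sup>2 + 2 * (norm (g x))\<^sup>2"
        using sum_squares_bound[of "norm (f x)" "norm (g x)"] by (simp add: power2_sum)
      finally show ?thesis .
    qed
    then show "AE x in lborel. norm ((norm (f x + g x))\<^sup>2) \<le> norm (2 * (norm (f x))\<^sup>2 + 2 * (norm (g x))\<^sup>2)"
      by simp
  qed measurable
qed

lemma square_integrable_diff:
  assumes "square_integrable f" "square_integrable g"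
  shows "square_integrable (\<lambda>x. f x - g x)"
  using square_integrable_add[OF assms(1) square_integrable_scaleR[OF assms(2), of "-1"]] by simp

lemma integrable_norm_mult:
  assumes "square_integrable f" "square_integrable g"
  shows "integrable lborel (\<lambda>x. norm (f x) * norm (g x))"
proof (rule Bochner_Integration.integrable_bound)
  note [measurable] = assms[THEN square_integrableD]
  show "integrable lborel (\<lambda>x. (norm (f x))\<^sup>2 + (norm (g x))\<^sup>2)"
    using assms[THEN square_integrable_sqD] by simp
  have "norm (f x) * norm (g x) \<le> (norm (f x))\<^sup>2 + (norm (g x))\<^sup>2" for x
  proof -
    have "0 \<le> norm (f x) * norm (g x)" by simp
    then show ?thesis
      using sum_squares_bound[of "norm (f x)" "norm (g x)"] by linarith
  qed
  then show "AE x in lborel. norm (norm (f x) * norm (g x)) \<le> norm ((norm (f x))\<^sup>2 + (norm (g x))\<^sup>2)"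
    by simp
qed (use assms[THEN square_integrableD] in measurable)

lemma L2_Cauchy_Schwarz:
  assumes "square_integrable f" "square_integrable g"
  shows "(LINT x|lborel. norm (f x) * norm (g x)) \<le> L2norm f * L2norm g"
proof -
  note [measurable] = assms[THEN square_integrableD]
  have "(\<integral>\<^sup>+x. ennreal (norm (f x)) * ennreal (norm (g x)) \<partial>lborel)\<^sup>2
     \<le> (\<integral>\<^sup>+x. (ennreal (norm (f x)))\<^sup>2 \<partial>lborel) * (\<integral>\<^sup>+x. (ennreal (norm (g x)))\<^sup>2 \<partial>lborel)"
    by (rule Cauchy_Schwarz_nn_integral) measurable
  also have "\<dots> = ennreal ((L2norm f * L2norm g)\<^sup>2)"
    using nn_integral_L2norm[OF assms(1)] nn_integral_L2norm[OF assms(2)]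
    by (simp add: ennreal_power ennreal_mult' power_mult_distrib)
  also have "(\<integral>\<^sup>+x. ennreal (norm (f x)) * ennreal (norm (g x)) \<partial>lborel)
     = ennreal (LINT x|lborel. norm (f x) * norm (g x))"
    by (subst nn_integral_eq_integral[symmetric])
       (auto simp: ennreal_mult' intro: integrable_norm_mult assms)
  finally have "(LINT x|lborel. norm (f x) * norm (g x))\<^sup>2 \<le> (L2norm f * L2norm g)\<^sup>2"
    by (simp add: ennreal_power)
  then show ?thesis
    by (rule power2_le_imp_le) simp
qed

lemma L2norm_triangle:
  assumes "square_integrable f" "square_integrable g"
  shows "L2norm (\<lambda>x. f x + g x) \<le> L2norm f + L2norm g"
proof -
  have "(L2norm (\<lambda>x. f x + g x))\<^sup>2 \<le>
    (LINT x|lborel. (norm (f x))\<^sup>2 + (norm (g x))\<^sup>2 + 2 * (norm (f x) * norm (g x)))"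
    unfolding L2norm_sq
  proof (rule integral_mono)
    show "integrable lborel (\<lambda>x. (norm (f x + g x))\<^sup>2)"
      by (intro square_integrable_sqD square_integrable_add assms)
    show "integrable lborel (\<lambda>x. (norm (f x))\<^sup>2 + (norm (g x))\<^sup>2 + 2 * (norm (f x) * norm (g x)))"
      using assms[THEN square_integrable_sqD] integrable_norm_mult[OF assms] by simp
    fix x
    have "(norm (f x + g x))\<^sup>2 \<le> (norm (f x) + norm (g x))\<^sup>2"
      by (intro power_mono norm_triangle_ineq) auto
    then show "(norm (f x + g x))\<^sup>2 \<le> (norm (f x))\<^sup>2 + (norm (g x))\<^sup>2 + 2 * (norm (f x) * norm (g x))"
      by (simp add: power2_sum)
  qed
  also have "\<dots> = (L2norm f)\<^sup>2 + (L2norm g)\<^sup>2 + 2 * (LINT x|lborel. norm (f x) * norm (g x))"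
    using assms[THEN square_integrable_sqD] integrable_norm_mult[OF assms]
    by (simp add: L2norm_sq)
  also have "\<dots> \<le> (L2norm f + L2norm g)\<^sup>2"
    using L2_Cauchy_Schwarz[OF assms] by (simp add: power2_sum)
  finally show ?thesis
    by (rule power2_le_imp_le) simp
qed

lemma L2norm_minus_commute: "L2norm (\<lambda>x. f x - g x) = L2norm (\<lambda>x. g x - f x)"
  by (rule L2norm_cong_norm) (rule norm_minus_commute)

lemma L2norm_triangle3:
  assumes "square_integrable f" "square_integrable g" "square_integrable h"
  shows "L2norm (\<lambda>x. f x - h x) \<le> L2norm (\<lambda>x. f x - g x) + L2norm (\<lambda>x. g x - h x)"
  using L2norm_triangle[OF square_integrable_diff[OF assms(1,2)] square_integrable_diff[OF assms(2,3)]]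
  by simp

lemma L2norm_triangle_sub:
  assumes "square_integrable f" "square_integrable g"
  shows "\<bar>L2norm f - L2norm g\<bar> \<le> L2norm (\<lambda>x. f x - g x)"
  using L2norm_triangle[OF square_integrable_diff[OF assms] assms(2)]
    L2norm_triangle[OF square_integrable_diff[OF assms(2,1)] assms(1)]
    L2norm_minus_commute[of f g]
  by simp

lemma L2norm_eq_0:
  assumes "square_integrable f" "L2norm f = 0"
  shows "AE x in lborel. f x = 0"
proof -
  have "AE x in lborel. (norm (f x))\<^sup>2 = 0"
    using assms unfolding L2norm_def
    by (subst integral_nonneg_eq_0_iff_AE[symmetric]) (auto dest: square_integrable_sqD)
  then show ?thesis by simp
qed

text \<open>Square integrability of the limit is a conclusion here. Uniform bounds thereby place
  limits in \<open>L^2\<close>, both in the completeness proof and for the frequency truncations of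
  the minimizer.\<close>

lemma L2norm_Fatou:
  assumes f: "\<And>n. square_integrable (f n)" and le: "\<And>n::nat. L2norm (f n) \<le> c"
    and lim: "AE x in lborel. (\<lambda>n. f n x) \<longlonglongrightarrow> g x" and g: "g \<in> borel_measurable lborel"
  shows "square_integrable g" "L2norm g \<le> c"
proof -
  note [measurable] = f[THEN square_integrableD]
  have c: "0 \<le> c" using le[of 0] L2norm_nonneg[of "f 0"] by linarith
  have "(\<integral>\<^sup>+x. ennreal ((norm (g x))\<^sup>2) \<partial>lborel)
     = (\<integral>\<^sup>+x. liminf (\<lambda>n. ennreal ((norm (f n x))\<^sup>2)) \<partial>lborel)"
  proof (rule nn_integral_cong_AE)
    show "AE x in lborel. ennreal ((norm (g x))\<^sup>2) = liminf (\<lambda>n. ennreal ((norm (f n x))\<^sup>2))"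
      using lim
    proof eventually_elim
      case (elim x)
      then have "(\<lambda>n. ennreal ((norm (f n x))\<^sup>2)) \<longlonglongrightarrow> ennreal ((norm (g x))\<^sup>2)"
        by (intro tendsto_intros)
      then show ?case
        by (metis lim_imp_Liminf sequentially_bot)
    qed
  qed
  also have "\<dots> \<le> liminf (\<lambda>n. \<integral>\<^sup>+x. ennreal ((norm (f n x))\<^sup>2) \<partial>lborel)"
    by (rule nn_integral_liminf) measurable
  also have "\<dots> \<le> liminf (\<lambda>n::nat. ennreal (c\<^sup>2))"
    unfolding nn_integral_L2norm[OF f]
    by (intro Liminf_mono always_eventually allI ennreal_leI power_mono le) simp
  also have "\<dots> = ennreal (c\<^sup>2)" by (simp add: Liminf_const)
  finally have *: "(\<integral>\<^sup>+x. ennreal ((norm (g x))\<^sup>2) \<partial>lborel) \<le> ennreal (c\<^sup>2)" .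
  show "square_integrable g" "L2norm g \<le> c"
    using square_integrable_nn_bound[OF g * c] by auto
qed

text \<open>Riesz-Fischer: a rapidly Cauchy subsequence converges almost everywhere, and Fatou's
  lemma turns the Cauchy condition into convergence in norm to its limit.\<close>

lemma L2norm_complete:
  fixes f :: "nat \<Rightarrow> real \<Rightarrow> 'a::{banach, second_countable_topology}"
  assumes f: "\<And>n. square_integrable (f n)"
    and Cauchy: "\<And>e. e > 0 \<Longrightarrow> \<exists>N. \<forall>m\<ge>N. \<forall>n\<ge>N. L2norm (\<lambda>x. f m x - f n x) < e"
  obtains g where "square_integrable g" "(\<lambda>n. L2norm (\<lambda>x. f n x - g x)) \<longlonglongrightarrow> 0"
proof -
  note [measurable] = f[THEN square_integrableD]
  have "\<exists>N. \<forall>m\<ge>N. \<forall>n\<ge>N. L2norm (\<lambda>x. f m x - f n x) < (1/4) ^ k" for k :: nat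
    by (rule Cauchy) simp
  then obtain N where N: "\<And>k m n. m \<ge> N k \<Longrightarrow> n \<ge> N k \<Longrightarrow> L2norm (\<lambda>x. f m x - f n x) < (1/4) ^ k"
    by metis
  \<comment> \<open>The maximum makes \<open>r\<close> strictly increasing and keeps
    \<open>r k\<close> beyond \<open>N k\<close>.\<close>
  define r where "r = rec_nat (N 0) (\<lambda>k rk. max (Suc rk) (N (Suc k)))"
  have rN: "r k \<ge> N k" for k by (cases k) (auto simp: r_def)
  have r_Suc: "r (Suc k) > r k" for k by (auto simp: r_def)
  have r: "strict_mono r" by (rule strict_monoI_Suc) (rule r_Suc)
  have rN': "r (Suc k) \<ge> N k" for k using rN[of k] r_Suc[of k] by simp
  define d where "d k x = f (r (Suc k)) x - f (r k) x" for k x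
  have [measurable]: "d k \<in> borel_measurable lborel" for k unfolding d_def by measurable
  have sd: "square_integrable (d k)" for k
    unfolding d_def by (intro square_integrable_diff f)
  have dn: "L2norm (d k) \<le> (1/4)^k" for k
    unfolding d_def using N[OF rN' rN, of k] by simp
  \<comment> \<open>The squared norms are at most 16^-k. The weight 4^k leaves the sum of the
    integrals finite and still forces \<open>norm (d k x)\<close> below (1/2)^k eventually, at
    almost every point.\<close>
  have "(\<integral>\<^sup>+x. (\<Sum>k. ennreal (4^k * (norm (d k x))\<^sup>2)) \<partial>lborel)
      = (\<Sum>k. \<integral>\<^sup>+x. ennreal (4^k * (norm (d k x))\<^sup>2) \<partial>lborel)"
    by (rule nn_integral_suminf) measurable
  also have "\<dots> \<le> (\<Sum>k. ennreal ((1/4)^k))"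
  proof (intro suminf_le allI)
    fix k
    have "(\<integral>\<^sup>+x. ennreal (4^k * (norm (d k x))\<^sup>2) \<partial>lborel) = ennreal (4^k) * ennreal ((L2norm (d k))\<^sup>2)"
      by (subst nn_integral_L2norm[OF sd, symmetric]) (simp add: ennreal_mult' nn_integral_cmult)
    also have "\<dots> \<le> ennreal (4^k) * ennreal (((1/4)^k)\<^sup>2)"
      by (intro mult_left_mono ennreal_leI power_mono dn) auto
    also have "\<dots> = ennreal ((1/4)^k)"
      by (simp add: ennreal_mult'[symmetric] power2_eq_square power_mult_distrib[symmetric] field_simps)
    finally show "(\<integral>\<^sup>+x. ennreal (4^k * (norm (d k x))\<^sup>2) \<partial>lborel) \<le> ennreal ((1/4)^k)" .
  qed auto
  also have "\<dots> = ennreal (\<Sum>k. (1/4)^k)"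
    by (rule suminf_ennreal2) (auto intro: summable_geometric)
  also have "\<dots> < \<infinity>" by simp
  finally have "AE x in lborel. (\<Sum>k. ennreal (4^k * (norm (d k x))\<^sup>2)) \<noteq> \<infinity>"
    by (intro nn_integral_PInf_AE) auto
  then have conv: "AE x in lborel. convergent (\<lambda>k. f (r k) x)"
  proof eventually_elim
    case (elim x)
    then have "summable (\<lambda>k. 4^k * (norm (d k x))\<^sup>2)"
      by (intro summable_suminf_not_top) auto
    then have "(\<lambda>k. 4^k * (norm (d k x))\<^sup>2) \<longlonglongrightarrow> 0"
      by (rule summable_LIMSEQ_zero)
    then have "eventually (\<lambda>k. 4^k * (norm (d k x))\<^sup>2 < 1) sequentially"
      by (rule order_tendstoD) simp
    then have "eventually (\<lambda>k. norm (d k x) \<le> (1/2)^k) sequentially"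
    proof eventually_elim
      case (elim k)
      have "(2^k * norm (d k x))\<^sup>2 \<le> 1\<^sup>2"
        using elim by (simp add: power_mult_distrib power_mult[symmetric] mult.commute[of k 2] power_mult[of 2 2])
      then have "2^k * norm (d k x) \<le> 1" by (rule power2_le_imp_le) simp
      then show ?case by (simp add: field_simps power_one_over)
    qed
    then have "summable (\<lambda>k. d k x)"
      by (rule summable_comparison_test_ev) (auto intro: summable_geometric)
    then have "convergent (\<lambda>n. \<Sum>k<n. d k x)"
      by (simp add: summable_iff_convergent)
    moreover have "(\<Sum>k<n. d k x) = f (r n) x - f (r 0) x" for n
      unfolding d_def by (rule sum_lessThan_telescope)
    ultimately have "convergent (\<lambda>n. f (r n) x - f (r 0) x)" by simp
    then show ?case
      using convergent_diff_const_right_iff by blast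
  qed
  define g where "g x = lim (\<lambda>k. f (r k) x)" for x
  have [measurable]: "g \<in> borel_measurable lborel" unfolding g_def by measurable
  have lim: "AE x in lborel. (\<lambda>k. f (r k) x) \<longlonglongrightarrow> g x"
    using conv by eventually_elim (simp add: g_def convergent_LIMSEQ_iff)
  \<comment> \<open>Fatou's lemma with \<open>m\<close> fixed and the subsequence running. It starts
    at index \<open>k\<close>, so that both indices lie beyond \<open>N k\<close>.\<close>
  have *: "square_integrable (\<lambda>x. f m x - g x) \<and> L2norm (\<lambda>x. f m x - g x) \<le> (1/4)^k" if m: "m \<ge> N k" for m k
  proof -
    have a: "square_integrable (\<lambda>x. f m x - f (r (n + k)) x)" for n
      by (intro square_integrable_diff f)
    have b: "L2norm (\<lambda>x. f m x - f (r (n + k)) x) \<le> (1/4)^k" for n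
    proof -
      have "r k \<le> r (n + k)" using r by (simp add: strict_mono_less_eq)
      then have "N k \<le> r (n + k)" using rN[of k] by linarith
      from N[OF m this] show ?thesis by simp
    qed
    have c: "AE x in lborel. (\<lambda>n. f m x - f (r (n + k)) x) \<longlonglongrightarrow> f m x - g x"
      using lim by eventually_elim (intro tendsto_intros LIMSEQ_ignore_initial_segment)
    show ?thesis
      using L2norm_Fatou[OF a b c] by simp
  qed
  have "square_integrable (\<lambda>x. f (N 0) x - (f (N 0) x - g x))"
    by (intro square_integrable_diff f conjunct1[OF *[of 0]]) simp
  then have "square_integrable g" by simp
  moreover have "(\<lambda>n. L2norm (\<lambda>x. f n x - g x)) \<longlonglongrightarrow> 0"
  proof (rule LIMSEQ_I)
    fix e :: real assume "e > 0"
    then obtain k where k: "(1/4)^k < e"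
      using real_arch_pow_inv[of e "1/4"] by auto
    show "\<exists>no. \<forall>n\<ge>no. norm (L2norm (\<lambda>x. f n x - g x) - 0) < e"
      using *[of k] k by (intro exI[of _ "N k"]) (auto intro: le_less_trans)
  qed
  ultimately show ?thesis by (rule that)
qed

section \<open>Invariance under translations and reflections\<close>

lemma integrable_shift:
  fixes f :: "real \<Rightarrow> 'a :: {banach, second_countable_topology}"
  shows "integrable lborel (\<lambda>x. f (x + t)) \<longleftrightarrow> integrable lborel f"
  using lborel_integrable_real_affine_iff[of 1 f t] by (simp add: add.commute)

lemma integral_shift:
  fixes f :: "real \<Rightarrow> 'a :: {banach, second_countable_topology}"
  shows "(LINT x|lborel. f (x + t)) = (LINT x|lborel. f x)"
  using lborel_integral_real_affine[of 1 f t] by (simp add: add.commute)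

lemma integrable_reflect_lborel:
  fixes f :: "real \<Rightarrow> 'a :: {banach, second_countable_topology}"
  shows "integrable lborel (\<lambda>x. f (- x)) \<longleftrightarrow> integrable lborel f"
  using lborel_integrable_real_affine_iff[of "-1" f 0] by simp

lemma integral_reflect_lborel:
  fixes f :: "real \<Rightarrow> 'a :: {banach, second_countable_topology}"
  shows "(LINT x|lborel. f (- x)) = (LINT x|lborel. f x)"
  using lborel_integral_real_affine[of "-1" f 0] by simp

lemma square_integrable_shift:
  "square_integrable f \<Longrightarrow> square_integrable (\<lambda>x. f (x + t))"
  unfolding square_integrable_def
  using integrable_shift[of "\<lambda>x. (norm (f x))\<^sup>2" t]
    measurable_compose[of "\<lambda>x. x + t" borel borel f borel] by simp

lemma L2norm_shift: "L2norm (\<lambda>x. f (x + t)) = L2norm f"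
  unfolding L2norm_def using integral_shift[of "\<lambda>x. (norm (f x))\<^sup>2" t] by simp

lemma square_integrable_reflect:
  "square_integrable f \<Longrightarrow> square_integrable (\<lambda>x. f (- x))"
  unfolding square_integrable_def
  using integrable_reflect_lborel[of "\<lambda>x. (norm (f x))\<^sup>2"]
    measurable_compose[of uminus borel borel f borel] by simp

lemma L2norm_reflect: "L2norm (\<lambda>x. f (- x)) = L2norm f"
  unfolding L2norm_def using integral_reflect_lborel[of "\<lambda>x. (norm (f x))\<^sup>2"] by simp

lemma L2_tendsto_dominated:
  fixes f :: "nat \<Rightarrow> real \<Rightarrow> 'a::{banach, second_countable_topology}"
  assumes f: "\<And>n. f n \<in> borel_measurable lborel" and h: "square_integrable h"
    and le: "\<And>n. AE x in lborel. norm (f n x) \<le> norm (h x)"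
    and lim: "AE x in lborel. (\<lambda>n. f n x) \<longlonglongrightarrow> 0"
  shows "(\<lambda>n. L2norm (f n)) \<longlonglongrightarrow> 0"
proof -
  have "(\<lambda>n. LINT x|lborel. (norm (f n x))\<^sup>2) \<longlonglongrightarrow> (LINT x|(lborel :: real measure). (0 :: real))"
  proof (rule integral_dominated_convergence[where w="\<lambda>x. (norm (h x))\<^sup>2"])
    show "integrable lborel (\<lambda>x. (norm (h x))\<^sup>2)" by (rule square_integrable_sqD[OF h])
    show "AE x in lborel. (\<lambda>n. (norm (f n x))\<^sup>2) \<longlonglongrightarrow> 0"
      using lim by eventually_elim (auto intro!: tendsto_eq_intros)
    show "AE x in lborel. norm ((norm (f n x))\<^sup>2) \<le> (norm (h x))\<^sup>2" for n
      using le[of n] by eventually_elim (auto intro: power_mono)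
  qed (use f in measurable)
  then have "(\<lambda>n. sqrt (LINT x|lborel. (norm (f n x))\<^sup>2)) \<longlonglongrightarrow> sqrt 0"
    by (intro tendsto_intros) simp
  then show ?thesis by (simp add: L2norm_def)
qed

section \<open>The Fourier transform\<close>

definition ft :: "(real \<Rightarrow> complex) \<Rightarrow> real \<Rightarrow> complex" where
  "ft f k = (LINT x|lborel. exp (- (\<i> * of_real k * of_real x)) * f x)"

lemma cmod_exp_ikx [simp]: "cmod (exp (- (\<i> * of_real k * of_real x))) = 1"
  using norm_exp_i_times[of "- (k * x)"] by (simp add: mult.assoc)

lemma measurable_exp_ikx [measurable]:
  "(\<lambda>x. exp (- (\<i> * complex_of_real k * complex_of_real x))) \<in> borel_measurable borel"
  by (intro borel_measurable_continuous_onI continuous_intros)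

lemma integrable_exp_ikx:
  "integrable lborel f \<Longrightarrow> integrable lborel (\<lambda>x. exp (- (\<i> * of_real k * of_real x)) * f x)"
  by (rule Bochner_Integration.integrable_bound[of _ f]) (auto simp: norm_mult)

lemma ft_measurable [measurable]:
  assumes [measurable]: "f \<in> borel_measurable borel"
  shows "ft f \<in> borel_measurable borel"
proof -
  have 1: "(\<lambda>z::real \<times> real. exp (- (\<i> * complex_of_real (fst z) * complex_of_real (snd z)))) \<in> borel_measurable borel"
    by (intro borel_measurable_continuous_onI continuous_intros)
  have [measurable]: "(\<lambda>(k, x). exp (- (\<i> * complex_of_real k * complex_of_real x)) * f x)
     \<in> borel_measurable (borel \<Otimes>\<^sub>M lborel)"
    using 1 unfolding borel_prod[symmetric] by (simp add: split_beta' cong: measurable_cong_sets)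
  show ?thesis unfolding ft_def[abs_def] by measurable
qed

lemma cmod_ft_le: "cmod (ft f k) \<le> (LINT x|lborel. cmod (f x))"
  unfolding ft_def by (rule order_trans[OF integral_norm_bound]) (simp add: norm_mult)

lemma ft_diff:
  assumes "integrable lborel f" "integrable lborel g"
  shows "ft (\<lambda>x. f x - g x) k = ft f k - ft g k"
  unfolding ft_def right_diff_distrib
  by (intro Bochner_Integration.integral_diff integrable_exp_ikx assms)

lemma ft_add:
  assumes "integrable lborel f" "integrable lborel g"
  shows "ft (\<lambda>x. f x + g x) k = ft f k + ft g k"
  unfolding ft_def distrib_left
  by (intro Bochner_Integration.integral_add integrable_exp_ikx assms)

lemma ft_cmult: "ft (\<lambda>x. c * f x) k = c * ft f k"
  unfolding ft_def by (subst integral_mult_right_zero[symmetric]) (simp add: algebra_simps)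

lemma ft_cnj: "ft (\<lambda>x. cnj (f x)) k = cnj (ft f (- k))"
proof -
  have "cnj (exp (- (\<i> * of_real (- k) * of_real x)) * f x) = exp (- (\<i> * of_real k * of_real x)) * cnj (f x)" for x
    by (simp add: exp_cnj)
  then have "ft (\<lambda>x. cnj (f x)) k = (LINT x|lborel. cnj (exp (- (\<i> * of_real (- k) * of_real x)) * f x))"
    unfolding ft_def by (simp only:)
  then show ?thesis
    unfolding ft_def by (simp only: Bochner_Integration.integral_cnj)
qed

lemma ft_shift: "ft (\<lambda>x. f (x + y)) k = exp (\<i> * of_real k * of_real y) * ft f k"
proof -
  have "ft f k = (LINT x|lborel. exp (- (\<i> * of_real k * of_real (x + y))) * f (x + y))"
    unfolding ft_def by (rule integral_shift[symmetric])
  also have "\<dots> = (LINT x|lborel. exp (- (\<i> * of_real k * of_real y)) *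
      (exp (- (\<i> * of_real k * of_real x)) * f (x + y)))"
    by (intro arg_cong[where f="integral\<^sup>L lborel"] ext) (simp add: exp_add[symmetric] algebra_simps)
  also have "\<dots> = exp (- (\<i> * of_real k * of_real y)) * ft (\<lambda>x. f (x + y)) k"
    unfolding ft_def by simp
  finally show ?thesis
    by (simp add: mult.assoc[symmetric] exp_add[symmetric])
qed

text \<open>In the application \<open>h\<close> is the Fourier kernel. As it is bounded by one, the
  product of the moduli of \<open>f\<close> and \<open>g\<close> is an integrable majorant on the
  plane.\<close>

lemma integrable_pair_mult:
  fixes f g :: "real \<Rightarrow> complex"
  assumes "integrable lborel f" "integrable lborel g"
    and h: "h \<in> borel_measurable (borel \<Otimes>\<^sub>M borel)" "\<And>z. cmod (h z) \<le> 1"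
  shows "integrable (lborel \<Otimes>\<^sub>M lborel) (\<lambda>(x, y). h (x, y) * (f x * g y))"
proof (rule lborel_pair.Fubini_integrable)
  have [measurable]: "f \<in> borel_measurable borel" "g \<in> borel_measurable borel"
    using assms(1,2)[THEN borel_measurable_integrable] by auto
  note [measurable] = h(1)
  show "(\<lambda>(x, y). h (x, y) * (f x * g y)) \<in> borel_measurable (lborel \<Otimes>\<^sub>M lborel)"
    by measurable
  have b: "integrable lborel (\<lambda>y. h (x, y) * (f x * g y))" for x
  proof (rule Bochner_Integration.integrable_bound)
    show "integrable lborel (\<lambda>y. f x * g y)" using assms by simp
    show "AE y in lborel. cmod (h (x, y) * (f x * g y)) \<le> cmod (f x * g y)"
      using h(2) by (auto simp: norm_mult intro!: mult_left_le_one_le)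
  qed measurable
  then show "AE x in lborel. integrable lborel (\<lambda>y. case (x, y) of (x, y) \<Rightarrow> h (x, y) * (f x * g y))"
    by simp
  show "integrable lborel (\<lambda>x. LINT y|lborel. cmod (case (x, y) of (x, y) \<Rightarrow> h (x, y) * (f x * g y)))"
  proof (rule Bochner_Integration.integrable_bound)
    show "integrable lborel (\<lambda>x. cmod (f x) * (LINT y|lborel. cmod (g y)))"
      using assms by simp
    have "(LINT y|lborel. cmod (h (x, y) * (f x * g y))) \<le> cmod (f x) * (LINT y|lborel. cmod (g y))" for x
    proof -
      have "(LINT y|lborel. cmod (h (x, y) * (f x * g y))) \<le> (LINT y|lborel. cmod (f x) * cmod (g y))"
        using integrable_norm[OF b[of x]] assms h(2)
        by (intro integral_mono) (auto simp: norm_mult intro!: mult_left_le_one_le)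
      then show ?thesis by simp
    qed
    then show "AE x in lborel. norm (LINT y|lborel. cmod (case (x, y) of (x, y) \<Rightarrow> h (x, y) * (f x * g y)))
      \<le> norm (cmod (f x) * (LINT y|lborel. cmod (g y)))" by simp
  qed measurable
qed

text \<open>The multiplication formula, by Fubini. It moves the transform from one factor to the
  other: onto a Gaussian in Plancherel's theorem and, once extended to \<open>L^2\<close>, in the
  inversion formula.\<close>

lemma ft_mult_swap:
  assumes f: "integrable lborel f" and g: "integrable lborel g"
  shows "(LINT k|lborel. ft f k * g k) = (LINT x|lborel. f x * ft g x)"
proof -
  have m: "(\<lambda>z::real \<times> real. exp (- (\<i> * complex_of_real (fst z) * complex_of_real (snd z)))) \<in> borel_measurable (borel \<Otimes>\<^sub>M borel)"
    unfolding borel_prod by (intro borel_measurable_continuous_onI continuous_intros)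
  have "integrable (lborel \<Otimes>\<^sub>M lborel) (\<lambda>(x, k). exp (- (\<i> * complex_of_real x * complex_of_real k)) * (f x * g k))"
    using integrable_pair_mult[OF f g m] by simp
  from lborel_pair.Fubini_integral[OF this]
  have "(LINT k|lborel. LINT x|lborel. exp (- (\<i> * complex_of_real x * complex_of_real k)) * (f x * g k))
      = (LINT x|lborel. LINT k|lborel. exp (- (\<i> * complex_of_real x * complex_of_real k)) * (f x * g k))" .
  also have "(LINT k|lborel. LINT x|lborel. exp (- (\<i> * complex_of_real x * complex_of_real k)) * (f x * g k))
     = (LINT k|lborel. ft f k * g k)"
    unfolding ft_def integral_mult_left_zero[symmetric] by (simp add: mult_ac)
  also have "(LINT x|lborel. LINT k|lborel. exp (- (\<i> * complex_of_real x * complex_of_real k)) * (f x * g k))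
     = (LINT x|lborel. f x * ft g x)"
    unfolding ft_def integral_mult_right_zero[symmetric] by (simp add: mult_ac)
  finally show ?thesis .
qed

text \<open>The characteristic function of the normal distribution, rescaled. Written as a density,
  the result is visibly an approximate identity of total mass 2 \<pi> as \<open>s\<close> tends to
  zero.\<close>

lemma ft_gauss:
  assumes s: "s > 0"
  shows "integrable lborel (\<lambda>k. complex_of_real (exp (- (s * k)\<^sup>2 / 2)))"
    "ft (\<lambda>k. complex_of_real (exp (- (s * k)\<^sup>2 / 2))) t
       = complex_of_real (2 * pi / s * std_normal_density (t / s))"
proof -
  have dens: "exp (- z\<^sup>2 / 2) = sqrt (2 * pi) * std_normal_density z" for z
    by (simp add: std_normal_density_def)
  have i0: "integrable lborel std_normal_density" by simp
  have i1: "integrable lborel (\<lambda>z. complex_of_real (exp (- z\<^sup>2 / 2)))"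
    unfolding dens using i0 by (intro integrable_of_real) simp
  show "integrable lborel (\<lambda>k. complex_of_real (exp (- (s * k)\<^sup>2 / 2)))"
    using lborel_integrable_real_affine[OF i1, of s 0] s by simp
  have "char std_normal_distribution (- (t / s)) = (LINT x|lborel. std_normal_density x *\<^sub>R iexp (- (t / s) * x))"
    unfolding char_def by (subst integral_density) auto
  then have c: "(LINT x|lborel. std_normal_density x *\<^sub>R iexp (- (t / s) * x)) = complex_of_real (exp (- (t/s)\<^sup>2 / 2))"
    using char_std_normal_distribution by simp
  have "ft (\<lambda>k. complex_of_real (exp (- (s * k)\<^sup>2 / 2))) t
     = (1 / s) *\<^sub>R (LINT z|lborel. exp (- (\<i> * of_real t * of_real (z / s))) * complex_of_real (exp (- z\<^sup>2 / 2)))"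
    unfolding ft_def using s by (subst lborel_integral_real_affine[of "1 / s" _ 0]) (auto simp: )
  also have "(LINT z|lborel. exp (- (\<i> * of_real t * of_real (z / s))) * complex_of_real (exp (- z\<^sup>2 / 2)))
     = (LINT z|lborel. sqrt (2 * pi) *\<^sub>R (std_normal_density z *\<^sub>R iexp (- (t / s) * z)))"
    unfolding dens by (intro arg_cong[where f="integral\<^sup>L lborel"] ext) (simp add: scaleR_conv_of_real field_simps)
  also have "\<dots> = sqrt (2 * pi) *\<^sub>R complex_of_real (exp (- (t/s)\<^sup>2 / 2))"
    unfolding c[symmetric] by (rule integral_scaleR_right)
  finally show "ft (\<lambda>k. complex_of_real (exp (- (s * k)\<^sup>2 / 2))) t
       = complex_of_real (2 * pi / s * std_normal_density (t / s))"
    unfolding dens by (simp add: scaleR_conv_of_real flip: of_real_mult)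
qed

section \<open>Continuity of translations in the mean\<close>

text \<open>The modulus of the difference of two indicators is their sum minus twice their product.
  After integration only the product depends on the shift, and for an open set it converges
  pointwise: by openness at points of \<open>U\<close>, and trivially elsewhere, where it
  vanishes.\<close>

lemma L1_shift_tendsto_open:
  fixes t :: "nat \<Rightarrow> real"
  assumes t: "t \<longlonglongrightarrow> 0" and U: "open U" "emeasure lborel U < \<infinity>"
  shows "(\<lambda>n. LINT x|lborel. \<bar>indicator U (x + t n) - indicator U x :: real\<bar>) \<longlonglongrightarrow> 0"
proof -
  have [measurable]: "U \<in> sets borel" using U by auto
  let ?u = "indicator U :: real \<Rightarrow> real"
  have iU: "integrable lborel ?u" using U by (auto simp: integrable_indicator_iff)
  have iU': "integrable lborel (\<lambda>x. ?u (x + s))" for s using iU integrable_shift[of ?u s] by simp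
  have iUU: "integrable lborel (\<lambda>x. ?u (x + s) * ?u x)" for s
    by (rule Bochner_Integration.integrable_bound[OF iU]) (auto simp: indicator_def)
  have "(\<lambda>n. LINT x|lborel. ?u (x + t n) * ?u x) \<longlonglongrightarrow> (LINT x|lborel. ?u x)"
  proof (rule integral_dominated_convergence[OF _ _ iU])
    show "AE x in lborel. (\<lambda>n. ?u (x + t n) * ?u x) \<longlonglongrightarrow> ?u x"
    proof (rule AE_I2)
      fix x
      show "(\<lambda>n. ?u (x + t n) * ?u x) \<longlonglongrightarrow> ?u x"
      proof (cases "x \<in> U")
        case True
        have "(\<lambda>n. x + t n) \<longlonglongrightarrow> x" using tendsto_add[OF tendsto_const t, of x] by simp
        then have "eventually (\<lambda>n. x + t n \<in> U) sequentially"
          using topological_tendstoD U(1) True by blast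
        then have "eventually (\<lambda>n. ?u (x + t n) * ?u x = ?u x) sequentially"
          by eventually_elim (simp add: True)
        then show ?thesis by (rule tendsto_eventually)
      qed simp
    qed
  qed (auto simp: indicator_def)
  then have "(\<lambda>n. 2 * (LINT x|lborel. ?u x) - 2 * (LINT x|lborel. ?u (x + t n) * ?u x)) \<longlonglongrightarrow>
     2 * (LINT x|lborel. ?u x) - 2 * (LINT x|lborel. ?u x)"
    by (intro tendsto_intros)
  moreover have "(LINT x|lborel. \<bar>?u (x + t n) - ?u x\<bar>) = 
     2 * (LINT x|lborel. ?u x) - 2 * (LINT x|lborel. ?u (x + t n) * ?u x)" for n
  proof -
    have "(LINT x|lborel. \<bar>?u (x + t n) - ?u x\<bar>) = 
       (LINT x|lborel. ?u (x + t n) + ?u x - 2 * (?u (x + t n) * ?u x))"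
      by (intro arg_cong[where f="integral\<^sup>L lborel"] ext) (auto simp: indicator_def)
    also have "\<dots> = 2 * (LINT x|lborel. ?u x) - 2 * (LINT x|lborel. ?u (x + t n) * ?u x)"
      using iU iU'[of "t n"] iUU[of "t n"] integral_shift[of ?u "t n"] by simp
    finally show ?thesis .
  qed
  ultimately show ?thesis by simp
qed

text \<open>An approximation argument in three pieces; by translation invariance the error made in
  the shifted function equals the error made in the function itself.\<close>

lemma L1_shift_tendsto_approx:
  fixes f :: "real \<Rightarrow> 'a::{banach, second_countable_topology}" and t :: "nat \<Rightarrow> real"
  assumes f: "integrable lborel f"
    and ex: "\<And>e. e > 0 \<Longrightarrow> \<exists>g. integrable lborel g \<and> (LINT x|lborel. norm (f x - g x)) \<le> e
        \<and> (\<lambda>n. LINT x|lborel. norm (g (x + t n) - g x)) \<longlonglongrightarrow> 0"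
  shows "(\<lambda>n. LINT x|lborel. norm (f (x + t n) - f x)) \<longlonglongrightarrow> 0"
proof (rule LIMSEQ_I)
  fix e :: real assume e: "e > 0"
  then obtain g where g: "integrable lborel g" "(LINT x|lborel. norm (f x - g x)) \<le> e / 4"
    "(\<lambda>n. LINT x|lborel. norm (g (x + t n) - g x)) \<longlonglongrightarrow> 0"
    using ex[of "e / 4"] by auto
  have sf: "integrable lborel (\<lambda>x. f (x + s))" and sg: "integrable lborel (\<lambda>x. g (x + s))" for s
    using f g(1) integrable_shift by auto
  from LIMSEQ_D[OF g(3), of "e / 2"] e obtain N where
    N: "\<And>n. n \<ge> N \<Longrightarrow> (LINT x|lborel. norm (g (x + t n) - g x)) < e / 2" by auto
  have "(LINT x|lborel. norm (f (x + t n) - f x)) < e" if "n \<ge> N" for n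
  proof -
    have "(LINT x|lborel. norm (f (x + t n) - f x)) \<le>
      (LINT x|lborel. norm (f (x + t n) - g (x + t n)) + norm (g (x + t n) - g x) + norm (f x - g x))"
    proof (rule integral_mono)
      fix x
      show "norm (f (x + t n) - f x) \<le> norm (f (x + t n) - g (x + t n)) + norm (g (x + t n) - g x) + norm (f x - g x)"
        by norm
    qed (use f g(1) sf sg in auto)
    also have "\<dots> = (LINT x|lborel. norm (f (x + t n) - g (x + t n))) + (LINT x|lborel. norm (g (x + t n) - g x))
       + (LINT x|lborel. norm (f x - g x))"
      using f g(1) sf sg by simp
    also have "(LINT x|lborel. norm (f (x + t n) - g (x + t n))) = (LINT x|lborel. norm (f x - g x))"
      by (rule integral_shift[of "\<lambda>x. norm (f x - g x)"])
    finally show ?thesis using g(2) N[OF that] by linarith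
  qed
  then show "\<exists>no. \<forall>n\<ge>no. norm ((LINT x|lborel. norm (f (x + t n) - f x)) - 0) < e"
    by (intro exI[of _ N]) auto
qed

lemma L1_shift_tendsto:
  fixes f :: "real \<Rightarrow> 'a::{banach, second_countable_topology}" and t :: "nat \<Rightarrow> real"
  assumes "integrable lborel f" and t: "t \<longlonglongrightarrow> 0"
  shows "(\<lambda>n. LINT x|lborel. norm (f (x + t n) - f x)) \<longlonglongrightarrow> 0"
  using assms(1)
proof (induction rule: integrable_induct)
  case (base A c)
  show ?case
  proof (rule L1_shift_tendsto_approx)
    show iA: "integrable lborel (\<lambda>x. indicator A x *\<^sub>R c)" using base by (auto intro!: integrable_scaleR_left)
    fix e :: real assume e: "e > 0"
    have A: "A \<in> sets borel" "emeasure lborel A < \<infinity>" using base by auto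
    \<comment> \<open>The summand 1 covers the case \<open>c = 0\<close>.\<close>
    define d where "d = e / (norm c + 1)"
    have d: "d > 0" unfolding d_def using e by (simp add: add_nonneg_pos)
    \<comment> \<open>Outer regularity replaces a measurable set by an open one, for which the claim
      is already known.\<close>
    obtain U where U: "open U" "A \<subseteq> U" "emeasure lborel (U - A) < ennreal d"
      using outer_regular_lborel[of A d] A d by (auto simp: )
    have [measurable]: "A \<in> sets borel" "U \<in> sets borel" using A U by auto
    have "emeasure lborel U = emeasure lborel A + emeasure lborel (U - A)"
      using U by (subst plus_emeasure) (auto intro!: arg_cong[where f="emeasure lborel"])
    also have "\<dots> < \<infinity>" using A U(3) by (auto simp: ennreal_add_less_top intro: less_trans)
    finally have fU: "emeasure lborel U < \<infinity>" .
    have iU: "integrable lborel (\<lambda>x. indicator U x *\<^sub>R c)" using fU by (auto intro!: integrable_scaleR_left)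
    have mU: "measure lborel (U - A) \<le> d"
      using U(3) d by (simp add: measure_def enn2real_leI less_imp_le)
    have "(LINT x|lborel. norm (indicator A x *\<^sub>R c - indicator U x *\<^sub>R c)) = (LINT x|lborel. norm c * indicator (U - A) x)"
      using U(2) by (intro arg_cong[where f="integral\<^sup>L lborel"] ext) (auto simp: indicator_def)
    also have "\<dots> = norm c * measure lborel (U - A)" by simp
    also have "\<dots> \<le> norm c * d" by (intro mult_left_mono mU) simp
    also have "\<dots> \<le> e" unfolding d_def using e
      by (simp add: pos_divide_le_eq add_nonneg_pos distrib_left mult.commute)
    finally have 1: "(LINT x|lborel. norm (indicator A x *\<^sub>R c - indicator U x *\<^sub>R c)) \<le> e" .
    have "(\<lambda>n. norm c * (LINT x|lborel. \<bar>indicator U (x + t n) - indicator U x :: real\<bar>)) \<longlonglongrightarrow> norm c * 0"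
      by (intro tendsto_intros L1_shift_tendsto_open t U fU)
    moreover have "norm c * (LINT x|lborel. \<bar>indicator U (x + t n) - indicator U x :: real\<bar>)
        = (LINT x|lborel. norm (indicator U (x + t n) *\<^sub>R c - indicator U x *\<^sub>R c))" for n
      by (simp flip: integral_mult_right_zero scaleR_diff_left add: mult.commute)
    ultimately have "(\<lambda>n. LINT x|lborel. norm (indicator U (x + t n) *\<^sub>R c - indicator U x *\<^sub>R c)) \<longlonglongrightarrow> 0"
      by simp
    with iU 1 show "\<exists>g. integrable lborel g \<and> (LINT x|lborel. norm (indicator A x *\<^sub>R c - g x)) \<le> e
        \<and> (\<lambda>n. LINT x|lborel. norm (g (x + t n) - g x)) \<longlonglongrightarrow> 0"
      by (intro exI[of _ "\<lambda>x. indicator U x *\<^sub>R c"]) auto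
  qed
next
  case (add f g)
  have sf: "integrable lborel (\<lambda>x. f (x + s))" and sg: "integrable lborel (\<lambda>x. g (x + s))" for s
    using add integrable_shift by auto
  show ?case
  proof (rule tendsto_sandwich[OF _ _ tendsto_const])
    show "\<forall>\<^sub>F n in sequentially. 0 \<le> (LINT x|lborel. norm (f (x + t n) + g (x + t n) - (f x + g x)))"
      by simp
    show "\<forall>\<^sub>F n in sequentially. (LINT x|lborel. norm (f (x + t n) + g (x + t n) - (f x + g x))) \<le>
       (LINT x|lborel. norm (f (x + t n) - f x)) + (LINT x|lborel. norm (g (x + t n) - g x))"
    proof (intro always_eventually allI)
      fix n
      have "(LINT x|lborel. norm (f (x + t n) + g (x + t n) - (f x + g x))) \<le>
       (LINT x|lborel. norm (f (x + t n) - f x) + norm (g (x + t n) - g x))"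
        using add sf sg by (intro integral_mono) (auto simp: norm_diff_triangle_ineq)
      then show "(LINT x|lborel. norm (f (x + t n) + g (x + t n) - (f x + g x))) \<le>
       (LINT x|lborel. norm (f (x + t n) - f x)) + (LINT x|lborel. norm (g (x + t n) - g x))"
        using add sf sg by simp
    qed
    show "(\<lambda>n. (LINT x|lborel. norm (f (x + t n) - f x)) + (LINT x|lborel. norm (g (x + t n) - g x))) \<longlonglongrightarrow> 0"
      using tendsto_add[OF add(3,4)] by simp
  qed
next
  case (lim f s)
  show ?case
  proof (rule L1_shift_tendsto_approx)
    show "integrable lborel f" by fact
    fix e :: real assume e: "e > 0"
    have "(\<lambda>i. LINT x|lborel. norm (s i x - f x)) \<longlonglongrightarrow> (LINT x|(lborel::real measure). (0::real))"
    proof (rule integral_dominated_convergence)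
      show "integrable lborel (\<lambda>x. 3 * norm (f x))" using lim by simp
      show "AE x in lborel. (\<lambda>i. norm (s i x - f x)) \<longlonglongrightarrow> 0"
      proof (rule AE_I2)
        fix x
        have "(\<lambda>i. s i x) \<longlonglongrightarrow> f x" using lim by auto
        from tendsto_norm[OF tendsto_diff[OF this tendsto_const[of "f x"]]]
        show "(\<lambda>i. norm (s i x - f x)) \<longlonglongrightarrow> 0" by simp
      qed
      show "AE x in lborel. norm (norm (s i x - f x)) \<le> 3 * norm (f x)" for i
      proof (rule AE_I2)
        fix x
        have "norm (s i x) \<le> 2 * norm (f x)" using lim by auto
        then show "norm (norm (s i x - f x)) \<le> 3 * norm (f x)"
          using norm_triangle_ineq4[of "s i x" "f x"] by simp
      qed
    qed (use lim in auto)
    then obtain N where N: "\<And>n. n \<ge> N \<Longrightarrow> (LINT x|lborel. norm (s n x - f x)) < e"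
      using LIMSEQ_D[OF _ e] by fastforce
    then show "\<exists>g. integrable lborel g \<and> (LINT x|lborel. norm (f x - g x)) \<le> e
        \<and> (\<lambda>n. LINT x|lborel. norm (g (x + t n) - g x)) \<longlonglongrightarrow> 0"
      using lim by (intro exI[of _ "s N"]) (auto simp: norm_minus_commute[of "f _"] intro!: less_imp_le)
  qed
qed

lemma tendsto_0_ge_less:
  fixes X :: "nat \<Rightarrow> real"
  assumes "X \<longlonglongrightarrow> 0" "e > 0"
  shows "\<exists>N. \<forall>n\<ge>N. X n < e"
  using order_tendstoD(2)[OF assms] unfolding eventually_sequentially .

lemma borel_measurable_cnj [measurable (raw)]:
  "f \<in> borel_measurable M \<Longrightarrow> (\<lambda>x. cnj (f x)) \<in> borel_measurable M"
  by (rule borel_measurable_continuous_on) (intro continuous_intros)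

text \<open>Truncates the values of \<open>f\<close>, whereas \<open>cutoff\<close> truncates its
  argument.\<close>

definition clip :: "real \<Rightarrow> (real \<Rightarrow> complex) \<Rightarrow> real \<Rightarrow> complex" where
  "clip B f x = (if cmod (f x) \<le> B then f x else 0)"

text \<open>For a function bounded by N, the square of a difference of two values is at most 2 N
  times the difference, so continuity in the \<open>L^1\<close> mean gives continuity in the
  \<open>L^2\<close> mean. The error of clipping is small in norm and does not change under
  translation.\<close>

lemma L2_shift_tendsto:
  fixes f :: "real \<Rightarrow> complex" and t :: "nat \<Rightarrow> real"
  assumes i: "integrable lborel f" and f: "square_integrable f" and t: "t \<longlonglongrightarrow> 0"
  shows "(\<lambda>n. L2norm (\<lambda>x. f (x + t n) - f x)) \<longlonglongrightarrow> 0"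
proof (rule LIMSEQ_I)
  note [measurable] = square_integrableD[OF f]
  have tm: "clip B f \<in> borel_measurable lborel" for B
    unfolding clip_def[abs_def] by measurable
  have ts: "square_integrable (clip B f)" for B
    by (rule square_integrable_bound[OF f tm, where c=1]) (simp add: clip_def)
  have ti: "integrable lborel (clip B f)" for B
    by (rule Bochner_Integration.integrable_bound[OF i tm]) (simp add: clip_def)
  fix e :: real assume e: "e > 0"
  have "(\<lambda>n. L2norm (\<lambda>x. f x - clip (real n) f x)) \<longlonglongrightarrow> 0"
  proof (rule L2_tendsto_dominated[OF _ f])
    show "AE x in lborel. (\<lambda>n. f x - clip (real n) f x) \<longlonglongrightarrow> 0"
    proof (rule AE_I2)
      fix x
      obtain N where "cmod (f x) \<le> real N" using real_arch_simple by blast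
      then have "f x - clip (real n) f x = 0" if "n \<ge> N" for n
        using that order_trans[of "cmod (f x)" "real N" "real n"] by (simp add: clip_def)
      then show "(\<lambda>n. f x - clip (real n) f x) \<longlonglongrightarrow> 0"
        by (intro tendsto_eventually) (auto simp: eventually_sequentially)
    qed
  qed (use tm in \<open>auto simp: clip_def\<close>)
  from tendsto_0_ge_less[OF this, of "e / 4"] e
  obtain N where N: "L2norm (\<lambda>x. f x - clip (real N) f x) < e / 4" by auto
  let ?g = "clip (real N) f"
  have gb: "cmod (?g x) \<le> real N" for x by (simp add: clip_def)
  have "(\<lambda>n. sqrt (2 * real N * (LINT x|lborel. cmod (?g (x + t n) - ?g x)))) \<longlonglongrightarrow> sqrt (2 * real N * 0)"
    by (rule tendsto_real_sqrt[OF tendsto_mult[OF tendsto_const L1_shift_tendsto[OF ti t]]])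
  then have "(\<lambda>n. sqrt (2 * real N * (LINT x|lborel. cmod (?g (x + t n) - ?g x)))) \<longlonglongrightarrow> 0"
    by simp
  from tendsto_0_ge_less[OF this, of "e / 2"] e
  obtain M where M: "\<And>n. n \<ge> M \<Longrightarrow> sqrt (2 * real N * (LINT x|lborel. cmod (?g (x + t n) - ?g x))) < e / 2"
    by auto
  have "L2norm (\<lambda>x. f (x + t n) - f x) < e" if "n \<ge> M" for n
  proof -
    have sh: "square_integrable (\<lambda>x. f (x + t n))" "square_integrable (\<lambda>x. ?g (x + t n))"
      by (intro square_integrable_shift f ts)+
    have "L2norm (\<lambda>x. f (x + t n) - f x) \<le> L2norm (\<lambda>x. f (x + t n) - ?g (x + t n)) + L2norm (\<lambda>x. ?g (x + t n) - f x)"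
      by (rule L2norm_triangle3[OF sh f])
    also have "L2norm (\<lambda>x. ?g (x + t n) - f x) \<le> L2norm (\<lambda>x. ?g (x + t n) - ?g x) + L2norm (\<lambda>x. ?g x - f x)"
      by (rule L2norm_triangle3[OF sh(2) ts f])
    also have "L2norm (\<lambda>x. f (x + t n) - ?g (x + t n)) = L2norm (\<lambda>x. f x - ?g x)"
      by (rule L2norm_shift[of "\<lambda>x. f x - ?g x"])
    also have "L2norm (\<lambda>x. ?g x - f x) = L2norm (\<lambda>x. f x - ?g x)"
      by (rule L2norm_minus_commute)
    also have "L2norm (\<lambda>x. ?g (x + t n) - ?g x) \<le> sqrt (2 * real N * (LINT x|lborel. cmod (?g (x + t n) - ?g x)))"
    proof -
      have "(LINT x|lborel. (cmod (?g (x + t n) - ?g x))\<^sup>2) \<le> (LINT x|lborel. 2 * real N * cmod (?g (x + t n) - ?g x))"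
      proof (rule integral_mono)
        show "integrable lborel (\<lambda>x. (cmod (?g (x + t n) - ?g x))\<^sup>2)"
          by (intro square_integrable_sqD square_integrable_diff sh ts)
        show "integrable lborel (\<lambda>x. 2 * real N * cmod (?g (x + t n) - ?g x))"
          using ti integrable_shift[of ?g "t n"] by simp
        fix x
        have "cmod (?g (x + t n) - ?g x) \<le> 2 * real N"
          using gb[of x] gb[of "x + t n"] norm_triangle_ineq4[of "?g (x + t n)" "?g x"] by linarith
        then show "(cmod (?g (x + t n) - ?g x))\<^sup>2 \<le> 2 * real N * cmod (?g (x + t n) - ?g x)"
          unfolding power2_eq_square by (intro mult_right_mono) auto
      qed
      then show ?thesis unfolding L2norm_def by simp
    qed
    finally show ?thesis using N M[OF that] by simp
  qed
  then show "\<exists>no. \<forall>n\<ge>no. norm (L2norm (\<lambda>x. f (x + t n) - f x) - 0) < e"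
    by (intro exI[of _ M]) auto
qed

section \<open>Plancherel's theorem for functions that are both integrable and square
  integrable\<close>

text \<open>The transform of the autocorrelation of \<open>f\<close> is the squared modulus of the transform of \<open>f\<close>, and
  its value at \<open>0\<close> is the squared norm of \<open>f\<close>. Plancherel's theorem is therefore Fourier inversion at
  \<open>0\<close> for the autocorrelation, which follows by testing with wide Gaussians because the transform is
  nonnegative.\<close>

definition autocorr :: "(real \<Rightarrow> complex) \<Rightarrow> real \<Rightarrow> complex" where
  "autocorr f t = (LINT x|lborel. f (x + t) * cnj (f x))"

lemma square_integrable_cnj: "square_integrable f \<Longrightarrow> square_integrable (\<lambda>x. cnj (f x))"
  unfolding square_integrable_def by (simp add: borel_measurable_cnj)

lemma integrable_mult_L2:
  fixes f g :: "real \<Rightarrow> complex"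
  assumes "square_integrable f" "square_integrable g"
  shows "integrable lborel (\<lambda>x. f x * g x)"
proof (rule Bochner_Integration.integrable_bound[OF integrable_norm_mult[OF assms]])
  show "(\<lambda>x. f x * g x) \<in> borel_measurable lborel"
    using assms[THEN square_integrableD] by measurable
qed (simp add: norm_mult)

lemma L2_Cauchy_Schwarz_complex:
  fixes f g :: "real \<Rightarrow> complex"
  assumes "square_integrable f" "square_integrable g"
  shows "cmod (LINT x|lborel. f x * g x) \<le> L2norm f * L2norm g"
  by (rule order_trans[OF integral_norm_bound]) (use L2_Cauchy_Schwarz[OF assms] in \<open>simp add: norm_mult\<close>)

lemma autocorr_0:
  "autocorr f 0 = complex_of_real ((L2norm f)\<^sup>2)"
  unfolding autocorr_def L2norm_sq by (simp add: complex_norm_square[symmetric] flip: integral_complex_of_real of_real_power)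

lemma L2norm_cnj: "L2norm (\<lambda>x. cnj (f x)) = L2norm f"
  by (rule L2norm_cong_norm) simp

lemma autocorr_bound:
  assumes "square_integrable f"
  shows "cmod (autocorr f t) \<le> (L2norm f)\<^sup>2"
  unfolding autocorr_def
  using L2_Cauchy_Schwarz_complex[OF square_integrable_shift[OF assms, of t] square_integrable_cnj[OF assms]]
  by (simp add: L2norm_shift L2norm_cnj power2_eq_square)

lemma autocorr_tendsto:
  assumes i: "integrable lborel f" and f: "square_integrable f" and t: "t \<longlonglongrightarrow> 0"
  shows "(\<lambda>n::nat. autocorr f (t n)) \<longlonglongrightarrow> autocorr f 0"
proof (rule LIM_zero_cancel, rule Lim_null_comparison)
  have "(\<lambda>n. L2norm (\<lambda>x. f (x + t n) - f x) * L2norm f) \<longlonglongrightarrow> 0 * L2norm f"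
    by (intro tendsto_intros L2_shift_tendsto assms)
  then show "(\<lambda>n. L2norm (\<lambda>x. f (x + t n) - f x) * L2norm f) \<longlonglongrightarrow> 0" by simp
  show "\<forall>\<^sub>F n in sequentially. cmod (autocorr f (t n) - autocorr f 0) \<le> L2norm (\<lambda>x. f (x + t n) - f x) * L2norm f"
  proof (intro always_eventually allI)
    fix n
    have "autocorr f (t n) - autocorr f 0 = (LINT x|lborel. (f (x + t n) - f x) * cnj (f x))"
      unfolding autocorr_def left_diff_distrib
      by (subst Bochner_Integration.integral_diff)
         (auto intro!: integrable_mult_L2 square_integrable_shift square_integrable_cnj f)
    then show "cmod (autocorr f (t n) - autocorr f 0) \<le> L2norm (\<lambda>x. f (x + t n) - f x) * L2norm f"
      using L2_Cauchy_Schwarz_complex[OF square_integrable_diff[OF square_integrable_shift[OF f] f] square_integrable_cnj[OF f]]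
      by (simp add: L2norm_cnj)
  qed
qed

lemma autocorr_ft:
  assumes i: "integrable lborel f"
  shows "integrable lborel (autocorr f)" "ft (autocorr f) k = complex_of_real ((cmod (ft f k))\<^sup>2)"
proof -
  have [measurable]: "f \<in> borel_measurable borel" using borel_measurable_integrable[OF i] by simp
  let ?e = "\<lambda>s::real. exp (- (\<i> * complex_of_real k * complex_of_real s))"
  have si: "integrable lborel (\<lambda>t. f (x + t))" for x
    using integrable_shift[of f x] i by (simp add: add.commute)
  have ii: "integrable (lborel \<Otimes>\<^sub>M lborel) (\<lambda>(x, t). f (x + t) * cnj (f x))"
  proof (rule lborel_pair.Fubini_integrable)
    have n: "(LINT t|lborel. cmod (f (x + t) * cnj (f x))) = (LINT t|lborel. cmod (f t)) * cmod (f x)" for x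
      using integral_shift[of "\<lambda>t. cmod (f t)" x] by (simp add: norm_mult add.commute)
    show "integrable lborel (\<lambda>x. LINT t|lborel. cmod (case (x, t) of (x, t) \<Rightarrow> f (x + t) * cnj (f x)))"
      using i by (simp add: n)
    show "AE x in lborel. integrable lborel (\<lambda>t. case (x, t) of (x, t) \<Rightarrow> f (x + t) * cnj (f x))"
      using si by simp
    show "(\<lambda>(x, t). f (x + t) * cnj (f x)) \<in> borel_measurable (lborel \<Otimes>\<^sub>M lborel)"
      by measurable
  qed
  have "integrable (lborel \<Otimes>\<^sub>M lborel) (\<lambda>(x, y). (\<lambda>(x, t). f (x + t) * cnj (f x)) (y, x))"
    using lborel_pair.integrable_product_swap_iff ii by blast
  then have "integrable (lborel \<Otimes>\<^sub>M lborel) (\<lambda>(t, x). f (x + t) * cnj (f x))"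
    by simp
  from lborel_pair.integrable_fst'[OF this]
  show "integrable lborel (autocorr f)" unfolding autocorr_def[abs_def] by simp
  have "integrable (lborel \<Otimes>\<^sub>M lborel) (\<lambda>(x, t). ?e t * (f (x + t) * cnj (f x)))"
  proof (rule Bochner_Integration.integrable_bound[OF ii])
    have "(\<lambda>z::real \<times> real. exp (- (\<i> * complex_of_real k * complex_of_real (snd z)))) \<in> borel_measurable (borel \<Otimes>\<^sub>M borel)"
      unfolding borel_prod by (intro borel_measurable_continuous_onI continuous_intros)
    then have [measurable]: "(\<lambda>(x::real, t). ?e t) \<in> borel_measurable (borel \<Otimes>\<^sub>M borel)"
      by (simp add: split_beta')
    show "(\<lambda>(x, t). ?e t * (f (x + t) * cnj (f x))) \<in> borel_measurable (lborel \<Otimes>\<^sub>M lborel)"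
      by measurable
  qed (auto simp: norm_mult)
  from lborel_pair.Fubini_integral[OF this]
  have "ft (autocorr f) k = (LINT x|lborel. LINT t|lborel. ?e t * (f (x + t) * cnj (f x)))"
    unfolding ft_def autocorr_def by simp
  \<comment> \<open>The inner integral is the transform of a translate of \<open>f\<close>, that is,
    \<open>ft f k\<close> times a phase, and the phase is absorbed into the conjugate.\<close>
  also have "\<dots> = (LINT x|lborel. ft f k * cnj (?e x * f x))"
  proof (intro arg_cong[where f="integral\<^sup>L lborel"] ext)
    fix x
    have "(LINT t|lborel. ?e t * (f (x + t) * cnj (f x))) = (LINT t|lborel. ?e t * f (t + x)) * cnj (f x)"
      unfolding integral_mult_left_zero[symmetric] by (simp add: mult_ac add_ac)
    also have "(LINT t|lborel. ?e t * f (t + x)) = ft (\<lambda>t. f (t + x)) k" by (simp add: ft_def)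
    also have "\<dots> * cnj (f x) = ft f k * cnj (?e x * f x)"
      unfolding ft_shift by (simp add: exp_cnj mult_ac)
    finally show "(LINT t|lborel. ?e t * (f (x + t) * cnj (f x))) = ft f k * cnj (?e x * f x)" .
  qed
  also have "\<dots> = ft f k * cnj (ft f k)"
    unfolding ft_def by (simp only: integral_mult_right_zero Bochner_Integration.integral_cnj)
  finally show "ft (autocorr f) k = complex_of_real ((cmod (ft f k))\<^sup>2)"
    by (simp add: complex_norm_square[symmetric])
qed

theorem Plancherel_L1_L2:
  assumes i: "integrable lborel f" and f: "square_integrable f"
  shows "square_integrable (ft f)" "L2norm (ft f) = sqrt (2 * pi) * L2norm f"
proof -
  have [measurable]: "f \<in> borel_measurable borel" using borel_measurable_integrable[OF i] by simp
  define s where "s n = 1 / real (Suc n)" for n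
  have s: "s n > 0" for n by (simp add: s_def)
  have s0: "s \<longlonglongrightarrow> 0" unfolding s_def by (rule LIMSEQ_inverse_real_of_nat[unfolded inverse_eq_divide])
  let ?w = "\<lambda>n k. exp (- (s n * k)\<^sup>2 / 2)"
  have am: "autocorr f \<in> borel_measurable borel" 
    using borel_measurable_integrable[OF autocorr_ft(1)[OF i]] by simp
  have eq: "(LINT k|lborel. complex_of_real ((cmod (ft f k))\<^sup>2 * ?w n k))
     = (LINT z|lborel. complex_of_real (2 * pi * std_normal_density z) * autocorr f (s n * z))" for n
  proof -
    have "(LINT k|lborel. complex_of_real ((cmod (ft f k))\<^sup>2 * ?w n k)) = 
       (LINT k|lborel. ft (autocorr f) k * complex_of_real (?w n k))"
      by (simp add: autocorr_ft(2)[OF i])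
    also have "\<dots> = (LINT t|lborel. autocorr f t * complex_of_real (2 * pi / s n * std_normal_density (t / s n)))"
      by (subst ft_mult_swap[OF autocorr_ft(1)[OF i] ft_gauss(1)[OF s]]) (simp only: ft_gauss(2)[OF s])
    also have "\<dots> = (s n) *\<^sub>R (LINT z|lborel. autocorr f (s n * z) * complex_of_real (2 * pi / s n * std_normal_density z))"
      using s[of n] by (subst lborel_integral_real_affine[of "s n" _ 0]) auto
    also have "\<dots> = (LINT z|lborel. complex_of_real (2 * pi * std_normal_density z) * autocorr f (s n * z))"
      unfolding integral_scaleR_right[symmetric] using s[of n]
      by (intro arg_cong[where f="integral\<^sup>L lborel"] ext) (simp add: scaleR_conv_of_real)
    finally show ?thesis .
  qed
  have int_w: "integrable lborel (\<lambda>k. (cmod (ft f k))\<^sup>2 * ?w n k)" for n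
  proof (rule Bochner_Integration.integrable_bound)
    show "integrable lborel (\<lambda>k. (LINT x|lborel. cmod (f x))\<^sup>2 * ?w n k)"
      using integrable_Re[OF ft_gauss(1)[OF s[of n]]] by simp
    show "AE k in lborel. norm ((cmod (ft f k))\<^sup>2 * ?w n k) \<le> norm ((LINT x|lborel. cmod (f x))\<^sup>2 * ?w n k)"
      by (auto intro!: mult_right_mono power_mono cmod_ft_le)
  qed measurable
  \<comment> \<open>After rescaling, the Gaussian is a fixed density and the concentration has moved
    into the argument of the autocorrelation. Boundedness of the latter gives a majorant independent
    of \<open>n\<close>.\<close>
  have "(\<lambda>n. LINT z|lborel. complex_of_real (2 * pi * std_normal_density z) * autocorr f (s n * z))
    \<longlonglongrightarrow> (LINT z|lborel. complex_of_real (2 * pi * std_normal_density z) * autocorr f 0)"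
  proof (rule integral_dominated_convergence)
    show "integrable lborel (\<lambda>z. 2 * pi * std_normal_density z * (L2norm f)\<^sup>2)" by simp
    show "AE z in lborel. (\<lambda>n. complex_of_real (2 * pi * std_normal_density z) * autocorr f (s n * z))
      \<longlonglongrightarrow> complex_of_real (2 * pi * std_normal_density z) * autocorr f 0"
    proof (intro AE_I2 tendsto_intros autocorr_tendsto i f)
      fix z show "(\<lambda>n. s n * z) \<longlonglongrightarrow> 0" using tendsto_mult[OF s0 tendsto_const] by simp
    qed
    show "AE z in lborel. cmod (complex_of_real (2 * pi * std_normal_density z) * autocorr f (s n * z))
       \<le> 2 * pi * std_normal_density z * (L2norm f)\<^sup>2" for n
      using autocorr_bound[OF f] by (auto simp: norm_mult abs_mult intro!: mult_left_mono)
    show "(\<lambda>z. complex_of_real (2 * pi * std_normal_density z) * autocorr f (s n * z)) \<in> borel_measurable lborel" for n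
      using measurable_compose[OF _ am, of "\<lambda>z. s n * z" borel] by measurable
  qed measurable
  also have "(LINT z|lborel. complex_of_real (2 * pi * std_normal_density z) * autocorr f 0)
    = (LINT z|lborel. complex_of_real (2 * pi * std_normal_density z)) * autocorr f 0"
    by (rule integral_mult_left_zero)
  also have "(LINT z|lborel. complex_of_real (2 * pi * std_normal_density z)) = 2 * pi"
    unfolding integral_complex_of_real by simp
  finally have "(\<lambda>n. complex_of_real (LINT k|lborel. (cmod (ft f k))\<^sup>2 * ?w n k)) \<longlonglongrightarrow> complex_of_real (2 * pi * (L2norm f)\<^sup>2)"
    unfolding eq[symmetric] autocorr_0 integral_complex_of_real by simp
  then have lim: "(\<lambda>n. (LINT k|lborel. (cmod (ft f k))\<^sup>2 * ?w n k)) \<longlonglongrightarrow> 2 * pi * (L2norm f)\<^sup>2"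
    unfolding tendsto_of_real_iff .
  \<comment> \<open>Integrability of the squared transform is not known yet. The Gaussian weights
    increase to one, so monotone convergence yields it together with the value of the
    integral.\<close>
  have "(\<lambda>n. \<integral>\<^sup>+k. ennreal ((cmod (ft f k))\<^sup>2 * ?w n k) \<partial>lborel) \<longlonglongrightarrow> (\<integral>\<^sup>+k. ennreal ((cmod (ft f k))\<^sup>2) \<partial>lborel)"
  proof (rule nn_integral_LIMSEQ)
    show "incseq (\<lambda>n k. ennreal ((cmod (ft f k))\<^sup>2 * ?w n k))"
    proof (intro incseq_SucI le_funI ennreal_leI mult_left_mono)
      fix n k
      have "s (Suc n) \<le> s n" by (simp add: s_def field_simps)
      then have "(s (Suc n))\<^sup>2 * k\<^sup>2 \<le> (s n)\<^sup>2 * k\<^sup>2"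
        using s[of "Suc n"] by (intro mult_right_mono power_mono) auto
      then show "?w n k \<le> ?w (Suc n) k" by (simp add: power_mult_distrib)
    qed simp
    fix k
    have "(\<lambda>n. (cmod (ft f k))\<^sup>2 * ?w n k) \<longlonglongrightarrow> (cmod (ft f k))\<^sup>2 * exp (- (0 * k)\<^sup>2 / 2)"
      by (intro tendsto_intros s0) auto
    then show "(\<lambda>n. ennreal ((cmod (ft f k))\<^sup>2 * ?w n k)) \<longlonglongrightarrow> ennreal ((cmod (ft f k))\<^sup>2)"
      by simp
  qed measurable
  also have "(\<lambda>n. \<integral>\<^sup>+k. ennreal ((cmod (ft f k))\<^sup>2 * ?w n k) \<partial>lborel) = (\<lambda>n. ennreal (LINT k|lborel. (cmod (ft f k))\<^sup>2 * ?w n k))"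
    using int_w by (intro ext nn_integral_eq_integral) auto
  finally have nn: "(\<integral>\<^sup>+k. ennreal ((cmod (ft f k))\<^sup>2) \<partial>lborel) = ennreal ((sqrt (2 * pi) * L2norm f)\<^sup>2)"
    using LIMSEQ_unique[OF _ tendsto_ennrealI[OF lim]] by (simp add: power_mult_distrib)
  show sq: "square_integrable (ft f)"
    unfolding square_integrable_iff_nn using nn by simp
  show "L2norm (ft f) = sqrt (2 * pi) * L2norm f"
    using nn unfolding nn_integral_L2norm[OF sq] by simp
qed

section \<open>Extension of the Fourier transform to \<open>L^2\<close>\<close>

definition cutoff :: "real \<Rightarrow> (real \<Rightarrow> complex) \<Rightarrow> real \<Rightarrow> complex" where
  "cutoff R f x = indicator {-R..R} x *\<^sub>R f x"

lemma ft_cutoff: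
  "(LINT x:{-R..R}|lborel. exp (- (\<i> * of_real k * of_real x)) * f x) = ft (cutoff R f) k"
  unfolding set_lebesgue_integral_def ft_def cutoff_def by simp

lemma cutoff_L2:
  assumes "square_integrable f"
  shows "square_integrable (cutoff R f)"
proof (rule square_integrable_bound[OF assms, where c=1])
  note [measurable] = square_integrableD[OF assms]
  show "cutoff R f \<in> borel_measurable lborel" unfolding cutoff_def[abs_def] by measurable
qed (auto simp: cutoff_def indicator_def)

lemma cutoff_L1:
  assumes "square_integrable f"
  shows "integrable lborel (cutoff R f)"
proof -
  have "square_integrable (indicator {-R..R} :: real \<Rightarrow> real)"
    unfolding square_integrable_def
    by (auto simp: power2_eq_square indicator_inter_arith[symmetric] emeasure_lborel_Icc_eq
        intro!: integrable_real_indicator)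
  from integrable_norm_mult[OF this assms]
  show ?thesis
  proof (rule Bochner_Integration.integrable_bound)
    show "cutoff R f \<in> borel_measurable lborel" using cutoff_L2[OF assms] by (rule square_integrableD)
  qed (simp add: cutoff_def)
qed

lemma cutoff_tendsto:
  assumes f: "square_integrable f" and X: "filterlim X at_top sequentially"
  shows "(\<lambda>n. L2norm (\<lambda>x. f x - cutoff (X n) f x)) \<longlonglongrightarrow> 0"
proof (rule L2_tendsto_dominated[OF _ f])
  show "(\<lambda>x. f x - cutoff (X n) f x) \<in> borel_measurable lborel" for n
    by (intro borel_measurable_diff square_integrableD f cutoff_L2)
  show "AE x in lborel. cmod (f x - cutoff (X n) f x) \<le> cmod (f x)" for n
    by (simp add: cutoff_def indicator_def)
  show "AE x in lborel. (\<lambda>n. f x - cutoff (X n) f x) \<longlonglongrightarrow> 0"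
  proof (rule AE_I2)
    fix x
    have "eventually (\<lambda>n. \<bar>x\<bar> \<le> X n) sequentially"
      using X by (simp add: filterlim_at_top)
    then have "eventually (\<lambda>n. f x - cutoff (X n) f x = 0) sequentially"
      by eventually_elim (auto simp: cutoff_def indicator_def abs_le_iff)
    then show "(\<lambda>n. f x - cutoff (X n) f x) \<longlonglongrightarrow> 0" by (rule tendsto_eventually)
  qed
qed

lemma cutoff_tendsto_nat:
  "square_integrable f \<Longrightarrow> (\<lambda>n. L2norm (\<lambda>x. f x - cutoff (real n) f x)) \<longlonglongrightarrow> 0"
  by (rule cutoff_tendsto) (auto intro: filterlim_real_sequentially)

lemma cutoff_tendsto_at_top:
  "square_integrable f \<Longrightarrow> ((\<lambda>R. L2norm (\<lambda>x. f x - cutoff R f x)) \<longlongrightarrow> 0) at_top"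
  by (rule tendsto_at_topI_sequentially) (rule cutoff_tendsto)

lemma ft_isometry_diff:
  assumes "integrable lborel f" "square_integrable f" "integrable lborel g" "square_integrable g"
  shows "L2norm (\<lambda>k. ft f k - ft g k) = sqrt (2 * pi) * L2norm (\<lambda>x. f x - g x)"
proof -
  have "ft (\<lambda>x. f x - g x) = (\<lambda>k. ft f k - ft g k)"
    by (intro ext ft_diff assms)
  then show ?thesis
    using Plancherel_L1_L2(2)[of "\<lambda>x. f x - g x"] assms by (simp add: square_integrable_diff)
qed

text \<open>Since \<open>g\<close> and the transforms of the truncations are all in
  \<open>L^2\<close>, the nonnegative integral in \<open>is_fourier\<close> is a squared norm, and
  squares tend to zero exactly when the norms do.\<close>

lemma is_fourier_iff:
  assumes f: "square_integrable f"
  shows "is_fourier f g \<longleftrightarrow> square_integrable g \<and>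
    ((\<lambda>R. L2norm (\<lambda>k. g k - ft (cutoff R f) k)) \<longlongrightarrow> 0) at_top"
proof (cases "square_integrable g")
  case True
  have sq: "square_integrable (\<lambda>k. g k - ft (cutoff R f) k)" for R
    by (intro square_integrable_diff True Plancherel_L1_L2 cutoff_L1 cutoff_L2 f)
  have "((\<lambda>R. (L2norm (\<lambda>k. g k - ft (cutoff R f) k))\<^sup>2) \<longlongrightarrow> 0) at_top \<longleftrightarrow>
     ((\<lambda>R. L2norm (\<lambda>k. g k - ft (cutoff R f) k)) \<longlongrightarrow> 0) at_top"
    (is "?l \<longleftrightarrow> ?r")
  proof
    assume ?l
    from tendsto_real_sqrt[OF this] show ?r by simp
  next
    assume ?r
    from tendsto_power[OF this, of 2] show ?l by simp
  qed
  moreover have "((\<lambda>R. ennreal ((L2norm (\<lambda>k. g k - ft (cutoff R f) k))\<^sup>2)) \<longlongrightarrow> 0) at_top \<longleftrightarrow> ?l"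
    using tendsto_ennreal_iff[of "\<lambda>R. (L2norm (\<lambda>k. g k - ft (cutoff R f) k))\<^sup>2" at_top 0] by simp
  ultimately show ?thesis
    unfolding is_fourier_def ft_cutoff nn_integral_L2norm[OF sq] by simp
qed (simp add: is_fourier_def)

text \<open>By the isometry, all approximating sequences lead to the same transform. This frees the
  later rules from truncations to symmetric intervals: the translate of such a truncation, for
  instance, is no longer of that form.\<close>

lemma is_fourierI:
  assumes f: "square_integrable f" and g: "square_integrable g"
    and h: "\<And>n. integrable lborel (h n)" "\<And>n. square_integrable (h n)"
    and hf: "(\<lambda>n::nat. L2norm (\<lambda>x. f x - h n x)) \<longlonglongrightarrow> 0"
    and hg: "(\<lambda>n. L2norm (\<lambda>x. g x - ft (h n) x)) \<longlonglongrightarrow> 0"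
  shows "is_fourier f g"
  unfolding is_fourier_iff[OF f]
proof (intro conjI g, rule tendsto_sandwich[OF _ _ tendsto_const])
  \<comment> \<open>For fixed \<open>R\<close> the functions \<open>h n\<close> serve as
    intermediaries and disappear in the limit, leaving only the truncation error of
    \<open>f\<close>.\<close>
  have le: "L2norm (\<lambda>k. g k - ft (cutoff R f) k) \<le> sqrt (2 * pi) * L2norm (\<lambda>x. f x - cutoff R f x)" for R
  proof (rule LIMSEQ_le[OF tendsto_const])
    show "(\<lambda>n. L2norm (\<lambda>k. g k - ft (h n) k) + sqrt (2 * pi) * (L2norm (\<lambda>x. f x - h n x) + L2norm (\<lambda>x. f x - cutoff R f x)))
      \<longlonglongrightarrow> sqrt (2 * pi) * L2norm (\<lambda>x. f x - cutoff R f x)"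
      by (rule tendsto_eq_intros hf hg refl | simp)+
    have "L2norm (\<lambda>k. g k - ft (cutoff R f) k) \<le> L2norm (\<lambda>k. g k - ft (h n) k)
          + sqrt (2 * pi) * (L2norm (\<lambda>x. f x - h n x) + L2norm (\<lambda>x. f x - cutoff R f x))" for n
    proof -
      have "L2norm (\<lambda>k. g k - ft (cutoff R f) k) \<le> L2norm (\<lambda>k. g k - ft (h n) k) + L2norm (\<lambda>k. ft (h n) k - ft (cutoff R f) k)"
        by (rule L2norm_triangle3) (intro g Plancherel_L1_L2 cutoff_L1 cutoff_L2 f h)+
      also have "L2norm (\<lambda>k. ft (h n) k - ft (cutoff R f) k) = sqrt (2 * pi) * L2norm (\<lambda>x. h n x - cutoff R f x)"
        by (rule ft_isometry_diff) (intro cutoff_L1 cutoff_L2 f h)+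
      also have "L2norm (\<lambda>x. h n x - cutoff R f x) \<le> L2norm (\<lambda>x. h n x - f x) + L2norm (\<lambda>x. f x - cutoff R f x)"
        by (rule L2norm_triangle3) (intro cutoff_L2 f h)+
      finally show ?thesis by (simp add: L2norm_minus_commute[of "h n" f])
    qed
    then show "\<exists>N. \<forall>n\<ge>N. L2norm (\<lambda>k. g k - ft (cutoff R f) k) \<le> L2norm (\<lambda>k. g k - ft (h n) k)
          + sqrt (2 * pi) * (L2norm (\<lambda>x. f x - h n x) + L2norm (\<lambda>x. f x - cutoff R f x))" by blast
  qed
  then show "\<forall>\<^sub>F R in at_top. L2norm (\<lambda>k. g k - ft (cutoff R f) k) \<le> sqrt (2 * pi) * L2norm (\<lambda>x. f x - cutoff R f x)"
    by simp
  show "((\<lambda>R. sqrt (2 * pi) * L2norm (\<lambda>x. f x - cutoff R f x)) \<longlongrightarrow> 0) at_top"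
    using tendsto_mult[OF tendsto_const cutoff_tendsto_at_top[OF f], of "sqrt (2 * pi)"] by simp
qed simp

lemma is_fourier_ft:
  "integrable lborel f \<Longrightarrow> square_integrable f \<Longrightarrow> is_fourier f (ft f)"
  by (rule is_fourierI[where h="\<lambda>_. f"]) (auto intro: Plancherel_L1_L2 simp: L2norm_def)

lemma is_fourier_L2: "is_fourier f g \<Longrightarrow> square_integrable g"
  by (simp add: is_fourier_def)

lemma is_fourier_cutoff_tendsto:
  assumes f: "square_integrable f" and g: "is_fourier f g"
  shows "(\<lambda>n. L2norm (\<lambda>k. g k - ft (cutoff (real n) f) k)) \<longlonglongrightarrow> 0"
proof -
  have "((\<lambda>R. L2norm (\<lambda>k. g k - ft (cutoff R f) k)) \<longlongrightarrow> 0) at_top"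
    using g is_fourier_iff[OF f] by blast
  from filterlim_compose[OF this filterlim_real_sequentially] show ?thesis .
qed

text \<open>The choice in \<open>fourier\<close> is made from a nonempty set: the isometry makes the
  transforms of the truncations a Cauchy sequence, and completeness supplies the limit.\<close>

theorem is_fourier_fourier:
  assumes f: "square_integrable f"
  shows "is_fourier f (fourier f)"
proof -
  let ?h = "\<lambda>n. cutoff (real n) f"
  have Cauchy: "\<exists>N. \<forall>m\<ge>N. \<forall>n\<ge>N. L2norm (\<lambda>k. ft (?h m) k - ft (?h n) k) < e" if e: "e > 0" for e
  proof -
    have "(\<lambda>n. sqrt (2 * pi) * L2norm (\<lambda>x. f x - ?h n x)) \<longlonglongrightarrow> 0"
      using tendsto_mult[OF tendsto_const cutoff_tendsto_nat[OF f], of "sqrt (2 * pi)"] by simp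
    from tendsto_0_ge_less[OF this, of "e / 2"] e
    obtain N where N: "\<And>n. n \<ge> N \<Longrightarrow> sqrt (2 * pi) * L2norm (\<lambda>x. f x - ?h n x) < e / 2" by auto
    have "L2norm (\<lambda>k. ft (?h m) k - ft (?h n) k) < e" if "m \<ge> N" "n \<ge> N" for m n
    proof -
      have "L2norm (\<lambda>k. ft (?h m) k - ft (?h n) k) = sqrt (2 * pi) * L2norm (\<lambda>x. ?h m x - ?h n x)"
        by (rule ft_isometry_diff) (intro cutoff_L1 cutoff_L2 f)+
      also have "L2norm (\<lambda>x. ?h m x - ?h n x) \<le> L2norm (\<lambda>x. ?h m x - f x) + L2norm (\<lambda>x. f x - ?h n x)"
        by (rule L2norm_triangle3) (intro cutoff_L2 f)+
      finally show ?thesis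
        using N[OF that(1)] N[OF that(2)] by (simp add: L2norm_minus_commute[of "?h m" f] distrib_left)
    qed
    then show ?thesis by blast
  qed
  obtain g where g: "square_integrable g" "(\<lambda>n. L2norm (\<lambda>k. ft (?h n) k - g k)) \<longlonglongrightarrow> 0"
    by (rule L2norm_complete[where f="\<lambda>n. ft (?h n)", OF Plancherel_L1_L2(1)[OF cutoff_L1[OF f] cutoff_L2[OF f]] Cauchy])
  have "(\<lambda>n. L2norm (\<lambda>k. g k - ft (?h n) k)) \<longlonglongrightarrow> 0"
    using g(2) by (simp only: L2norm_minus_commute[of g])
  then have "is_fourier f g"
    by (rule is_fourierI[OF f g(1) cutoff_L1[OF f] cutoff_L2[OF f] cutoff_tendsto_nat[OF f]])
  then show ?thesis unfolding fourier_def by (rule someI[of "is_fourier f"])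
qed

lemma is_fourier_unique:
  assumes f: "square_integrable f" and g: "is_fourier f g" "is_fourier f g'"
  shows "AE k in lborel. g k = g' k"
proof -
  note sg = g[THEN is_fourier_L2]
  have "L2norm (\<lambda>k. g k - g' k) \<le> 0"
  proof (rule LIMSEQ_le[OF tendsto_const])
    show "(\<lambda>n. L2norm (\<lambda>k. g k - ft (cutoff (real n) f) k) + L2norm (\<lambda>k. g' k - ft (cutoff (real n) f) k)) \<longlonglongrightarrow> 0"
      using tendsto_add[OF is_fourier_cutoff_tendsto[OF f g(1)] is_fourier_cutoff_tendsto[OF f g(2)]] by simp
    have "L2norm (\<lambda>k. g k - g' k) \<le> L2norm (\<lambda>k. g k - ft (cutoff (real n) f) k) + L2norm (\<lambda>k. ft (cutoff (real n) f) k - g' k)" for n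
      by (rule L2norm_triangle3) (intro sg Plancherel_L1_L2 cutoff_L1 cutoff_L2 f)+
    then show "\<exists>N. \<forall>n\<ge>N. L2norm (\<lambda>k. g k - g' k) \<le> L2norm (\<lambda>k. g k - ft (cutoff (real n) f) k) + L2norm (\<lambda>k. g' k - ft (cutoff (real n) f) k)"
      by (simp add: L2norm_minus_commute[of g'])
  qed
  then have "L2norm (\<lambda>k. g k - g' k) = 0" using L2norm_nonneg[of "\<lambda>k. g k - g' k"] by linarith
  from L2norm_eq_0[OF square_integrable_diff[OF sg] this] show ?thesis by simp
qed

text \<open>The transform is a class modulo null sets, whereas \<open>fourier\<close> picks one
  representative. This rule changes representatives on both sides.\<close>

lemma is_fourier_cong_AE:
  assumes f: "square_integrable f" and g: "is_fourier f g"
    and f': "f' \<in> borel_measurable lborel" and g': "g' \<in> borel_measurable lborel"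
    and eq: "AE x in lborel. f x = f' x" "AE x in lborel. g x = g' x"
  shows "square_integrable f'" "is_fourier f' g'"
proof -
  note [measurable] = f' g' square_integrableD[OF f] square_integrableD[OF is_fourier_L2[OF g]]
  show sf': "square_integrable f'"
    by (rule square_integrable_bound[OF f f', where c=1]) (use eq(1) in eventually_elim, simp)
  have sg': "square_integrable g'"
    by (rule square_integrable_bound[OF is_fourier_L2[OF g] g', where c=1]) (use eq(2) in eventually_elim, simp)
  let ?h = "\<lambda>n. cutoff (real n) f"
  have [measurable]: "?h n \<in> borel_measurable lborel" "ft (?h n) \<in> borel_measurable lborel" for n
    using square_integrableD[OF cutoff_L2[OF f]] by auto
  have 1: "L2norm (\<lambda>x. f' x - ?h n x) = L2norm (\<lambda>x. f x - ?h n x)" for n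
    by (rule L2norm_cong_AE) (use eq(1) in eventually_elim, simp, measurable)
  have 2: "L2norm (\<lambda>x. g' x - ft (?h n) x) = L2norm (\<lambda>x. g x - ft (?h n) x)" for n
    by (rule L2norm_cong_AE) (use eq(2) in eventually_elim, simp, measurable)
  show "is_fourier f' g'"
    by (rule is_fourierI[where h="?h", OF sf' sg' cutoff_L1[OF f] cutoff_L2[OF f]])
       (simp_all only: 1 2 cutoff_tendsto_nat[OF f] is_fourier_cutoff_tendsto[OF f g])
qed

lemma L2norm_add_tendsto:
  assumes sq: "square_integrable f" "square_integrable g"  "\<And>n. square_integrable (a n)" "\<And>n. square_integrable (b n)"
    and lim: "(\<lambda>n::nat. L2norm (\<lambda>x. f x - a n x)) \<longlonglongrightarrow> 0" "(\<lambda>n. L2norm (\<lambda>x. g x - b n x)) \<longlonglongrightarrow> 0"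
  shows "(\<lambda>n. L2norm (\<lambda>x. (f x + g x) - (a n x + b n x))) \<longlonglongrightarrow> 0"
proof (rule tendsto_sandwich[OF _ _ tendsto_const])
  show "(\<lambda>n. L2norm (\<lambda>x. f x - a n x) + L2norm (\<lambda>x. g x - b n x)) \<longlonglongrightarrow> 0"
    using tendsto_add[OF lim] by simp
  have "L2norm (\<lambda>x. (f x - a n x) + (g x - b n x)) \<le> L2norm (\<lambda>x. f x - a n x) + L2norm (\<lambda>x. g x - b n x)" for n
    by (intro L2norm_triangle square_integrable_diff sq)
  then show "\<forall>\<^sub>F n in sequentially. L2norm (\<lambda>x. (f x + g x) - (a n x + b n x)) \<le> L2norm (\<lambda>x. f x - a n x) + L2norm (\<lambda>x. g x - b n x)"
    by (simp add: algebra_simps)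
qed simp

lemma is_fourier_add:
  assumes f: "square_integrable f" "is_fourier f g" and f': "square_integrable f'" "is_fourier f' g'"
  shows "is_fourier (\<lambda>x. f x + f' x) (\<lambda>x. g x + g' x)"
proof (rule is_fourierI[where h="\<lambda>n x. cutoff (real n) f x + cutoff (real n) f' x"])
  have ft: "ft (\<lambda>x. cutoff (real n) f x + cutoff (real n) f' x) k = ft (cutoff (real n) f) k + ft (cutoff (real n) f') k" for n k
    by (intro ft_add cutoff_L1 f f')
  show "(\<lambda>n. L2norm (\<lambda>x. g x + g' x - ft (\<lambda>x. cutoff (real n) f x + cutoff (real n) f' x) x)) \<longlonglongrightarrow> 0"
    unfolding ft by (intro L2norm_add_tendsto Plancherel_L1_L2 cutoff_L1 cutoff_L2 f f' is_fourier_L2[OF f(2)] is_fourier_L2[OF f'(2)] is_fourier_cutoff_tendsto)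
qed (intro L2norm_add_tendsto square_integrable_add Bochner_Integration.integrable_add cutoff_L1 cutoff_L2 f f' is_fourier_L2[OF f(2)] is_fourier_L2[OF f'(2)] cutoff_tendsto_nat)+

lemma is_fourier_cmult:
  assumes f: "square_integrable f" "is_fourier f g"
  shows "is_fourier (\<lambda>x. c * f x) (\<lambda>x. c * g x)"
proof (rule is_fourierI[where h="\<lambda>n x. c * cutoff (real n) f x"])
  show "(\<lambda>n. L2norm (\<lambda>x. c * g x - ft (\<lambda>x. c * cutoff (real n) f x) x)) \<longlonglongrightarrow> 0"
    unfolding ft_cmult right_diff_distrib[symmetric] L2norm_cmult
    using tendsto_mult[OF tendsto_const is_fourier_cutoff_tendsto[OF f], of "cmod c"] by simp
  show "(\<lambda>n. L2norm (\<lambda>x. c * f x - c * cutoff (real n) f x)) \<longlonglongrightarrow> 0"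
    unfolding right_diff_distrib[symmetric] L2norm_cmult
    using tendsto_mult[OF tendsto_const cutoff_tendsto_nat[OF f(1)], of "cmod c"] by simp
  show "integrable lborel (\<lambda>x. c * cutoff (real n) f x)" for n
    using cutoff_L1[OF f(1)] by simp
qed (intro square_integrable_cmult cutoff_L2 f is_fourier_L2[OF f(2)])+

lemma is_fourier_diff:
  assumes f: "square_integrable f" "is_fourier f g" and f': "square_integrable f'" "is_fourier f' g'"
  shows "is_fourier (\<lambda>x. f x - f' x) (\<lambda>x. g x - g' x)"
  using is_fourier_add[OF f square_integrable_cmult[OF f'(1)] is_fourier_cmult[OF f'], of "-1"] by simp

lemma is_fourier_cnj:
  assumes f: "square_integrable f" "is_fourier f g"
  shows "is_fourier (\<lambda>x. cnj (f x)) (\<lambda>k. cnj (g (- k)))"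
proof (rule is_fourierI[where h="\<lambda>n x. cnj (cutoff (real n) f x)"])
  show "(\<lambda>n. L2norm (\<lambda>k. cnj (g (- k)) - ft (\<lambda>x. cnj (cutoff (real n) f x)) k)) \<longlonglongrightarrow> 0"
    unfolding ft_cnj complex_cnj_diff[symmetric] L2norm_cnj
      L2norm_reflect[of "\<lambda>k. g k - ft (cutoff (real _) f) k"]
    by (rule is_fourier_cutoff_tendsto[OF f])
  show "(\<lambda>n. L2norm (\<lambda>x. cnj (f x) - cnj (cutoff (real n) f x))) \<longlonglongrightarrow> 0"
    unfolding complex_cnj_diff[symmetric] L2norm_cnj by (rule cutoff_tendsto_nat[OF f(1)])
  show "integrable lborel (\<lambda>x. cnj (cutoff (real n) f x))" for n
    using cutoff_L1[OF f(1)] by simp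
qed (intro square_integrable_cnj square_integrable_reflect[of "\<lambda>x. cnj (g x)"] cutoff_L2 f is_fourier_L2[OF f(2)])+

lemma cmod_exp_iky [simp]: "cmod (exp (\<i> * of_real k * of_real x)) = 1"
  using norm_exp_i_times[of "k * x"] by (simp add: mult.assoc)

lemma square_integrable_modulate:
  assumes "square_integrable g"
  shows "square_integrable (\<lambda>k. exp (\<i> * of_real k * of_real y) * g k)"
proof (rule square_integrable_bound[OF assms, where c=1])
  note [measurable] = square_integrableD[OF assms]
  have [measurable]: "(\<lambda>k. exp (\<i> * complex_of_real k * complex_of_real y)) \<in> borel_measurable borel"
    by (intro borel_measurable_continuous_onI continuous_intros)
  show "(\<lambda>k. exp (\<i> * of_real k * of_real y) * g k) \<in> borel_measurable lborel" by measurable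
qed (simp add: norm_mult)

lemma L2norm_modulate: "L2norm (\<lambda>k. exp (\<i> * of_real k * of_real y) * g k) = L2norm g"
  by (rule L2norm_cong_norm) (simp add: norm_mult)

lemma is_fourier_shift:
  assumes f: "square_integrable f" "is_fourier f g"
  shows "is_fourier (\<lambda>x. f (x + y)) (\<lambda>k. exp (\<i> * of_real k * of_real y) * g k)"
proof (rule is_fourierI[where h="\<lambda>n x. cutoff (real n) f (x + y)"])
  show "(\<lambda>n. L2norm (\<lambda>k. exp (\<i> * of_real k * of_real y) * g k - ft (\<lambda>x. cutoff (real n) f (x + y)) k)) \<longlonglongrightarrow> 0"
    unfolding ft_shift right_diff_distrib[symmetric] L2norm_modulate
    by (rule is_fourier_cutoff_tendsto[OF f])
  show "(\<lambda>n. L2norm (\<lambda>x. f (x + y) - cutoff (real n) f (x + y))) \<longlonglongrightarrow> 0"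
    unfolding L2norm_shift[of "\<lambda>x. f x - cutoff (real _) f x"] by (rule cutoff_tendsto_nat[OF f(1)])
  show "integrable lborel (\<lambda>x. cutoff (real n) f (x + y))" for n
    using cutoff_L1[OF f(1)] by (simp add: integrable_shift)
qed (intro square_integrable_shift square_integrable_modulate cutoff_L2 f is_fourier_L2[OF f(2)])+

lemma L2norm_tendsto:
  assumes "square_integrable f" "\<And>n. square_integrable (a n)" "(\<lambda>n::nat. L2norm (\<lambda>x. f x - a n x)) \<longlonglongrightarrow> 0"
  shows "(\<lambda>n. L2norm (a n)) \<longlonglongrightarrow> L2norm f"
proof (rule LIM_zero_cancel, rule Lim_null_comparison[OF _ assms(3)])
  show "\<forall>\<^sub>F n in sequentially. norm (L2norm (a n) - L2norm f) \<le> L2norm (\<lambda>x. f x - a n x)"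
    using L2norm_triangle_sub[OF assms(1,2)] by (simp add: abs_minus_commute)
qed

theorem Plancherel:
  assumes f: "square_integrable f" "is_fourier f g"
  shows "L2norm g = sqrt (2 * pi) * L2norm f"
proof (rule LIMSEQ_unique)
  show "(\<lambda>n. L2norm (ft (cutoff (real n) f))) \<longlonglongrightarrow> L2norm g"
    by (intro L2norm_tendsto is_fourier_cutoff_tendsto Plancherel_L1_L2 cutoff_L1 cutoff_L2 f is_fourier_L2[OF f(2)])
  have "(\<lambda>n. sqrt (2 * pi) * L2norm (cutoff (real n) f)) \<longlonglongrightarrow> sqrt (2 * pi) * L2norm f"
    by (intro tendsto_intros L2norm_tendsto cutoff_tendsto_nat cutoff_L2 f)
  then show "(\<lambda>n. L2norm (ft (cutoff (real n) f))) \<longlonglongrightarrow> sqrt (2 * pi) * L2norm f"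
    by (simp add: Plancherel_L1_L2(2)[OF cutoff_L1[OF f(1)] cutoff_L2[OF f(1)]])
qed

lemma L2_integral_mult_tendsto:
  fixes f g :: "real \<Rightarrow> complex"
  assumes sq: "square_integrable f" "square_integrable g"  "\<And>n. square_integrable (a n)" "\<And>n. square_integrable (b n)"
    and lim: "(\<lambda>n::nat. L2norm (\<lambda>x. f x - a n x)) \<longlonglongrightarrow> 0" "(\<lambda>n. L2norm (\<lambda>x. g x - b n x)) \<longlonglongrightarrow> 0"
  shows "(\<lambda>n. LINT x|lborel. a n x * b n x) \<longlonglongrightarrow> (LINT x|lborel. f x * g x)"
proof (rule LIM_zero_cancel, rule Lim_null_comparison)
  show "(\<lambda>n. L2norm (\<lambda>x. f x - a n x) * L2norm g + L2norm (a n) * L2norm (\<lambda>x. g x - b n x)) \<longlonglongrightarrow> 0"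
    by (rule tendsto_eq_intros lim L2norm_tendsto[OF sq(1,3) lim(1)] refl | simp)+
  have "cmod ((LINT x|lborel. a n x * b n x) - (LINT x|lborel. f x * g x)) \<le>
    L2norm (\<lambda>x. f x - a n x) * L2norm g + L2norm (a n) * L2norm (\<lambda>x. g x - b n x)" for n
  proof -
    have "(LINT x|lborel. f x * g x) - (LINT x|lborel. a n x * b n x) =
      (LINT x|lborel. (f x - a n x) * g x) + (LINT x|lborel. a n x * (g x - b n x))"
      unfolding left_diff_distrib right_diff_distrib
      by (subst (1 2) Bochner_Integration.integral_diff) (auto intro!: integrable_mult_L2 sq)
    also have "cmod \<dots> \<le> L2norm (\<lambda>x. f x - a n x) * L2norm g + L2norm (a n) * L2norm (\<lambda>x. g x - b n x)"
      by (intro order_trans[OF norm_triangle_ineq] add_mono L2_Cauchy_Schwarz_complex square_integrable_diff sq)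
    finally show ?thesis by (simp add: norm_minus_commute)
  qed
  then show "\<forall>\<^sub>F n in sequentially. cmod ((LINT x|lborel. a n x * b n x) - (LINT x|lborel. f x * g x)) \<le>
    L2norm (\<lambda>x. f x - a n x) * L2norm g + L2norm (a n) * L2norm (\<lambda>x. g x - b n x)" by simp
qed

lemma is_fourier_swap:
  assumes f: "square_integrable f" "is_fourier f g" and f': "square_integrable f'" "is_fourier f' g'"
  shows "(LINT k|lborel. g k * f' k) = (LINT x|lborel. f x * g' x)"
proof (rule LIMSEQ_unique)
  show "(\<lambda>n. LINT k|lborel. ft (cutoff (real n) f) k * cutoff (real n) f' k) \<longlonglongrightarrow> (LINT k|lborel. g k * f' k)"
    by (intro L2_integral_mult_tendsto is_fourier_cutoff_tendsto cutoff_tendsto_nat Plancherel_L1_L2 cutoff_L1 cutoff_L2 f f' is_fourier_L2[OF f(2)])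
  have "(\<lambda>n. LINT k|lborel. cutoff (real n) f k * ft (cutoff (real n) f') k) \<longlonglongrightarrow> (LINT x|lborel. f x * g' x)"
    by (intro L2_integral_mult_tendsto is_fourier_cutoff_tendsto cutoff_tendsto_nat Plancherel_L1_L2 cutoff_L1 cutoff_L2 f f' is_fourier_L2[OF f'(2)])
  then show "(\<lambda>n. LINT k|lborel. ft (cutoff (real n) f) k * cutoff (real n) f' k) \<longlonglongrightarrow> (LINT x|lborel. f x * g' x)"
    by (simp add: ft_mult_swap[OF cutoff_L1[OF f(1)] cutoff_L1[OF f'(1)]])
qed

lemma L2norm_diff_sq:
  fixes f g :: "real \<Rightarrow> complex"
  assumes "square_integrable f" "square_integrable g"
  shows "(L2norm (\<lambda>x. f x - g x))\<^sup>2 = (L2norm f)\<^sup>2 + (L2norm g)\<^sup>2 - 2 * Re (LINT x|lborel. f x * cnj (g x))"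
proof -
  have i: "integrable lborel (\<lambda>x. f x * cnj (g x))"
    by (intro integrable_mult_L2 square_integrable_cnj assms)
  have "(L2norm (\<lambda>x. f x - g x))\<^sup>2 = (LINT x|lborel. (cmod (f x))\<^sup>2 + (cmod (g x))\<^sup>2 - 2 * Re (f x * cnj (g x)))"
    unfolding L2norm_sq by (intro arg_cong[where f="integral\<^sup>L lborel"] ext)
      (simp add: cmod_power2 power2_diff algebra_simps)
  also have "\<dots> = (L2norm f)\<^sup>2 + (L2norm g)\<^sup>2 - 2 * (LINT x|lborel. Re (f x * cnj (g x)))"
    unfolding L2norm_sq using assms[THEN square_integrable_sqD] integrable_Re[OF i] by (simp del: times_complex.simps)
  also have "(LINT x|lborel. Re (f x * cnj (g x))) = Re (LINT x|lborel. f x * cnj (g x))"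
    using i by (rule integral_Re)
  finally show ?thesis .
qed

text \<open>Polarization of Plancherel's theorem: the norms of \<open>f\<close>, \<open>f'\<close>
  and \<open>f - f'\<close> determine the real part of the inner product, which is all that the
  quadratic functional requires.\<close>

lemma Parseval:
  assumes f: "square_integrable f" "is_fourier f g" and f': "square_integrable f'" "is_fourier f' g'"
  shows "Re (LINT k|lborel. g k * cnj (g' k)) = 2 * pi * Re (LINT x|lborel. f x * cnj (f' x))"
  using L2norm_diff_sq[OF f(1) f'(1)] L2norm_diff_sq[OF is_fourier_L2[OF f(2)] is_fourier_L2[OF f'(2)]]
    Plancherel[OF f] Plancherel[OF f'] Plancherel[OF square_integrable_diff[OF f(1) f'(1)] is_fourier_diff[OF f f']]
  by (simp add: power_mult_distrib) (simp add: algebra_simps)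

text \<open>Inversion as a case of equality in Cauchy-Schwarz. Let w be the transform of the
  candidate preimage. Plancherel, applied twice, gives w and \<open>g\<close> the same norm, and the
  multiplication formula makes the real part of their inner product the square of that norm; hence w
  - g has norm zero.\<close>

theorem is_fourier_inverse:
  assumes g: "square_integrable g"
  shows "is_fourier (\<lambda>x. complex_of_real (1 / (2 * pi)) * fourier g (- x)) g"
proof -
  note F = is_fourier_fourier[OF g]
  define h where "h = fourier g"
  have h: "is_fourier g h" and sh: "square_integrable h"
    using F is_fourier_L2[OF F] by (auto simp: h_def)
  define P where "P x = complex_of_real (1 / (2 * pi)) * h (- x)" for x
  have sP: "square_integrable P"
    unfolding P_def[abs_def] by (intro square_integrable_cmult square_integrable_reflect sh)
  define w where "w = fourier P"
  have w: "is_fourier P w" and sw: "square_integrable w"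
    using is_fourier_fourier[OF sP] is_fourier_L2 by (auto simp: w_def)
  have nP: "L2norm P = L2norm h / (2 * pi)"
    unfolding P_def[abs_def] L2norm_cmult L2norm_reflect by (simp add: norm_divide)
  have nh: "(L2norm h)\<^sup>2 = 2 * pi * (L2norm g)\<^sup>2"
    by (simp add: Plancherel[OF g h] power_mult_distrib)
  have nw: "(L2norm w)\<^sup>2 = (L2norm g)\<^sup>2"
    by (simp add: Plancherel[OF sP w] power_mult_distrib nP power_divide nh power2_eq_square[of pi])
  have "(LINT k|lborel. w k * cnj (g k)) = (LINT x|lborel. P x * cnj (h (- x)))"
    by (rule is_fourier_swap[OF sP w square_integrable_cnj[OF g] is_fourier_cnj[OF g h]])
  also have "\<dots> = (LINT x|lborel. complex_of_real (1 / (2 * pi) * (cmod (h (- x)))\<^sup>2))"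
    by (intro arg_cong[where f="integral\<^sup>L lborel"] ext)
       (simp add: P_def mult.assoc complex_norm_square[symmetric])
  also have "\<dots> = complex_of_real (1 / (2 * pi) * (L2norm h)\<^sup>2)"
    unfolding integral_complex_of_real L2norm_sq
    using integral_reflect_lborel[of "\<lambda>x. (cmod (h x))\<^sup>2"] by simp
  finally have "Re (LINT k|lborel. w k * cnj (g k)) = (L2norm g)\<^sup>2"
    using nh by simp
  then have "(L2norm (\<lambda>k. w k - g k))\<^sup>2 = 0"
    unfolding L2norm_diff_sq[OF sw g] nw by simp
  then have "AE k in lborel. w k - g k = 0"
    using L2norm_eq_0[OF square_integrable_diff[OF sw g]] by simp
  then have "AE k in lborel. w k = g k" by simp
  then have "is_fourier P g"
    by (intro is_fourier_cong_AE(2)[OF sP w square_integrableD[OF sP] square_integrableD[OF g]]) auto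
  then show ?thesis unfolding P_def[abs_def] h_def .
qed

lemma is_fourier_inj:
  assumes f: "square_integrable f" "is_fourier f g" and f': "square_integrable f'" "is_fourier f' g"
  shows "AE x in lborel. f x = f' x"
proof -
  have sd: "square_integrable (\<lambda>x. f x - f' x)"
    by (rule square_integrable_diff[OF f(1) f'(1)])
  have "is_fourier (\<lambda>x. f x - f' x) (\<lambda>k. 0)"
    using is_fourier_diff[OF f f'] by simp
  note P = Plancherel[OF sd this]
  have z: "L2norm (\<lambda>k::real. 0::complex) = 0"
    unfolding L2norm_def by simp
  have "L2norm (\<lambda>x. f x - f' x) = 0"
    using P unfolding z by simp
  from L2norm_eq_0[OF sd this] have "AE x in lborel. f x - f' x = 0" .
  then show ?thesis by eventually_elim simp
qed

section \<open>Fourier multipliers on real functions\<close>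

lemma square_integrable_of_real_iff:
  "square_integrable (\<lambda>x. complex_of_real (u x)) \<longleftrightarrow> square_integrable u"
proof -
  have "(\<lambda>x. complex_of_real (u x)) \<in> borel_measurable borel \<longleftrightarrow> u \<in> borel_measurable borel"
  proof
    assume "(\<lambda>x. complex_of_real (u x)) \<in> borel_measurable borel"
    then have "(\<lambda>x. Re (complex_of_real (u x))) \<in> borel_measurable borel" by (rule measurable_compose) simp
    then show "u \<in> borel_measurable borel" by simp
  qed simp
  then show ?thesis by (simp add: square_integrable_def)
qed

lemma L2norm_of_real [simp]: "L2norm (\<lambda>x. complex_of_real (u x)) = L2norm u"
  by (simp add: L2norm_def)

lemma is_fourier_fourier_real:
  "square_integrable u \<Longrightarrow> is_fourier (\<lambda>x. complex_of_real (u x)) (fourier_real u)"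
  unfolding fourier_real_def by (rule is_fourier_fourier) (simp add: square_integrable_of_real_iff)

lemma fourier_real_L2: "square_integrable u \<Longrightarrow> square_integrable (fourier_real u)"
  by (rule is_fourier_L2[OF is_fourier_fourier_real])

lemma fourier_real_AE:
  assumes "square_integrable u" "is_fourier (\<lambda>x. complex_of_real (u x)) g"
  shows "AE k in lborel. fourier_real u k = g k"
  using is_fourier_unique[OF _ is_fourier_fourier_real[OF assms(1)] assms(2)] assms(1)
  by (simp add: square_integrable_of_real_iff)

lemma fourier_real_hermitian:
  assumes "square_integrable u"
  shows "AE k in lborel. fourier_real u (- k) = cnj (fourier_real u k)"
proof -
  have "is_fourier (\<lambda>x. complex_of_real (u x)) (\<lambda>k. cnj (fourier_real u (- k)))"
    using is_fourier_cnj[OF _ is_fourier_fourier_real[OF assms]] assms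
    by (simp add: square_integrable_of_real_iff)
  from fourier_real_AE[OF assms this] show ?thesis
    by eventually_elim (metis complex_cnj_cnj)
qed

text \<open>The symmetry says that the preimage and its complex conjugate have the same transform.
  By injectivity they agree almost everywhere, so the preimage may be replaced by its real
  part.\<close>

lemma is_fourier_hermitian_ex:
  assumes g: "square_integrable g" and h: "AE k in lborel. g (- k) = cnj (g k)"
  shows "\<exists>u::real \<Rightarrow> real. square_integrable u \<and> is_fourier (\<lambda>x. complex_of_real (u x)) g"
proof -
  define f where "f x = complex_of_real (1 / (2 * pi)) * fourier g (- x)" for x
  have sf: "square_integrable f"
    unfolding f_def[abs_def]
    by (intro square_integrable_cmult square_integrable_reflect is_fourier_L2[OF is_fourier_fourier[OF g]])
  have f: "is_fourier f g" unfolding f_def[abs_def] by (rule is_fourier_inverse[OF g])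
  have gm [measurable]: "g \<in> borel_measurable lborel" by (rule square_integrableD[OF g])
  have "AE k in lborel. cnj (g (- k)) = g k"
    using h by eventually_elim simp
  from is_fourier_cong_AE(2)[OF square_integrable_cnj[OF sf] is_fourier_cnj[OF sf f] _ gm _ this]
  have "is_fourier (\<lambda>x. cnj (f x)) g"
    using square_integrableD[OF square_integrable_cnj[OF sf]] by simp
  from is_fourier_inj[OF sf f square_integrable_cnj[OF sf] this]
  have eq: "AE x in lborel. f x = complex_of_real (Re (f x))"
    by eventually_elim (metis Reals_cnj_iff of_real_Re)
  have fm [measurable]: "f \<in> borel_measurable lborel" by (rule square_integrableD[OF sf])
  have m: "(\<lambda>x. complex_of_real (Re (f x))) \<in> borel_measurable lborel" by measurable
  from is_fourier_cong_AE[OF sf f m gm eq]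
  show ?thesis by (auto simp: square_integrable_of_real_iff)
qed

lemma has_symbol_image_fourier:
  assumes u: "square_integrable u" and m [measurable]: "m \<in> borel_measurable borel"
    and im: "has_symbol_image m u v"
  shows "square_integrable v" "is_fourier (\<lambda>x. complex_of_real (v x)) (\<lambda>k. m k * fourier_real u k)"
    "square_integrable (\<lambda>k. m k * fourier_real u k)"
    "(L2norm (\<lambda>k. m k * fourier_real u k))\<^sup>2 = 2 * pi * (L2norm v)\<^sup>2"
proof -
  show v: "square_integrable v" using im by (simp add: has_symbol_image_def)
  have [measurable]: "fourier_real u \<in> borel_measurable borel" using square_integrableD[OF fourier_real_L2[OF u]] by simp
  have sv: "square_integrable (\<lambda>x. complex_of_real (v x))" using v by (simp add: square_integrable_of_real_iff)
  show F: "is_fourier (\<lambda>x. complex_of_real (v x)) (\<lambda>k. m k * fourier_real u k)"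
  proof (rule is_fourier_cong_AE(2)[OF sv is_fourier_fourier_real[OF v]])
    show "AE k in lborel. fourier_real v k = m k * fourier_real u k"
      using im by (simp add: has_symbol_image_def)
  qed (use square_integrableD[OF sv] in auto)
  then show "square_integrable (\<lambda>k. m k * fourier_real u k)" by (rule is_fourier_L2)
  show "(L2norm (\<lambda>k. m k * fourier_real u k))\<^sup>2 = 2 * pi * (L2norm v)\<^sup>2"
    unfolding Plancherel[OF sv F] by (simp add: power_mult_distrib)
qed

text \<open>Justifies the choice in \<open>fourier_op\<close> as soon as the product is square
  integrable: the symmetry of \<open>m\<close> preserves that of the transform, so that a real image
  exists.\<close>

lemma has_symbol_image_fourier_op:
  assumes u: "square_integrable u" and m: "\<And>k. m (- k) = cnj (m k)"
    and sq: "square_integrable (\<lambda>k. m k * fourier_real u k)"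
  shows "has_symbol_image m u (fourier_op m u)"
proof -
  have "AE k in lborel. m (- k) * fourier_real u (- k) = cnj (m k * fourier_real u k)"
    using fourier_real_hermitian[OF u] by eventually_elim (simp add: m)
  from is_fourier_hermitian_ex[OF sq this]
  obtain v where v: "square_integrable v" "is_fourier (\<lambda>x. complex_of_real (v x)) (\<lambda>k. m k * fourier_real u k)" by blast
  have "has_symbol_image m u v"
    unfolding has_symbol_image_def using v fourier_real_AE by blast
  then show ?thesis unfolding fourier_op_def by (rule someI[of "has_symbol_image m u"])
qed

lemma symbols_measurable [measurable]:
  "dx_symbol \<in> borel_measurable borel" "dx_inv_symbol \<in> borel_measurable borel"
  "half_symbol \<in> borel_measurable borel" "hilbert_symbol \<in> borel_measurable borel"
  unfolding dx_symbol_def[abs_def] dx_inv_symbol_def[abs_def] half_symbol_def[abs_def] hilbert_symbol_def[abs_def]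
  by measurable

lemma symbols_cnj:
  "dx_symbol (- k) = cnj (dx_symbol k)" "dx_inv_symbol (- k) = cnj (dx_inv_symbol k)"
  "half_symbol (- k) = cnj (half_symbol k)" "hilbert_symbol (- k) = cnj (hilbert_symbol k)"
  by (simp_all add: dx_symbol_def dx_inv_symbol_def half_symbol_def hilbert_symbol_def sgn_minus)

lemma cmod_symbols:
  "cmod (dx_symbol k) = \<bar>k\<bar>" "cmod (dx_inv_symbol k) = 1 / \<bar>k\<bar>" "cmod (half_symbol k) = sqrt \<bar>k\<bar>"
  by (simp_all add: dx_symbol_def dx_inv_symbol_def half_symbol_def norm_mult norm_inverse norm_divide inverse_eq_divide)

lemma abs_le_sobolev_weight: "\<bar>k\<bar> \<le> (1 + k\<^sup>2) powr (3/4)" for k :: real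
proof (rule power2_le_imp_le)
  have "k\<^sup>2 \<le> (1 + k\<^sup>2) powr 1" by simp
  also have "\<dots> \<le> (1 + k\<^sup>2) powr (3/2)" by (intro powr_mono) auto
  also have "\<dots> = ((1 + k\<^sup>2) powr (3/4))\<^sup>2" by (simp add: power2_eq_square powr_add[symmetric])
  finally show "\<bar>k\<bar>\<^sup>2 \<le> ((1 + k\<^sup>2) powr (3/4))\<^sup>2" by simp
qed simp

text \<open>The exponent 3/4 is half of 3/2, because the weight is moved inside the square.\<close>

lemma sobolev_iff:
  assumes u: "square_integrable u"
  shows "u \<in> sobolev (3/2) \<longleftrightarrow> square_integrable (\<lambda>k. complex_of_real ((1 + k\<^sup>2) powr (3/4)) * fourier_real u k)"
proof -
  have [measurable]: "fourier_real u \<in> borel_measurable borel" using square_integrableD[OF fourier_real_L2[OF u]] by simp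
  have m: "(\<lambda>k. complex_of_real ((1 + k\<^sup>2) powr (3/4)) * fourier_real u k) \<in> borel_measurable lborel"
    by measurable
  have "(cmod (complex_of_real ((1 + k\<^sup>2) powr (3/4)) * fourier_real u k))\<^sup>2 = (1 + k\<^sup>2) powr (3/2) * (cmod (fourier_real u k))\<^sup>2" for k
  proof -
    have "((1 + k\<^sup>2) powr (3/4))\<^sup>2 = (1 + k\<^sup>2) powr (3/2)" by (simp add: power2_eq_square powr_add[symmetric])
    then show ?thesis by (simp add: norm_mult power_mult_distrib)
  qed
  with u m show ?thesis by (simp add: sobolev_def square_integrable_def)
qed

lemma H_spaceI:
  assumes u: "square_integrable u" and g: "is_fourier (\<lambda>x. complex_of_real (u x)) g"
    and s: "square_integrable (\<lambda>k. complex_of_real ((1 + k\<^sup>2) powr (3/4)) * g k)"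
    and i: "square_integrable (\<lambda>k. dx_inv_symbol k * g k)"
  shows "u \<in> H_space"
proof -
  have [measurable]: "fourier_real u \<in> borel_measurable borel" using square_integrableD[OF fourier_real_L2[OF u]] by simp
  note eq = fourier_real_AE[OF u g]
  have "square_integrable (\<lambda>k. complex_of_real ((1 + k\<^sup>2) powr (3/4)) * fourier_real u k)"
    by (rule square_integrable_bound[OF s, where c=1], measurable, use eq in eventually_elim, simp)
  moreover have "square_integrable (\<lambda>k. dx_inv_symbol k * fourier_real u k)"
    by (rule square_integrable_bound[OF i, where c=1], measurable, use eq in eventually_elim, simp)
  from has_symbol_image_fourier_op[OF u symbols_cnj(2) this]
  have "\<exists>v. has_symbol_image dx_inv_symbol u v" by blast
  ultimately show ?thesis unfolding H_space_def using sobolev_iff[OF u] by simp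
qed

text \<open>The Sobolev weight dominates both \<bar>k\<bar> and its square root, so every operator
  in \<open>H_norm\<close> and in the functional maps the function into \<open>L^2\<close>.\<close>

lemma H_spaceD:
  assumes "u \<in> H_space"
  shows "square_integrable u"
    "square_integrable (\<lambda>k. complex_of_real ((1 + k\<^sup>2) powr (3/4)) * fourier_real u k)"
    "square_integrable (\<lambda>k. dx_inv_symbol k * fourier_real u k)"
    "square_integrable (\<lambda>k. dx_symbol k * fourier_real u k)"
    "square_integrable (\<lambda>k. half_symbol k * fourier_real u k)"
proof -
  show u: "square_integrable u" using assms by (simp add: H_space_def sobolev_def)
  show s: "square_integrable (\<lambda>k. complex_of_real ((1 + k\<^sup>2) powr (3/4)) * fourier_real u k)"
    using assms sobolev_iff[OF u] by (simp add: H_space_def)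
  show "square_integrable (\<lambda>k. dx_inv_symbol k * fourier_real u k)"
    using assms has_symbol_image_fourier(3)[OF u symbols_measurable(2)] by (auto simp: H_space_def)
  have [measurable]: "fourier_real u \<in> borel_measurable borel" using square_integrableD[OF fourier_real_L2[OF u]] by simp
  have "sqrt \<bar>k\<bar> \<le> (1 + k\<^sup>2) powr (3/4)" for k :: real
  proof (cases "\<bar>k\<bar> \<le> 1")
    case True
    then have "sqrt \<bar>k\<bar> \<le> 1" by simp
    also have "1 \<le> (1 + k\<^sup>2) powr (3/4)" by (rule ge_one_powr_ge_zero) auto
    finally show ?thesis .
  next
    case False
    then have "1 * \<bar>k\<bar> \<le> \<bar>k\<bar> * \<bar>k\<bar>" by (intro mult_right_mono) auto
    then have "sqrt \<bar>k\<bar> \<le> \<bar>k\<bar>" by (intro real_le_lsqrt) (auto simp: power2_eq_square)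
    then show ?thesis using abs_le_sobolev_weight[of k] by linarith
  qed
  then show "square_integrable (\<lambda>k. half_symbol k * fourier_real u k)"
    by (intro square_integrable_bound[OF s, where c=1]) (auto simp: norm_mult cmod_symbols intro!: mult_right_mono)
  show "square_integrable (\<lambda>k. dx_symbol k * fourier_real u k)"
    using abs_le_sobolev_weight
    by (intro square_integrable_bound[OF s, where c=1])
       (auto simp: norm_mult cmod_symbols intro!: AE_I2 mult_right_mono)
qed

lemma L2norm_fourier_op:
  assumes u: "square_integrable u" and m: "m \<in> borel_measurable borel" "\<And>k. m (- k) = cnj (m k)"
    and sq: "square_integrable (\<lambda>k. m k * fourier_real u k)"
  shows "L2norm (fourier_op m u) = L2norm (\<lambda>k. m k * fourier_real u k) / sqrt (2 * pi)"
proof -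
  have "(L2norm (\<lambda>k. m k * fourier_real u k))\<^sup>2 = (sqrt (2 * pi) * L2norm (fourier_op m u))\<^sup>2"
    using has_symbol_image_fourier(4)[OF u m(1) has_symbol_image_fourier_op[OF u m(2) sq]]
    by (simp add: power_mult_distrib)
  then have "L2norm (\<lambda>k. m k * fourier_real u k) = sqrt (2 * pi) * L2norm (fourier_op m u)"
    by (rule power2_eq_imp_eq) auto
  then show ?thesis by simp
qed

section \<open>The quadratic functional on the Fourier side\<close>

text \<open>The value at \<open>0\<close> is irrelevant, and is chosen so that the symbol is positive everywhere.\<close>

definition Qsym :: "real \<Rightarrow> real \<Rightarrow> real \<Rightarrow> real \<Rightarrow> real \<Rightarrow> real" where
  "Qsym c \<beta> \<gamma> \<delta> k = (if k = 0 then 1 else \<gamma> / k\<^sup>2 + \<delta> * k\<^sup>2 - \<beta> * \<bar>k\<bar> - c)"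

lemma Qsym_measurable [measurable]: "Qsym c \<beta> \<gamma> \<delta> \<in> borel_measurable borel"
  unfolding Qsym_def[abs_def] by measurable

lemma Qsym_even: "Qsym c \<beta> \<gamma> \<delta> (- k) = Qsym c \<beta> \<gamma> \<delta> k"
  by (simp add: Qsym_def)

text \<open>Plancherel turns the three squares into integrals with weights 1, 1 / k^2 and k^2. The
  mixed term goes through Parseval: the symbols of the Hilbert transform and of the derivative
  multiply to \<bar>k\<bar>.\<close>

lemma I_fun_fourier:
  assumes "u \<in> H_space"
  shows "2 * pi * I_fun \<alpha> \<beta> \<gamma> \<delta> cs u = (LINT k|lborel. Qsym (cs - \<alpha>) \<beta> \<gamma> \<delta> k * (cmod (fourier_real u k))\<^sup>2)"
    "integrable lborel (\<lambda>k. Qsym (cs - \<alpha>) \<beta> \<gamma> \<delta> k * (cmod (fourier_real u k))\<^sup>2)"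
proof -
  note D = H_spaceD[OF assms]
  let ?U = "fourier_real u" and ?p = "dx_inv u" and ?d = "dx u"
  have [measurable]: "?U \<in> borel_measurable borel" using square_integrableD[OF fourier_real_L2[OF D(1)]] by simp
  note p = has_symbol_image_fourier[OF D(1) symbols_measurable(2) has_symbol_image_fourier_op[OF D(1) symbols_cnj(2) D(3)]]
  note d = has_symbol_image_fourier[OF D(1) symbols_measurable(1) has_symbol_image_fourier_op[OF D(1) symbols_cnj(1) D(4)]]
  have Fd: "AE k in lborel. fourier_real ?d k = dx_symbol k * ?U k" by (rule fourier_real_AE[OF d(1,2)])
  have abs: "hilbert_symbol k * (dx_symbol k * z) = complex_of_real \<bar>k\<bar> * z" for k z
  proof -
    have "hilbert_symbol k * (dx_symbol k * z) = - (\<i> * \<i>) * (complex_of_real (k * sgn k) * z)"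
      unfolding hilbert_symbol_def dx_symbol_def of_real_mult by (simp only: mult_ac mult_minus_left mult_minus_right)
    then show ?thesis by (simp add: abs_sgn)
  qed
  have sh: "square_integrable (\<lambda>k. hilbert_symbol k * fourier_real ?d k)"
  proof (rule square_integrable_bound[OF d(3), where c=1])
    have [measurable]: "fourier_real ?d \<in> borel_measurable borel" using square_integrableD[OF fourier_real_L2[OF d(1)]] by simp
    show "(\<lambda>k. hilbert_symbol k * fourier_real ?d k) \<in> borel_measurable lborel" by measurable
    show "AE k in lborel. cmod (hilbert_symbol k * fourier_real ?d k) \<le> 1 * cmod (dx_symbol k * ?U k)"
      using Fd by eventually_elim (simp add: hilbert_symbol_def norm_mult sgn_if)
  qed
  let ?h = "hilbert ?d"
  note h = has_symbol_image_fourier[OF d(1) symbols_measurable(4) has_symbol_image_fourier_op[OF d(1) symbols_cnj(4) sh]]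
  have su: "square_integrable (\<lambda>x. complex_of_real (u x))" and sH: "square_integrable (\<lambda>x. complex_of_real (?h x))"
    using D(1) h(1) by (simp_all add: square_integrable_of_real_iff)
  have iu: "integrable lborel (\<lambda>x. (u x)\<^sup>2)" and ip: "integrable lborel (\<lambda>x. (?p x)\<^sup>2)"
    and id: "integrable lborel (\<lambda>x. (?d x)\<^sup>2)"
    using square_integrable_sqD[OF D(1)] square_integrable_sqD[OF p(1)] square_integrable_sqD[OF d(1)] by simp_all
  have "integrable lborel (\<lambda>x. complex_of_real (u x) * complex_of_real (?h x))"
    by (rule integrable_mult_L2[OF su sH])
  from integrable_Re[OF this] have iuh: "integrable lborel (\<lambda>x. u x * ?h x)" by simp
  have "I_fun \<alpha> \<beta> \<gamma> \<delta> cs u = (LINT x|lborel. - (cs - \<alpha>) * (u x)\<^sup>2 - \<beta> * (u x * ?h x) + \<gamma> * (?p x)\<^sup>2 + \<delta> * (?d x)\<^sup>2)"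
    unfolding I_fun_def by (simp add: mult.assoc)
  also have "\<dots> = - (cs - \<alpha>) * (L2norm u)\<^sup>2 - \<beta> * (LINT x|lborel. u x * ?h x) + \<gamma> * (L2norm ?p)\<^sup>2 + \<delta> * (L2norm ?d)\<^sup>2"
    unfolding L2norm_sq using iu ip id iuh by simp
  finally have I: "I_fun \<alpha> \<beta> \<gamma> \<delta> cs u = \<dots>" .
  have iU: "integrable lborel (\<lambda>k. (cmod (?U k))\<^sup>2)"
    by (rule square_integrable_sqD[OF fourier_real_L2[OF D(1)]])
  have nu: "2 * pi * (L2norm u)\<^sup>2 = (LINT k|lborel. (cmod (?U k))\<^sup>2)"
    using Plancherel[OF su is_fourier_fourier_real[OF D(1)]] unfolding L2norm_sq[symmetric] by (simp add: power_mult_distrib)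
  have np: "2 * pi * (L2norm ?p)\<^sup>2 = (LINT k|lborel. 1 / k\<^sup>2 * (cmod (?U k))\<^sup>2)"
    by (subst p(4)[symmetric]) (simp add: L2norm_sq norm_mult power_mult_distrib cmod_symbols power_divide)
  have ip': "integrable lborel (\<lambda>k. 1 / k\<^sup>2 * (cmod (?U k))\<^sup>2)"
    using square_integrable_sqD[OF p(3)] by (simp add: norm_mult power_mult_distrib cmod_symbols power_divide)
  have nd: "2 * pi * (L2norm ?d)\<^sup>2 = (LINT k|lborel. k\<^sup>2 * (cmod (?U k))\<^sup>2)"
    by (subst d(4)[symmetric]) (simp add: L2norm_sq norm_mult power_mult_distrib cmod_symbols power_divide)
  have id': "integrable lborel (\<lambda>k. k\<^sup>2 * (cmod (?U k))\<^sup>2)"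
    using square_integrable_sqD[OF d(3)] by (simp add: norm_mult power_mult_distrib cmod_symbols power_divide)
  have eqh: "AE k in lborel. ?U k * cnj (hilbert_symbol k * fourier_real ?d k) = complex_of_real (\<bar>k\<bar> * (cmod (?U k))\<^sup>2)"
    using Fd
  proof eventually_elim
    case (elim k)
    show ?case unfolding elim abs by (simp add: complex_norm_square del: of_real_power)
  qed
  have [measurable]: "fourier_real ?d \<in> borel_measurable borel" using square_integrableD[OF fourier_real_L2[OF d(1)]] by simp
  have ih': "integrable lborel (\<lambda>k. \<bar>k\<bar> * (cmod (?U k))\<^sup>2)"
    using square_integrable_sqD[OF D(5)] by (simp add: norm_mult power_mult_distrib cmod_symbols)
  have "2 * pi * (LINT x|lborel. u x * ?h x) = 2 * pi * Re (LINT x|lborel. complex_of_real (u x) * cnj (complex_of_real (?h x)))"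
    by (simp flip: of_real_mult)
  also have "\<dots> = Re (LINT k|lborel. ?U k * cnj (hilbert_symbol k * fourier_real ?d k))"
    by (rule Parseval[OF su is_fourier_fourier_real[OF D(1)] sH h(2), symmetric])
  also have "(LINT k|lborel. ?U k * cnj (hilbert_symbol k * fourier_real ?d k)) = (LINT k|lborel. complex_of_real (\<bar>k\<bar> * (cmod (?U k))\<^sup>2))"
    using eqh by (intro integral_cong_AE) auto
  finally have nh: "2 * pi * (LINT x|lborel. u x * ?h x) = (LINT k|lborel. \<bar>k\<bar> * (cmod (?U k))\<^sup>2)"
    unfolding integral_complex_of_real by simp
  \<comment> \<open>The origin is discarded because \<open>Qsym\<close> has an artificial value
    there.\<close>
  have ae: "AE k in lborel. (Qsym (cs - \<alpha>) \<beta> \<gamma> \<delta> k * (cmod (?U k))\<^sup>2) =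
    - (cs - \<alpha>) * (cmod (?U k))\<^sup>2 - \<beta> * (\<bar>k\<bar> * (cmod (?U k))\<^sup>2) + \<gamma> * (1 / k\<^sup>2 * (cmod (?U k))\<^sup>2) + \<delta> * (k\<^sup>2 * (cmod (?U k))\<^sup>2)"
    using AE_lborel_singleton[of 0] by eventually_elim (simp add: Qsym_def algebra_simps)
  have int: "integrable lborel (\<lambda>k. - (cs - \<alpha>) * (cmod (?U k))\<^sup>2 - \<beta> * (\<bar>k\<bar> * (cmod (?U k))\<^sup>2)
      + \<gamma> * (1 / k\<^sup>2 * (cmod (?U k))\<^sup>2) + \<delta> * (k\<^sup>2 * (cmod (?U k))\<^sup>2))"
    by (intro Bochner_Integration.integrable_add Bochner_Integration.integrable_diff integrable_mult_right iU ih' ip' id')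
  show "integrable lborel (\<lambda>k. Qsym (cs - \<alpha>) \<beta> \<gamma> \<delta> k * (cmod (?U k))\<^sup>2)"
    using int ae by (subst integrable_cong_AE) auto
  have "(LINT k|lborel. Qsym (cs - \<alpha>) \<beta> \<gamma> \<delta> k * (cmod (?U k))\<^sup>2) = 
     (LINT k|lborel. - (cs - \<alpha>) * (cmod (?U k))\<^sup>2 - \<beta> * (\<bar>k\<bar> * (cmod (?U k))\<^sup>2)
      + \<gamma> * (1 / k\<^sup>2 * (cmod (?U k))\<^sup>2) + \<delta> * (k\<^sup>2 * (cmod (?U k))\<^sup>2))"
    using ae by (intro integral_cong_AE) auto
  also have "\<dots> = - (cs - \<alpha>) * (LINT k|lborel. (cmod (?U k))\<^sup>2) - \<beta> * (LINT k|lborel. \<bar>k\<bar> * (cmod (?U k))\<^sup>2)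
      + \<gamma> * (LINT k|lborel. 1 / k\<^sup>2 * (cmod (?U k))\<^sup>2) + \<delta> * (LINT k|lborel. k\<^sup>2 * (cmod (?U k))\<^sup>2)"
    using iU ih' ip' id' by (simp del: times_divide_eq_left)
  also have "\<dots> = 2 * pi * I_fun \<alpha> \<beta> \<gamma> \<delta> cs u"
    unfolding I nu[symmetric] nh[symmetric] np[symmetric] nd[symmetric] by (simp add: algebra_simps)
  finally show "2 * pi * I_fun \<alpha> \<beta> \<gamma> \<delta> cs u = (LINT k|lborel. Qsym (cs - \<alpha>) \<beta> \<gamma> \<delta> k * (cmod (?U k))\<^sup>2)" by simp
qed

section \<open>Coercivity of the symbol and growth of the nonlinearity\<close>

text \<open>The expression is quadratic in \<open>s\<close>. Its vertex \<open>s = (1 - a) k\<^sup>2\<close> may lie to the left of the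
  admissible range \<open>s \<ge> a\<close>, hence the case distinction.\<close>

lemma z_plus_quartic:
  fixes a s k :: real
  assumes a: "0 < a" "a < 1" and s: "a \<le> s" and k: "0 < k"
  shows "0 \<le> s\<^sup>2 - a\<^sup>2 + k^4 - 4 * a * k^3 - 2 * ((1 - a) * s - a * (1 + a)) * k\<^sup>2"
    (is "0 \<le> ?P")
proof (cases "a \<le> (1 - a) * k\<^sup>2")
  case True
  have "4 * a\<^sup>2 * (1 - a) = a * (1 - (1 - 2 * a)\<^sup>2)" by algebra
  also have "\<dots> \<le> a * 1" using a by (intro mult_left_mono) auto
  also have "\<dots> \<le> (1 - a) * k\<^sup>2" using True by simp
  finally have "(2 * a)\<^sup>2 * (1 - a) \<le> k\<^sup>2 * (1 - a)" by (simp add: mult.commute power_mult_distrib)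
  then have "2 * a \<le> k" using a k by (intro power2_le_imp_le[of "2 * a" k]) auto
  then have "0 \<le> ((1 - a) * k\<^sup>2 - a) + k * (k - 2 * a)" using True k by simp
  then have "0 \<le> a * (k - 1)\<^sup>2 * (((1 - a) * k\<^sup>2 - a) + k * (k - 2 * a))"
    using a by (intro mult_nonneg_nonneg) auto
  moreover have "?P = (s - (1 - a) * k\<^sup>2)\<^sup>2 + a * (k - 1)\<^sup>2 * (((1 - a) * k\<^sup>2 - a) + k * (k - 2 * a))"
    by algebra
  ultimately show ?thesis by simp
next
  case False
  then have "0 \<le> (s - a) * (s + a - 2 * ((1 - a) * k\<^sup>2))" using s by (intro mult_nonneg_nonneg) auto
  moreover have "?P = (s - a) * (s + a - 2 * ((1 - a) * k\<^sup>2)) + k\<^sup>2 * (k - 2 * a)\<^sup>2" by algebra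
  ultimately show ?thesis by simp
qed

text \<open>Dividing by \<delta> leaves only the parameters \<open>a\<close> and \<open>g\<close>.
  The square root in \<open>z_plus\<close> becomes the variable \<open>s\<close>, and s^2 = g + a^2
  eliminates \<open>g\<close>; after multiplication by k^2 the claim is
  \<open>z_plus_quartic\<close>.\<close>

lemma z_plus_le:
  assumes "\<delta> > 0" "\<gamma> > 0" "\<beta> > 0" "\<beta> < 4 * \<delta>" "k > 0"
  shows "z_plus \<beta> \<gamma> \<delta> \<le> \<gamma> / k\<^sup>2 + \<delta> * k\<^sup>2 - \<beta> * k"
proof -
  define a g where "a = \<beta> / (4 * \<delta>)" and "g = \<gamma> / \<delta>"
  define s where "s = sqrt (g + a\<^sup>2)"
  have a: "0 < a" "a < 1" and g: "0 < g" using assms by (auto simp: a_def g_def)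
  have b: "\<beta> = 4 * \<delta> * a" and c: "\<gamma> = \<delta> * g" using assms by (auto simp: a_def g_def)
  have s2: "s\<^sup>2 = g + a\<^sup>2" using g by (simp add: s_def)
  have "a \<le> s" unfolding s_def using g by (intro real_le_rsqrt) simp
  from z_plus_quartic[OF a this \<open>k > 0\<close>]
  have "2 * ((1 - a) * s - a * (1 + a)) * k\<^sup>2 \<le> g + k^4 - 4 * a * k^3"
    unfolding s2 by simp
  then have "2 * ((1 - a) * s - a * (1 + a)) \<le> (g + k^4 - 4 * a * k^3) / k\<^sup>2"
    using assms by (simp add: pos_le_divide_eq)
  also have "\<dots> = g / k\<^sup>2 + k\<^sup>2 - 4 * a * k"
    using assms by (simp add: field_simps power2_eq_square power3_eq_cube power4_eq_xxxx)
  finally have "\<delta> * (2 * ((1 - a) * s - a * (1 + a))) \<le> \<delta> * (g / k\<^sup>2 + k\<^sup>2 - 4 * a * k)"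
    using assms by (intro mult_left_mono) auto
  moreover have "z_plus \<beta> \<gamma> \<delta> = \<delta> * (2 * ((1 - a) * s - a * (1 + a)))"
    unfolding z_plus_def a_def[symmetric] g_def[symmetric] s_def[symmetric] unfolding b by (simp add: algebra_simps)
  moreover have "\<gamma> / k\<^sup>2 + \<delta> * k\<^sup>2 - \<beta> * k = \<delta> * (g / k\<^sup>2 + k\<^sup>2 - 4 * a * k)"
    unfolding b c by (simp add: algebra_simps)
  ultimately show ?thesis by simp
qed

text \<open>Positive k suffice because the symbol is even. The four alternatives lead to four
  bounds: signs of the terms, the inequality of arithmetic and geometric means, completion of the
  square, and \<open>z_plus_le\<close>.\<close>

lemma symbol_bounded_below:
  assumes "\<delta> > 0" "\<gamma> > 0"
    and cond: "(\<beta> < 0 \<and> c < 0)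
       \<or> (\<beta> < 0 \<and> 0 < c \<and> c < 2 * sqrt (\<gamma> * \<delta>))
       \<or> (\<beta> > 0 \<and> c \<le> - (\<beta>\<^sup>2 / (4 * \<delta>)))
       \<or> (\<beta> > 0 \<and> 4 * \<delta> - \<beta> > 0 \<and> \<beta> ^ 3 < \<gamma> * (4 * \<delta> - \<beta>)\<^sup>2
            \<and> 0 < c \<and> c < z_plus \<beta> \<gamma> \<delta>)"
  shows "\<exists>e>0. \<forall>k>0. e \<le> \<gamma> / k\<^sup>2 + \<delta> * k\<^sup>2 - \<beta> * k - c"
  using cond
proof (elim disjE conjE)
  assume b: "\<beta> < 0" "c < 0"
  have "- c \<le> \<gamma> / k\<^sup>2 + \<delta> * k\<^sup>2 - \<beta> * k - c" if "k > 0" for k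
  proof -
    have "0 \<le> \<gamma> / k\<^sup>2" "0 \<le> \<delta> * k\<^sup>2" "\<beta> * k \<le> 0"
      using assms that b by (auto simp: mult_nonpos_nonneg)
    then show ?thesis by linarith
  qed
  with b show ?thesis by (intro exI[of _ "- c"]) auto
next
  assume b: "\<beta> < 0" "c < 2 * sqrt (\<gamma> * \<delta>)"
  have "2 * sqrt (\<gamma> * \<delta>) - c \<le> \<gamma> / k\<^sup>2 + \<delta> * k\<^sup>2 - \<beta> * k - c" if "k > 0" for k
  proof -
    \<comment> \<open>The cross term of this square is the critical speed 2 sqrt (\<gamma>
      \<delta>).\<close>
    have "0 \<le> (sqrt \<gamma> / k - sqrt \<delta> * k)\<^sup>2" by simp
    also have "\<dots> = \<gamma> / k\<^sup>2 + \<delta> * k\<^sup>2 - 2 * sqrt (\<gamma> * \<delta>)"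
      using assms that by (simp add: power2_diff power_divide power_mult_distrib real_sqrt_mult)
    finally have "2 * sqrt (\<gamma> * \<delta>) \<le> \<gamma> / k\<^sup>2 + \<delta> * k\<^sup>2" by simp
    moreover have "\<beta> * k \<le> 0" using that b by (auto simp: mult_nonpos_nonneg)
    ultimately show ?thesis by linarith
  qed
  with b show ?thesis by (intro exI[of _ "2 * sqrt (\<gamma> * \<delta>) - c"]) auto
next
  assume b: "\<beta> > 0" "c \<le> - (\<beta>\<^sup>2 / (4 * \<delta>))"
  \<comment> \<open>In the borderline case the completed square vanishes at k = \<beta> / (2
    \<delta>). The term \<gamma> / k^2 compensates for this up to twice that point, and beyond it
    the square itself is at least \<beta>^2 / (4 \<delta>).\<close>
  have "min (\<gamma> * \<delta>\<^sup>2 / \<beta>\<^sup>2) (\<beta>\<^sup>2 / (4 * \<delta>)) \<le> \<gamma> / k\<^sup>2 + \<delta> * k\<^sup>2 - \<beta> * k - c" if "k > 0" for k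
  proof -
    have sq: "\<delta> * k\<^sup>2 - \<beta> * k + \<beta>\<^sup>2 / (4 * \<delta>) = \<delta> * (k - \<beta> / (2 * \<delta>))\<^sup>2"
      using assms by (simp add: power2_diff power_divide field_simps power2_eq_square)
    then have g: "\<delta> * (k - \<beta> / (2 * \<delta>))\<^sup>2 \<le> \<delta> * k\<^sup>2 - \<beta> * k - c" using b by linarith
    show ?thesis
    proof (cases "k \<le> \<beta> / \<delta>")
      case True
      then have "k\<^sup>2 \<le> (\<beta> / \<delta>)\<^sup>2" using that by (intro power_mono) auto
      then have "\<gamma> / (\<beta> / \<delta>)\<^sup>2 \<le> \<gamma> / k\<^sup>2" using assms that b by (intro divide_left_mono) auto
      moreover have "\<gamma> / (\<beta> / \<delta>)\<^sup>2 = \<gamma> * \<delta>\<^sup>2 / \<beta>\<^sup>2" by (simp add: power_divide)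
      moreover have "0 \<le> \<delta> * (k - \<beta> / (2 * \<delta>))\<^sup>2" using assms by simp
      ultimately show ?thesis using g by linarith
    next
      case False
      then have "\<beta> / (2 * \<delta>) \<le> k - \<beta> / (2 * \<delta>)" using assms by (simp add: field_simps)
      then have "(\<beta> / (2 * \<delta>))\<^sup>2 \<le> (k - \<beta> / (2 * \<delta>))\<^sup>2" using assms b by (intro power_mono) auto
      then have "\<delta> * (\<beta> / (2 * \<delta>))\<^sup>2 \<le> \<delta> * (k - \<beta> / (2 * \<delta>))\<^sup>2" using assms by (intro mult_left_mono) auto
      moreover have "\<delta> * (\<beta> / (2 * \<delta>))\<^sup>2 = \<beta>\<^sup>2 / (4 * \<delta>)" using assms by (simp add: power2_eq_square)
      moreover have "0 \<le> \<gamma> / k\<^sup>2" using assms by simp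
      ultimately show ?thesis using g by linarith
    qed
  qed
  moreover have "0 < min (\<gamma> * \<delta>\<^sup>2 / \<beta>\<^sup>2) (\<beta>\<^sup>2 / (4 * \<delta>))" using assms b by simp
  ultimately show ?thesis by blast
next
  assume "\<beta> > 0" "4 * \<delta> - \<beta> > 0" and b: "c < z_plus \<beta> \<gamma> \<delta>"
  then have "z_plus \<beta> \<gamma> \<delta> - c \<le> \<gamma> / k\<^sup>2 + \<delta> * k\<^sup>2 - \<beta> * k - c" if "k > 0" for k
    using z_plus_le[of \<delta> \<gamma> \<beta> k] assms that by simp
  with b show ?thesis by (intro exI[of _ "z_plus \<beta> \<gamma> \<delta> - c"]) auto
qed

text \<open>A positive lower bound does not by itself give growth. It is combined convexly with the
  crude estimate that has the right growth but a negative constant.\<close>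

lemma Qsym_coercive:
  assumes "\<delta> > 0" "\<gamma> > 0" and e: "e > 0" "\<And>k. k > 0 \<Longrightarrow> e \<le> \<gamma> / k\<^sup>2 + \<delta> * k\<^sup>2 - \<beta> * k - c"
  shows "\<exists>\<kappa>>0. \<forall>k. k \<noteq> 0 \<longrightarrow> \<kappa> * (1 / k\<^sup>2 + 1 + k\<^sup>2) \<le> Qsym c \<beta> \<gamma> \<delta> k"
proof -
  \<comment> \<open>The term \<beta> k is absorbed into half of \<delta> k^2 by completing the
    square, at the cost of \<beta>^2 / (2 \<delta>).\<close>
  define M where "M = \<bar>c\<bar> + \<beta>\<^sup>2 / (2 * \<delta>)"
  have M: "0 \<le> M" unfolding M_def using assms by simp
  \<comment> \<open>Chosen so that exactly half of the lower bound \<open>e\<close> survives the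
    loss \<theta> M and the reduction of its own weight to 1 - \<theta>.\<close>
  define \<theta> where "\<theta> = e / (2 * (e + M))"
  have \<theta>: "0 < \<theta>" "\<theta> \<le> 1" "\<theta> * (M + e) = e / 2" unfolding \<theta>_def using e M by (auto simp: field_simps)
  define \<kappa> where "\<kappa> = min (\<theta> * \<gamma>) (min (\<theta> * \<delta> / 2) (e / 2))"
  have \<kappa>: "0 < \<kappa>" unfolding \<kappa>_def using \<theta> assms by simp
  have "\<kappa> * (1 / k\<^sup>2 + 1 + k\<^sup>2) \<le> \<gamma> / k\<^sup>2 + \<delta> * k\<^sup>2 - \<beta> * k - c" if k: "k > 0" for k
  proof -
    let ?q = "\<gamma> / k\<^sup>2 + \<delta> * k\<^sup>2 - \<beta> * k - c"
    have "0 \<le> \<delta> / 2 * (k - \<beta> / \<delta>)\<^sup>2" using assms by simp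
    also have "\<dots> = \<delta> * k\<^sup>2 / 2 - \<beta> * k + \<beta>\<^sup>2 / (2 * \<delta>)"
      using assms by (simp add: power2_diff power_divide field_simps power2_eq_square)
    finally have "\<gamma> / k\<^sup>2 + \<delta> * k\<^sup>2 / 2 - M \<le> ?q" unfolding M_def by linarith
    then have "\<theta> * (\<gamma> / k\<^sup>2 + \<delta> * k\<^sup>2 / 2 - M) + (1 - \<theta>) * e \<le> \<theta> * ?q + (1 - \<theta>) * ?q"
      using \<theta> e(2)[OF k] by (intro add_mono mult_left_mono) auto
    also have "\<dots> = ?q" unfolding distrib_right[symmetric] by simp
    also have "\<theta> * (\<gamma> / k\<^sup>2 + \<delta> * k\<^sup>2 / 2 - M) + (1 - \<theta>) * e
       = \<theta> * \<gamma> * (1 / k\<^sup>2) + \<theta> * \<delta> / 2 * k\<^sup>2 + e / 2"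
      using \<theta>(3) by (simp add: algebra_simps)
    finally have le: "\<theta> * \<gamma> * (1 / k\<^sup>2) + \<theta> * \<delta> / 2 * k\<^sup>2 + e / 2 \<le> ?q" .
    have "\<kappa> * (1 / k\<^sup>2) \<le> \<theta> * \<gamma> * (1 / k\<^sup>2)" "\<kappa> * k\<^sup>2 \<le> \<theta> * \<delta> / 2 * k\<^sup>2" "\<kappa> \<le> e / 2"
      unfolding \<kappa>_def by (intro mult_right_mono; simp)+ simp
    then show ?thesis using le by (simp add: distrib_left)
  qed
  from this[of "\<bar>_\<bar>"] have "\<kappa> * (1 / k\<^sup>2 + 1 + k\<^sup>2) \<le> Qsym c \<beta> \<gamma> \<delta> k" if "k \<noteq> 0" for k
    using that by (simp add: Qsym_def)
  with \<kappa> show ?thesis by blast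
qed

section \<open>Homogeneous nonlinearities and their primitives\<close>

text \<open>Positive scaling factors are admissible for every exponent, so \<open>f\<close> is
  determined away from the origin by its values at 1 and -1.\<close>

lemma homogeneous_pos:
  assumes "homogeneous p f" "s > 0"
  shows "f s = s powr p * f 1" "f (- s) = s powr p * f (- 1)"
proof -
  have r: "is_real_power s p (s powr p)" using assms(2) by (simp add: is_real_power_def)
  have "f (s * 1) = s powr p * f 1" "f (s * (- 1)) = s powr p * f (- 1)"
    using assms r unfolding homogeneous_def by (metis less_irrefl one_neq_zero, metis less_irrefl neg_equal_0_iff_equal one_neq_zero)
  then show "f s = s powr p * f 1" "f (- s) = s powr p * f (- 1)" by simp_all
qed

text \<open>The power is differentiated only on the open half line; continuity up to the origin and
  \<open>F 0 = 0\<close> fix the constant of integration.\<close>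

lemma half_line_primitive:
  fixes F :: "real \<Rightarrow> real"
  assumes der: "\<And>s. s > 0 \<Longrightarrow> (F has_real_derivative a * s powr p) (at s)" and cont: "continuous_on {0..} F"
    and F0: "F 0 = 0" and p: "p > 0" and s: "s \<ge> 0"
  shows "F s = a / (p + 1) * s powr (p + 1)"
proof (cases "s = 0")
  case False
  then have s: "s > 0" using s by simp
  let ?D = "\<lambda>s. F s - a / (p + 1) * s powr (p + 1)"
  have "?D s = ?D 0"
  proof (rule DERIV_isconst2[OF s, of ?D s])
    have "continuous_on {0..s} F" by (rule continuous_on_subset[OF cont]) auto
    moreover have "continuous_on {0..s} (\<lambda>s. s powr (p + 1))"
      by (intro continuous_on_powr' continuous_intros) (use p in auto)
    ultimately show "continuous_on {0..s} ?D"
      by (intro continuous_on_diff continuous_on_mult continuous_on_const)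
    fix x assume x: "0 < x" "x < s"
    have "(?D has_real_derivative a * x powr p - a / (p + 1) * ((p + 1) * x powr (p + 1 - 1))) (at x)"
      by (intro DERIV_diff der x DERIV_cmult has_real_derivative_powr)
    then show "(?D has_real_derivative 0) (at x)" using p by simp
  qed (use s in auto)
  then show ?thesis using F0 p by simp
qed (use F0 p in simp)

lemma homogeneous_primitive:
  assumes h: "homogeneous p f" and der: "\<And>s. (F has_real_derivative f s) (at s)" and F0: "F 0 = 0"
    and p: "p > 1"
  shows "s \<ge> 0 \<Longrightarrow> F s = f 1 / (p + 1) * s powr (p + 1)"
    and "s \<ge> 0 \<Longrightarrow> F (- s) = - f (- 1) / (p + 1) * s powr (p + 1)"
proof -
  have c: "continuous_on A F" for A
    using der by (meson DERIV_continuous_on has_field_derivative_at_within)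
  show "s \<ge> 0 \<Longrightarrow> F s = f 1 / (p + 1) * s powr (p + 1)"
  proof (rule half_line_primitive)
    show "(F has_real_derivative f 1 * s powr p) (at s)" if "s > 0" for s
      using der[of s] homogeneous_pos(1)[OF h that] by (simp add: mult.commute)
  qed (use c F0 p in auto)
  show "s \<ge> 0 \<Longrightarrow> F (- s) = - f (- 1) / (p + 1) * s powr (p + 1)"
  proof (rule half_line_primitive[where F="\<lambda>s. F (- s)"])
    show "((\<lambda>s. F (- s)) has_real_derivative - f (- 1) * s powr p) (at s)" if "s > 0" for s
    proof -
      have "((\<lambda>s. F (- s)) has_real_derivative f (- s) * (- 1)) (at s)"
        by (rule DERIV_chain2[OF der]) (auto intro!: derivative_eq_intros)
      then show ?thesis using homogeneous_pos(2)[OF h that] by (simp add: mult.commute)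
    qed
    have "continuous_on {0..} (F \<circ> uminus)" by (intro continuous_on_compose c continuous_intros)
    then show "continuous_on {0..} (\<lambda>s. F (- s))" by (simp add: o_def)
  qed (use F0 p in auto)
qed

lemma homogeneous_primitive_bounds:
  assumes h: "homogeneous p f" and der: "\<And>s. (F has_real_derivative f s) (at s)" and F0: "F 0 = 0"
    and p: "p > 1"
  shows "t > 0 \<Longrightarrow> F (t * s) = t powr (p + 1) * F s"
    and "\<exists>L\<ge>0. \<forall>s. \<bar>F s\<bar> \<le> L * \<bar>s\<bar> powr (p + 1) \<and> \<bar>f s\<bar> \<le> L * \<bar>s\<bar> powr p"
proof -
  note P = homogeneous_primitive[OF h der F0 p]
  show "F (t * s) = t powr (p + 1) * F s" if t: "t > 0"
  proof (cases "s \<ge> 0")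
    case True
    then show ?thesis using P(1)[of s] P(1)[of "t * s"] t by (simp add: powr_mult)
  next
    case False
    then show ?thesis using P(2)[of "- s"] P(2)[of "- (t * s)"] powr_mult[of t "- s" "p + 1"] t
      by (simp add: mult_nonneg_nonpos)
  qed
  define L where "L = \<bar>f 1\<bar> + \<bar>f (- 1)\<bar>"
  have L: "0 \<le> L" by (simp add: L_def)
  have Fb: "\<bar>F s\<bar> \<le> L * \<bar>s\<bar> powr (p + 1)" for s
  proof -
    have 1: "\<bar>f 1\<bar> / (p + 1) \<le> L" "\<bar>f (- 1)\<bar> / (p + 1) \<le> L"
      unfolding L_def using p by (auto simp: divide_le_eq algebra_simps intro!: add_increasing mult_nonneg_nonneg)
    show ?thesis
    proof (cases "s \<ge> 0")
      case True
      then show ?thesis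
        using P(1)[of s] mult_right_mono[OF 1(1), of "s powr (p + 1)"] p by (simp add: abs_mult)
    next
      case False
      then show ?thesis
        using P(2)[of "- s"] mult_right_mono[OF 1(2), of "(- s) powr (p + 1)"] p by (simp add: abs_mult)
    qed
  qed
  \<comment> \<open>Homogeneity is stated for nonzero arguments only. The value at the origin is
    recovered as the derivative of \<open>F\<close>, which vanishes faster than linearly
    there.\<close>
  have f0: "f 0 = 0"
  proof (rule DERIV_unique[OF der[of 0]])
    show "(F has_real_derivative 0) (at 0)"
      unfolding DERIV_def
    proof (rule Lim_null_comparison)
      have "((\<lambda>h. L * \<bar>h\<bar> powr p) \<longlongrightarrow> L * \<bar>0::real\<bar> powr p) (at 0)"
        using p by (intro tendsto_intros tendsto_powr') auto
      then show "((\<lambda>h. L * \<bar>h\<bar> powr p) \<longlongrightarrow> 0) (at (0::real))" using p by simp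
      show "\<forall>\<^sub>F h in at 0. norm ((F (0 + h) - F 0) / h) \<le> L * \<bar>h\<bar> powr p"
      proof (rule eventually_mono[OF eventually_at_ball'[of 1 0 UNIV]])
        fix h :: real assume "h \<in> ball 0 1 \<and> h \<noteq> 0 \<and> h \<in> UNIV"
        then show "norm ((F (0 + h) - F 0) / h) \<le> L * \<bar>h\<bar> powr p"
          using Fb[of h] F0 by (simp add: divide_le_eq powr_add mult.assoc)
      qed simp
    qed
  qed
  have fb: "\<bar>f s\<bar> \<le> L * \<bar>s\<bar> powr p" for s
  proof -
    consider "s > 0" | "s = 0" | "s < 0" by linarith
    then show ?thesis
    proof cases
      case 1
      then show ?thesis using homogeneous_pos(1)[OF h 1] by (simp add: abs_mult L_def mult.commute distrib_right)
    next
      case 3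
      then show ?thesis using homogeneous_pos(2)[OF h, of "- s"] by (simp add: abs_mult L_def mult.commute distrib_right)
    qed (simp add: f0)
  qed
  show "\<exists>L\<ge>0. \<forall>s. \<bar>F s\<bar> \<le> L * \<bar>s\<bar> powr (p + 1) \<and> \<bar>f s\<bar> \<le> L * \<bar>s\<bar> powr p"
    using L Fb fb by blast
qed

text \<open>The elementary inequality behind the splitting of K. By symmetry let y be the smaller
  argument: the mean value theorem bounds F(x + y) - F(x), and F(y) is small by itself. The surplus
  powers of x go into the constant through \<open>B\<close>, which leaves a defect bounded by a
  product of the two arguments.\<close>

lemma primitive_almost_additive:
  fixes F f :: "real \<Rightarrow> real"
  assumes der: "\<And>s. (F has_real_derivative f s) (at s)" and p: "p > 1" and L: "L \<ge> 0"
    and b: "\<And>s. \<bar>F s\<bar> \<le> L * \<bar>s\<bar> powr (p + 1)" "\<And>s. \<bar>f s\<bar> \<le> L * \<bar>s\<bar> powr p"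
    and B: "\<bar>x\<bar> \<le> B" "\<bar>y\<bar> \<le> B"
  shows "\<bar>F (x + y) - F x - F y\<bar> \<le> (L * 2 powr p + L) * B powr (p - 1) * (\<bar>x\<bar> * \<bar>y\<bar>)"
proof -
  have *: "\<bar>F (x + y) - F x - F y\<bar> \<le> (L * 2 powr p + L) * B powr (p - 1) * (\<bar>x\<bar> * \<bar>y\<bar>)"
    if xy: "\<bar>y\<bar> \<le> \<bar>x\<bar>" and x: "\<bar>x\<bar> \<le> B" for x y
  proof -
    \<comment> \<open>Both x and x + y lie in the ball of radius 2 \<bar>x\<bar>, since y is the
      smaller argument.\<close>
    have "norm (F (x + y) - F x) \<le> (L * (2 * \<bar>x\<bar>) powr p) * norm (x + y - x)"
    proof (rule field_differentiable_bound[of "cball 0 (2 * \<bar>x\<bar>)" F f])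
      fix z :: real assume "z \<in> cball 0 (2 * \<bar>x\<bar>)"
      then have "\<bar>z\<bar> powr p \<le> (2 * \<bar>x\<bar>) powr p" using p by (intro powr_mono2) auto
      then show "norm (f z) \<le> L * (2 * \<bar>x\<bar>) powr p"
        using order_trans[OF b(2)[of z] mult_left_mono[OF _ L]] by simp
      show "(F has_field_derivative f z) (at z within cball 0 (2 * \<bar>x\<bar>))"
        using der has_field_derivative_at_within by blast
    qed (use xy in auto)
    then have 1: "\<bar>F (x + y) - F x\<bar> \<le> L * 2 powr p * (\<bar>x\<bar> powr p * \<bar>y\<bar>)"
      by (simp add: powr_mult mult.assoc)
    have 2: "\<bar>F y\<bar> \<le> L * (\<bar>x\<bar> powr p * \<bar>y\<bar>)"
    proof -
      have "\<bar>y\<bar> powr (p + 1) = \<bar>y\<bar> powr p * \<bar>y\<bar>" by (cases "y = 0") (auto simp: powr_add)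
      also have "\<dots> \<le> \<bar>x\<bar> powr p * \<bar>y\<bar>" using xy p by (intro mult_right_mono powr_mono2) auto
      finally show ?thesis using order_trans[OF b(1)[of y] mult_left_mono[OF _ L]] by simp
    qed
    have 3: "\<bar>x\<bar> powr p * \<bar>y\<bar> \<le> B powr (p - 1) * (\<bar>x\<bar> * \<bar>y\<bar>)"
    proof -
      have "\<bar>x\<bar> powr p = \<bar>x\<bar> powr (p - 1) * \<bar>x\<bar>"
        using powr_add[of "\<bar>x\<bar>" "p - 1" 1] by (cases "x = 0") auto
      also have "\<dots> \<le> B powr (p - 1) * \<bar>x\<bar>" using x p by (intro mult_right_mono powr_mono2) auto
      finally show ?thesis by (simp add: mult_right_mono mult.assoc[symmetric])
    qed
    have "\<bar>F (x + y) - F x - F y\<bar> \<le> (L * 2 powr p + L) * (\<bar>x\<bar> powr p * \<bar>y\<bar>)"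
      using 1 2 unfolding distrib_right by linarith
    also have "\<dots> \<le> (L * 2 powr p + L) * (B powr (p - 1) * (\<bar>x\<bar> * \<bar>y\<bar>))"
      using L by (intro mult_left_mono 3) auto
    finally show ?thesis by (simp add: mult.assoc)
  qed
  show ?thesis
  proof (cases "\<bar>y\<bar> \<le> \<bar>x\<bar>")
    case True
    from *[OF this B(1)] show ?thesis .
  next
    case False
    then have "\<bar>x\<bar> \<le> \<bar>y\<bar>" by simp
    from *[OF this B(2)] show ?thesis by (simp add: add.commute mult.commute algebra_simps)
  qed
qed

section \<open>Weak compactness\<close>

text \<open>The real inner product underlying \<open>L2norm\<close>; the transforms of interest come
  from real functions, and squared norms of differences involve only the real part.\<close>

definition rip :: "(real \<Rightarrow> complex) \<Rightarrow> (real \<Rightarrow> complex) \<Rightarrow> real" where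
  "rip f g = Re (LINT x|lborel. f x * cnj (g x))"

lemma rip_self: "rip f f = (L2norm f)\<^sup>2"
  unfolding rip_def L2norm_sq complex_norm_square[symmetric] integral_complex_of_real by simp

lemma rip_bound:
  assumes "square_integrable f" "square_integrable g"
  shows "\<bar>rip f g\<bar> \<le> L2norm f * L2norm g"
  unfolding rip_def
  using abs_Re_le_cmod[of "LINT x|lborel. f x * cnj (g x)"] L2_Cauchy_Schwarz_complex[OF assms(1) square_integrable_cnj[OF assms(2)]]
  by (simp add: L2norm_cnj)

lemma rip_commute:
  "rip f g = rip g f"
proof -
  have "rip f g = Re (cnj (LINT x|lborel. f x * cnj (g x)))" unfolding rip_def by simp
  also have "cnj (LINT x|lborel. f x * cnj (g x)) = (LINT x|lborel. cnj (f x * cnj (g x)))"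
    by (rule Bochner_Integration.integral_cnj[symmetric])
  finally show ?thesis unfolding rip_def by (simp add: mult.commute)
qed

lemma rip_add_left:
  assumes "square_integrable f" "square_integrable g" "square_integrable h"
  shows "rip (\<lambda>x. f x + g x) h = rip f h + rip g h"
  unfolding rip_def distrib_right
  by (subst Bochner_Integration.integral_add) (auto intro!: integrable_mult_L2 square_integrable_cnj assms)

lemma rip_diff_left:
  assumes "square_integrable f" "square_integrable g" "square_integrable h"
  shows "rip (\<lambda>x. f x - g x) h = rip f h - rip g h"
  unfolding rip_def left_diff_distrib
  by (subst Bochner_Integration.integral_diff) (auto intro!: integrable_mult_L2 square_integrable_cnj assms)

lemma rip_cmult_left: "rip (\<lambda>x. complex_of_real c * f x) h = c * rip f h"
proof -
  have "(LINT x|lborel. complex_of_real c * f x * cnj (h x)) = complex_of_real c * (LINT x|lborel. f x * cnj (h x))"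
    unfolding mult.assoc by (rule integral_mult_right_zero)
  then show ?thesis unfolding rip_def by simp
qed

lemma rip_diff_right:
  assumes "square_integrable f" "square_integrable g" "square_integrable h"
  shows "rip h (\<lambda>x. f x - g x) = rip h f - rip h g"
  using rip_diff_left[OF assms] by (simp add: rip_commute[of h])

lemma L2norm_diff_sq_rip:
  assumes "square_integrable f" "square_integrable g"
  shows "(L2norm (\<lambda>x. f x - g x))\<^sup>2 = (L2norm f)\<^sup>2 + (L2norm g)\<^sup>2 - 2 * rip f g"
  using L2norm_diff_sq[OF assms] by (simp add: rip_def)

lemma L2norm_parallelogram:
  fixes f g :: "real \<Rightarrow> complex"
  assumes "square_integrable f" "square_integrable g"
  shows "(L2norm (\<lambda>x. f x - g x))\<^sup>2 = 2 * (L2norm f)\<^sup>2 + 2 * (L2norm g)\<^sup>2 - 4 * (L2norm (\<lambda>x. complex_of_real (1/2) * (f x + g x)))\<^sup>2"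
proof -
  have m: "square_integrable (\<lambda>x. complex_of_real (-1) * g x)" by (intro square_integrable_cmult assms)
  have "rip f (\<lambda>x. complex_of_real (-1) * g x) = - rip f g"
    using rip_cmult_left[of "-1" g f] by (simp add: rip_commute[of f])
  moreover have "L2norm (\<lambda>x. complex_of_real (-1) * g x) = L2norm g"
    unfolding L2norm_cmult by simp
  ultimately have "(L2norm (\<lambda>x. f x + g x))\<^sup>2 = (L2norm f)\<^sup>2 + (L2norm g)\<^sup>2 + 2 * rip f g"
    using L2norm_diff_sq_rip[OF assms(1) m] by simp
  then show ?thesis
    unfolding L2norm_diff_sq_rip[OF assms] L2norm_cmult by (simp add: power_mult_distrib power_divide norm_divide add_divide_distrib)
qed

text \<open>Midpoints are the convex combinations that occur in the parallelogram law, and the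
  inductive form transfers norm bounds and symmetry from the generators.\<close>

inductive_set midhull :: "(real \<Rightarrow> complex) set \<Rightarrow> (real \<Rightarrow> complex) set" for S where
  base: "f \<in> S \<Longrightarrow> f \<in> midhull S"
| mid: "f \<in> midhull S \<Longrightarrow> g \<in> midhull S \<Longrightarrow> (\<lambda>x. complex_of_real (1/2) * (f x + g x)) \<in> midhull S"

lemma midhull_mono: "f \<in> midhull S \<Longrightarrow> S \<subseteq> T \<Longrightarrow> f \<in> midhull T"
  by (induction rule: midhull.induct) (blast intro: midhull.intros)+

lemma midhull_L2:
  assumes "f \<in> midhull S" "\<And>g. g \<in> S \<Longrightarrow> square_integrable g \<and> L2norm g \<le> B"
  shows "square_integrable f" "L2norm f \<le> B"
proof -
  have "square_integrable f \<and> L2norm f \<le> B" using assms(1)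
  proof induction
    case (mid f g)
    then have "square_integrable (\<lambda>x. complex_of_real (1/2) * (f x + g x))"
      by (intro square_integrable_cmult square_integrable_add) auto
    moreover have "L2norm (\<lambda>x. complex_of_real (1/2) * (f x + g x)) \<le> B"
      unfolding L2norm_cmult using L2norm_triangle[of f g] mid by (simp add: norm_divide)
    ultimately show ?case by simp
  qed (use assms(2) in auto)
  then show "square_integrable f" "L2norm f \<le> B" by auto
qed

text \<open>Weak compactness is replaced by strong convergence of iterated midpoints of tails: by the
  parallelogram law, elements of nearly minimal norm in the hulls of the tails form a Cauchy
  sequence.\<close>

lemma midhull_tails_convergent:
  fixes G :: "nat \<Rightarrow> real \<Rightarrow> complex"
  assumes G: "\<And>n. square_integrable (G n)" and B: "\<And>n. L2norm (G n) \<le> B"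
  shows "\<exists>c C. (\<forall>n. c n \<in> midhull {G m |m. m \<ge> n}) \<and> square_integrable C
    \<and> (\<lambda>n. L2norm (\<lambda>x. c n x - C x)) \<longlonglongrightarrow> 0"
proof -
  let ?S = "\<lambda>n. {G m |m. m \<ge> n}"
  define X where "X n = (\<lambda>f. (L2norm f)\<^sup>2) ` midhull (?S n)" for n
  define d where "d n = Inf (X n)" for n
  have bdd: "bdd_below (X n)" for n unfolding X_def by (rule bdd_belowI[of _ 0]) auto
  have ne: "X n \<noteq> {}" for n unfolding X_def by (auto intro!: midhull.base)
  have hull: "square_integrable f" "L2norm f \<le> B" if "f \<in> midhull (?S n)" for f n
    using midhull_L2[OF that, of B] G B by auto
  have "\<exists>f. f \<in> midhull (?S n) \<and> (L2norm f)\<^sup>2 < d n + 1 / real (Suc n)" for n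
  proof -
    have "\<exists>x\<in>X n. x < d n + 1 / real (Suc n)"
      using cInf_lessD[OF ne[of n], of "d n + 1 / real (Suc n)"] by (simp add: d_def)
    then show ?thesis unfolding X_def by blast
  qed
  then have "\<forall>n. \<exists>f. f \<in> midhull (?S n) \<and> (L2norm f)\<^sup>2 < d n + 1 / real (Suc n)" by (rule allI)
  from choice[OF this]
  obtain c where c': "\<forall>n. c n \<in> midhull (?S n) \<and> (L2norm (c n))\<^sup>2 < d n + 1 / real (Suc n)" ..
  have c: "c n \<in> midhull (?S n)" "(L2norm (c n))\<^sup>2 < d n + 1 / real (Suc n)" for n
    using c'[THEN spec, of n] by (rule conjunct1, rule conjunct2)
  have le: "d n \<le> (L2norm f)\<^sup>2" if "f \<in> midhull (?S n)" for f n
    unfolding d_def X_def using that bdd[of n] by (intro cInf_lower) (auto simp: X_def)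
  have sub: "f \<in> midhull (?S n)" if "f \<in> midhull (?S m)" "n \<le> m" for f m n
    by (rule midhull_mono[OF that(1)]) (use that(2) in auto)
  have mono: "d n \<le> d m" if "n \<le> m" for m n
    unfolding d_def[of m] using ne[of m] that by (intro cInf_greatest) (auto simp: X_def intro: le sub)
  have "d n \<le> B\<^sup>2" for n
  proof -
    have "G n \<in> midhull (?S n)" by (auto intro: midhull.base)
    from le[OF this] show ?thesis using power_mono[OF B[of n], of 2] by simp
  qed
  moreover have "incseq d" using mono by (simp add: incseq_def)
  ultimately obtain D where D: "d \<longlonglongrightarrow> D" using incseq_convergent[of d "B\<^sup>2"] by blast
  have dD: "d n \<le> D" for n using \<open>incseq d\<close> D by (rule incseq_le)
  \<comment> \<open>The midpoint of \<open>c n\<close> and \<open>c m\<close> lies in the hull of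
    the n-th tail, hence its squared norm is at least \<open>d n\<close>, whereas those of
    \<open>c n\<close> and \<open>c m\<close> exceed \<open>d n\<close> and \<open>d m\<close> only
    slightly.\<close>
  have diff: "(L2norm (\<lambda>x. c n x - c m x))\<^sup>2 \<le> 2 * (D - d n) + 4 / real (Suc n)" if "n \<le> m" for n m
  proof -
    have h: "c m \<in> midhull (?S n)" using c(1)[of m] that by (rule sub)
    define z where "z = (L2norm (\<lambda>x. complex_of_real (1/2) * (c n x + c m x)))\<^sup>2"
    have z: "d n \<le> z" unfolding z_def by (rule le[OF midhull.mid[OF c(1)[of n] h]])
    have "(L2norm (\<lambda>x. c n x - c m x))\<^sup>2 = 2 * (L2norm (c n))\<^sup>2 + 2 * (L2norm (c m))\<^sup>2 - 4 * z"
      unfolding z_def by (rule L2norm_parallelogram) (use hull c(1) in blast)+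
    also have "\<dots> \<le> 2 * (d n + 1 / real (Suc n)) + 2 * (d m + 1 / real (Suc m)) - 4 * d n"
      using c(2)[of n] c(2)[of m] z unfolding distrib_left by linarith
    also have "1 / real (Suc m) \<le> 1 / real (Suc n)" using that by (simp add: field_simps)
    also have "d m \<le> D" by (rule dD)
    finally show ?thesis by simp
  qed
  have lim: "(\<lambda>n. 2 * (D - d n) + 4 / real (Suc n)) \<longlonglongrightarrow> 0"
  proof -
    have "(\<lambda>n. 2 * (D - d n) + 4 * (1 / real (Suc n))) \<longlonglongrightarrow> 2 * (D - D) + 4 * 0"
      by (intro tendsto_intros D LIMSEQ_inverse_real_of_nat[unfolded inverse_eq_divide])
    then show ?thesis by simp
  qed
  have "\<exists>N. \<forall>m\<ge>N. \<forall>n\<ge>N. L2norm (\<lambda>x. c m x - c n x) < e" if e: "e > 0" for e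
  proof -
    obtain N where N: "\<And>n. n \<ge> N \<Longrightarrow> 2 * (D - d n) + 4 / real (Suc n) < e\<^sup>2"
      using tendsto_0_ge_less[OF lim, of "e\<^sup>2"] e by auto
    have *: "L2norm (\<lambda>x. c n x - c m x) < e" if "n \<ge> N" "n \<le> m" for n m
    proof -
      have "(L2norm (\<lambda>x. c n x - c m x))\<^sup>2 < e\<^sup>2" using diff[OF that(2)] N[OF that(1)] by linarith
      then show ?thesis using e by (intro power2_less_imp_less[of _ e]) auto
    qed
    have "L2norm (\<lambda>x. c m x - c n x) < e" if "m \<ge> N" "n \<ge> N" for m n
    proof (cases "m \<le> n")
      case False
      then have "L2norm (\<lambda>x. c n x - c m x) < e" using *[of n m] that by simp
      then show ?thesis by (simp only: L2norm_minus_commute[of "c m"])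
    qed (use * that in auto)
    then show ?thesis by blast
  qed
  note Cauchy = this
  obtain C where C: "square_integrable C" "(\<lambda>n. L2norm (\<lambda>x. c n x - C x)) \<longlonglongrightarrow> 0"
    by (rule L2norm_complete[of c, OF hull(1)[OF c(1)] Cauchy])
  show ?thesis by (intro exI[of _ c] exI[of _ C] conjI allI c(1) C)
qed

lemma rip_tendsto:
  assumes "\<And>n. square_integrable (c n)" "square_integrable C" "square_integrable E"
    and "(\<lambda>n::nat. L2norm (\<lambda>x. c n x - C x)) \<longlonglongrightarrow> 0"
  shows "(\<lambda>n. rip (c n) E) \<longlonglongrightarrow> rip C E"
proof (rule LIM_zero_cancel, rule Lim_null_comparison)
  show "(\<lambda>n. L2norm (\<lambda>x. c n x - C x) * L2norm E) \<longlonglongrightarrow> 0"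
    using tendsto_mult[OF assms(4) tendsto_const, of "L2norm E"] by simp
  show "\<forall>\<^sub>F n in sequentially. norm (rip (c n) E - rip C E) \<le> L2norm (\<lambda>x. c n x - C x) * L2norm E"
    using rip_bound[OF square_integrable_diff[OF assms(1,2)] assms(3)]
    by (simp add: rip_diff_left assms)
qed

text \<open>The functions whose pairing with \<open>E\<close> is within e of \<open>l\<close> are
  stable under midpoints. If the set contains a tail of the sequence, it contains the hull of that
  tail.\<close>

lemma midhull_tails_rip:
  fixes G :: "nat \<Rightarrow> real \<Rightarrow> complex"
  assumes G: "\<And>n. square_integrable (G n)" and E: "square_integrable E"
    and c: "\<And>n. c n \<in> midhull {G m |m. m \<ge> n}" and lim: "(\<lambda>n. rip (G n) E) \<longlonglongrightarrow> l"
  shows "(\<lambda>n. rip (c n) E) \<longlonglongrightarrow> l"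
proof (rule LIMSEQ_I)
  fix e :: real assume e: "e > 0"
  then obtain N where N: "\<And>n. n \<ge> N \<Longrightarrow> norm (rip (G n) E - l) < e"
    using LIMSEQ_D[OF lim] by blast
  have "norm (rip f E - l) < e" if "f \<in> midhull {G m |m. m \<ge> N}" for f
  proof -
    have "square_integrable f \<and> norm (rip f E - l) < e" using that
    proof induction
      case (mid f g)
      then have "rip (\<lambda>x. complex_of_real (1/2) * (f x + g x)) E - l = ((rip f E - l) + (rip g E - l)) / 2"
        unfolding rip_cmult_left using E by (simp add: rip_add_left)
      moreover have "\<bar>rip f E - l\<bar> < e" "\<bar>rip g E - l\<bar> < e" using mid.IH by auto
      ultimately have "norm (rip (\<lambda>x. complex_of_real (1/2) * (f x + g x)) E - l) < e"
        unfolding real_norm_def by (simp only:) (simp add: abs_less_iff field_simps)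
      moreover have "square_integrable (\<lambda>x. complex_of_real (1/2) * (f x + g x))"
        using mid by (intro square_integrable_cmult square_integrable_add) auto
      ultimately show ?case by blast
    qed (use G N in auto)
    then show ?thesis by simp
  qed
  moreover have "c n \<in> midhull {G m |m. m \<ge> N}" if "n \<ge> N" for n
    using c[of n] by (rule midhull_mono) (use that in auto)
  ultimately show "\<exists>no. \<forall>n\<ge>no. norm (rip (c n) E - l) < e" by blast
qed

lemma diagonal_subsequence:
  fixes a :: "nat \<Rightarrow> nat \<Rightarrow> real"
  assumes "\<And>i m. \<bar>a i m\<bar> \<le> B i"
  shows "\<exists>r :: nat \<Rightarrow> nat. strict_mono r \<and> (\<forall>i. convergent (\<lambda>m. a i (r m)))"
proof -
  interpret nat: subseqs "\<lambda>i s. convergent (\<lambda>m. a i (s m))"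
  proof
    fix i :: nat and s :: "nat \<Rightarrow> nat" assume s: "strict_mono s"
    have "bounded (range (\<lambda>m. a i (s m)))"
      using assms by (auto intro!: boundedI[of _ "B i"])
    from bounded_imp_convergent_subsequence[OF this]
    obtain l r where "strict_mono r" "((\<lambda>m. a i (s m)) \<circ> r) \<longlonglongrightarrow> l" by auto
    then show "\<exists>r. strict_mono r \<and> convergent (\<lambda>m. a i ((s \<circ> r) m))"
      by (auto simp: convergent_def o_def)
  qed
  have "convergent (\<lambda>m. a i ((nat.diagseq \<circ> (+) (Suc i)) m))" for i
  proof (rule nat.diagseq_holds)
    fix r s :: "nat \<Rightarrow> nat" and n assume "strict_mono r" "convergent (\<lambda>m. a n (s m))"
    then show "convergent (\<lambda>m. a n ((s \<circ> r) m))"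
      using convergent_subseq_convergent[of "\<lambda>m. a n (s m)" r] by (simp add: o_def)
  qed
  \<comment> \<open>Only a tail of the diagonal sequence is known to refine the i-th stage; the
    shift does not affect convergence.\<close>
  moreover have "(\<lambda>m. a i ((nat.diagseq \<circ> (+) (Suc i)) m)) = (\<lambda>m. a i (nat.diagseq (m + Suc i)))" for i
    by (simp add: o_def add.commute)
  ultimately have "convergent (\<lambda>m. a i (nat.diagseq m))" for i
    using convergent_ignore_initial_segment[of "\<lambda>m. a i (nat.diagseq m)" "Suc i"] by simp
  with nat.subseq_diagseq show ?thesis by (intro exI[of _ nat.diagseq] conjI allI)
qed

text \<open>Weak convergence along countably many tests. The \<open>G i\<close> join the tests
  \<open>E i\<close> because \<open>C\<close> is a strong limit of their midpoints; thereby the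
  pairing with \<open>C\<close> itself converges, which later splits the norms. The approximants
  \<open>c\<close> are returned so that properties stable under midpoints and norm limits pass to
  \<open>C\<close>.\<close>

lemma L2_weak_subsequence:
  fixes G E :: "nat \<Rightarrow> real \<Rightarrow> complex"
  assumes G: "\<And>n. square_integrable (G n)" and B: "\<And>n. L2norm (G n) \<le> B" and E: "\<And>i. square_integrable (E i)"
  shows "\<exists>(r :: nat \<Rightarrow> nat) c C. strict_mono r \<and> square_integrable C
    \<and> (\<forall>i. (\<lambda>n. rip (G (r n)) (E i)) \<longlonglongrightarrow> rip C (E i)) \<and> (\<lambda>n. rip (G (r n)) C) \<longlonglongrightarrow> (L2norm C)\<^sup>2
    \<and> (\<forall>n. c n \<in> midhull (range G)) \<and> (\<lambda>n. L2norm (\<lambda>x. c n x - C x)) \<longlonglongrightarrow> 0"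
proof -
  have B0: "0 \<le> B" using B[of 0] L2norm_nonneg[of "G 0"] by linarith
  \<comment> \<open>Even indices carry the tests \<open>E\<close>, odd ones the \<open>G\<close>, so
    that one diagonal extraction serves both families.\<close>
  define a where "a i m = (if even i then rip (G m) (E (i div 2)) else rip (G m) (G (i div 2)))" for i m
  define A where "A i = (if even i then B * L2norm (E (i div 2)) else B * L2norm (G (i div 2)))" for i
  have aA: "\<bar>a i m\<bar> \<le> A i" for i m
  proof (cases "even i")
    case True
    have "\<bar>rip (G m) (E (i div 2))\<bar> \<le> L2norm (G m) * L2norm (E (i div 2))" by (intro rip_bound G E)
    also have "\<dots> \<le> B * L2norm (E (i div 2))" by (intro mult_right_mono B) simp
    finally show ?thesis using True by (simp add: a_def A_def)
  next
    case False
    have "\<bar>rip (G m) (G (i div 2))\<bar> \<le> L2norm (G m) * L2norm (G (i div 2))" by (intro rip_bound G)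
    also have "\<dots> \<le> B * L2norm (G (i div 2))" by (intro mult_right_mono B) simp
    finally show ?thesis using False by (simp add: a_def A_def)
  qed
  from diagonal_subsequence[where a=a and B=A, OF aA]
  obtain r where r: "strict_mono (r :: nat \<Rightarrow> nat)" and conv': "\<forall>i. convergent (\<lambda>m. a i (r m))"
    by (elim exE conjE)
  note conv = conv'[rule_format]
  have convE: "convergent (\<lambda>m. rip (G (r m)) (E i))" for i using conv[of "2 * i"] by (simp add: a_def)
  have convG: "convergent (\<lambda>m. rip (G (r m)) (G i))" for i using conv[of "2 * i + 1"] by (simp add: a_def)
  define H where "H n = G (r n)" for n
  have H: "\<And>n. square_integrable (H n)" "\<And>n. L2norm (H n) \<le> B" using G B by (auto simp: H_def)
  from midhull_tails_convergent[where G=H, OF H]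
  obtain c C where c': "\<forall>n. c n \<in> midhull {H m |m. m \<ge> n}" and C: "square_integrable C"
    and cC: "(\<lambda>n. L2norm (\<lambda>x. c n x - C x)) \<longlonglongrightarrow> 0"
    by (elim exE conjE)
  note c = c'[rule_format]
  have cG: "c n \<in> midhull (range G)" for n using c[of n] by (rule midhull_mono) (auto simp: H_def)
  have sc: "square_integrable (c n)" for n using midhull_L2(1)[OF cG[of n], of B] G B by auto
  have key: "(\<lambda>m. rip (H m) F) \<longlonglongrightarrow> rip C F" if F: "square_integrable F" and cv: "convergent (\<lambda>m. rip (H m) F)" for F
  proof -
    obtain l where l: "(\<lambda>m. rip (H m) F) \<longlonglongrightarrow> l" using cv by (auto simp: convergent_def)
    have "(\<lambda>n. rip (c n) F) \<longlonglongrightarrow> l" by (rule midhull_tails_rip[OF H(1) F c l])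
    moreover have "(\<lambda>n. rip (c n) F) \<longlonglongrightarrow> rip C F" by (rule rip_tendsto[OF sc C F cC])
    ultimately have "l = rip C F" by (rule LIMSEQ_unique)
    with l show ?thesis by simp
  qed
  have convc: "square_integrable f \<and> convergent (\<lambda>m. rip (H m) f)" if "f \<in> midhull (range G)" for f
    using that
  proof induction
    case (mid f g)
    have eq: "rip (H m) (\<lambda>x. complex_of_real (1/2) * (f x + g x)) = 1/2 * (rip (H m) f + rip (H m) g)" for m
      using mid H(1)[of m] by (simp add: rip_commute[of "H m"] rip_cmult_left rip_add_left del: of_real_divide)
    have "convergent (\<lambda>m. rip (H m) (\<lambda>x. complex_of_real (1/2) * (f x + g x)))"
      unfolding eq using mid.IH by (intro convergent_mult convergent_const convergent_add) auto
    moreover have "square_integrable (\<lambda>x. complex_of_real (1/2) * (f x + g x))"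
      using mid by (intro square_integrable_cmult square_integrable_add) auto
    ultimately show ?case by blast
  qed (use G convG in \<open>auto simp: H_def\<close>)
  \<comment> \<open>\<open>C\<close> is replaced by some \<open>c n\<close>, for which convergence
    is known; the error is uniform in \<open>m\<close> because the \<open>H m\<close> are
    bounded.\<close>
  have "Cauchy (\<lambda>m. rip (H m) C)"
  proof (rule CauchyI)
    fix e :: real assume e: "e > 0"
    have "(\<lambda>n. B * L2norm (\<lambda>x. c n x - C x)) \<longlonglongrightarrow> 0" using tendsto_mult[OF tendsto_const cC, of B] by simp
    from tendsto_0_ge_less[OF this, of "e / 3"] e obtain n where n: "B * L2norm (\<lambda>x. c n x - C x) < e / 3" by auto
    have close: "\<bar>rip (H m) (c n) - rip (H m) C\<bar> < e / 3" for m
    proof -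
      have "\<bar>rip (H m) (c n) - rip (H m) C\<bar> = \<bar>rip (H m) (\<lambda>x. c n x - C x)\<bar>"
        using rip_diff_right[OF sc C H(1)] by simp
      also have "\<dots> \<le> L2norm (H m) * L2norm (\<lambda>x. c n x - C x)" by (intro rip_bound H square_integrable_diff sc C)
      also have "\<dots> \<le> B * L2norm (\<lambda>x. c n x - C x)" by (intro mult_right_mono H) simp
      finally show ?thesis using n by linarith
    qed
    have "Cauchy (\<lambda>m. rip (H m) (c n))" using convc[OF cG[of n]] by (simp add: Cauchy_convergent_iff)
    from CauchyD[OF this, of "e / 3"] e
    obtain M where M: "\<And>m m'. m \<ge> M \<Longrightarrow> m' \<ge> M \<Longrightarrow> norm (rip (H m) (c n) - rip (H m') (c n)) < e / 3"
      by auto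
    have "norm (rip (H m) C - rip (H m') C) < e" if "m \<ge> M" "m' \<ge> M" for m m'
      using close[of m] close[of m'] M[OF that] unfolding real_norm_def by linarith
    then show "\<exists>M. \<forall>m\<ge>M. \<forall>n\<ge>M. norm (rip (H m) C - rip (H n) C) < e" by blast
  qed
  then have "(\<lambda>m. rip (H m) C) \<longlonglongrightarrow> rip C C"
    by (intro key[OF C]) (simp only: Cauchy_convergent_iff)
  then have CC: "(\<lambda>m. rip (G (r m)) C) \<longlonglongrightarrow> (L2norm C)\<^sup>2"
    by (simp only: rip_self H_def)
  have CE: "(\<lambda>m. rip (G (r m)) (E i)) \<longlonglongrightarrow> rip C (E i)" for i
    using key[OF E, of i] convE[of i] by (simp only: H_def)
  show ?thesis
    by (intro exI[of _ r] exI[of _ c] exI[of _ C] conjI allI r C CE CC cG cC)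
qed

section \<open>The form domain\<close>

definition hermitian :: "(real \<Rightarrow> complex) \<Rightarrow> bool" where
  "hermitian g \<longleftrightarrow> (AE k in lborel. g (- k) = cnj (g k))"

lemma hermitian_add:
  assumes "hermitian f" "hermitian g"
  shows "hermitian (\<lambda>k. f k + g k)"
  using assms unfolding hermitian_def by eventually_elim simp

lemma hermitian_diff:
  assumes "hermitian f" "hermitian g"
  shows "hermitian (\<lambda>k. f k - g k)"
  using assms unfolding hermitian_def by eventually_elim simp

lemma hermitian_mult_even:
  assumes "hermitian g" "\<And>k. a (- k) = a k"
  shows "hermitian (\<lambda>k. complex_of_real (a k) * g k)"
  using assms(1) unfolding hermitian_def by eventually_elim (simp add: assms(2))

lemma hermitian_modulate:
  assumes "hermitian g"
  shows "hermitian (\<lambda>k. exp (\<i> * of_real k * of_real y) * g k)"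
  using assms unfolding hermitian_def by eventually_elim (simp add: exp_cnj)

lemma hermitian_midhull:
  assumes "f \<in> midhull S" "\<And>g. g \<in> S \<Longrightarrow> hermitian g"
  shows "hermitian f"
  using assms(1)
  by induction (auto intro: assms(2) hermitian_mult_even[where a="\<lambda>_. 1/2"] hermitian_add simp del: of_real_divide)

lemma hermitian_L2_limit:
  assumes c: "\<And>n. square_integrable (c n)" "\<And>n. hermitian (c n)" and C: "square_integrable C"
    and lim: "(\<lambda>n::nat. L2norm (\<lambda>x. c n x - C x)) \<longlonglongrightarrow> 0"
  shows "hermitian C"
proof -
  have s: "square_integrable (\<lambda>k. C (- k))" "square_integrable (\<lambda>k. cnj (C k))"
    by (intro square_integrable_reflect square_integrable_cnj C)+
  have sc: "square_integrable (\<lambda>k. c n (- k))" for n by (intro square_integrable_reflect c)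
  have "L2norm (\<lambda>k. C (- k) - cnj (C k)) \<le> 0"
  proof (rule LIMSEQ_le[OF tendsto_const])
    show "(\<lambda>n. L2norm (\<lambda>x. c n x - C x) + L2norm (\<lambda>x. c n x - C x)) \<longlonglongrightarrow> 0"
      using tendsto_add[OF lim lim] by simp
    have "L2norm (\<lambda>k. C (- k) - cnj (C k)) \<le> L2norm (\<lambda>x. c n x - C x) + L2norm (\<lambda>x. c n x - C x)" for n
    proof -
      have "L2norm (\<lambda>k. C (- k) - cnj (C k)) \<le> L2norm (\<lambda>k. C (- k) - c n (- k)) + L2norm (\<lambda>k. c n (- k) - cnj (C k))"
        by (rule L2norm_triangle3[OF s(1) sc s(2)])
      also have "L2norm (\<lambda>k. C (- k) - c n (- k)) = L2norm (\<lambda>x. c n x - C x)"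
        using L2norm_reflect[of "\<lambda>k. C k - c n k"] by (simp add: L2norm_minus_commute[of C])
      also have "L2norm (\<lambda>k. c n (- k) - cnj (C k)) = L2norm (\<lambda>k. cnj (c n k - C k))"
      proof (rule L2norm_cong_AE)
        show "AE k in lborel. c n (- k) - cnj (C k) = cnj (c n k - C k)"
          using c(2)[of n] unfolding hermitian_def by eventually_elim simp
      qed (intro square_integrableD square_integrable_diff sc s square_integrable_cnj c C)+
      finally show ?thesis by (simp only: L2norm_cnj)
    qed
    then show "\<exists>N. \<forall>n\<ge>N. L2norm (\<lambda>k. C (- k) - cnj (C k)) \<le> L2norm (\<lambda>x. c n x - C x) + L2norm (\<lambda>x. c n x - C x)"
      by simp
  qed
  then have "L2norm (\<lambda>k. C (- k) - cnj (C k)) = 0" using L2norm_nonneg[of "\<lambda>k. C (- k) - cnj (C k)"] by linarith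
  from L2norm_eq_0[OF square_integrable_diff[OF s] this] show ?thesis unfolding hermitian_def by eventually_elim simp
qed

text \<open>The moduli rule out a direct appeal to weak convergence. Restricting \<open>b\<close> to
  a bounded interval gives the integrable majorant B \<bar>b\<bar> for dominated convergence, and
  Cauchy-Schwarz controls the rest uniformly in \<open>n\<close>.\<close>

lemma integral_mult_tendsto_0:
  fixes a :: "nat \<Rightarrow> real \<Rightarrow> real" and b :: "real \<Rightarrow> real"
  assumes a: "\<And>n. square_integrable (a n)" "\<And>n. L2norm (a n) \<le> R" "\<And>n x. \<bar>a n x\<bar> \<le> B"
    and lim: "\<And>x. (\<lambda>n. a n x) \<longlonglongrightarrow> 0" and b: "square_integrable b"
  shows "(\<lambda>n. LINT x|lborel. \<bar>a n x\<bar> * \<bar>b x\<bar>) \<longlonglongrightarrow> 0"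
proof (rule LIMSEQ_I)
  fix e :: real assume e: "e > 0"
  let ?b = "\<lambda>x. complex_of_real (b x)"
  have sb: "square_integrable ?b" using b by (simp add: square_integrable_of_real_iff)
  have R: "0 \<le> R" using a(2)[of 0] L2norm_nonneg[of "a 0"] by linarith
  have "(\<lambda>n. R * L2norm (\<lambda>x. ?b x - cutoff (real n) ?b x)) \<longlonglongrightarrow> 0"
    using tendsto_mult[OF tendsto_const cutoff_tendsto_nat[OF sb], of R] by simp
  from tendsto_0_ge_less[OF this, of "e / 2"] e
  obtain N where N: "R * L2norm (\<lambda>x. ?b x - cutoff (real N) ?b x) < e / 2" by auto
  let ?c = "cutoff (real N) ?b"
  have [measurable]: "a n \<in> borel_measurable borel" for n using square_integrableD[OF a(1)] by simp
  have [measurable]: "?c \<in> borel_measurable borel" using square_integrableD[OF cutoff_L2[OF sb]] by simp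
  have i1: "integrable lborel (\<lambda>x. \<bar>a n x\<bar> * cmod (?c x))" for n
    using integrable_norm_mult[OF a(1) cutoff_L2[OF sb], of n] by simp
  have i2: "integrable lborel (\<lambda>x. \<bar>a n x\<bar> * cmod (?b x - ?c x))" for n
    using integrable_norm_mult[OF a(1) square_integrable_diff[OF sb cutoff_L2[OF sb]], of n] by simp
  have i3: "integrable lborel (\<lambda>x. \<bar>a n x\<bar> * \<bar>b x\<bar>)" for n
    using integrable_norm_mult[OF a(1) b, of n] by simp
  have "(\<lambda>n. LINT x|lborel. \<bar>a n x\<bar> * cmod (?c x)) \<longlonglongrightarrow> (LINT x|(lborel::real measure). (0::real))"
  proof (rule integral_dominated_convergence)
    show "integrable lborel (\<lambda>x. B * cmod (?c x))" using cutoff_L1[OF sb] by simp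
    show "AE x in lborel. (\<lambda>n. \<bar>a n x\<bar> * cmod (?c x)) \<longlonglongrightarrow> 0"
    proof (rule AE_I2)
      fix x show "(\<lambda>n. \<bar>a n x\<bar> * cmod (?c x)) \<longlonglongrightarrow> 0"
        using tendsto_mult[OF tendsto_rabs[OF lim[of x]] tendsto_const] by simp
    qed
    show "AE x in lborel. norm (\<bar>a n x\<bar> * cmod (?c x)) \<le> B * cmod (?c x)" for n
      using a(3) by (auto intro!: AE_I2 mult_right_mono)
  qed measurable
  then have "(\<lambda>n. LINT x|lborel. \<bar>a n x\<bar> * cmod (?c x)) \<longlonglongrightarrow> 0" by simp
  from tendsto_0_ge_less[OF this, of "e / 2"] e
  obtain M where M: "\<And>n. n \<ge> M \<Longrightarrow> (LINT x|lborel. \<bar>a n x\<bar> * cmod (?c x)) < e / 2" by auto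
  have "(LINT x|lborel. \<bar>a n x\<bar> * \<bar>b x\<bar>) < e" if "n \<ge> M" for n
  proof -
    have "(LINT x|lborel. \<bar>a n x\<bar> * \<bar>b x\<bar>) \<le> (LINT x|lborel. \<bar>a n x\<bar> * cmod (?b x - ?c x) + \<bar>a n x\<bar> * cmod (?c x))"
    proof (rule integral_mono[OF i3])
      show "integrable lborel (\<lambda>x. \<bar>a n x\<bar> * cmod (?b x - ?c x) + \<bar>a n x\<bar> * cmod (?c x))" using i1 i2 by simp
      fix x
      have "\<bar>b x\<bar> \<le> cmod (?b x - ?c x) + cmod (?c x)" using norm_triangle_sub[of "?b x" "?c x"] by simp
      from mult_left_mono[OF this, of "\<bar>a n x\<bar>"]
      show "\<bar>a n x\<bar> * \<bar>b x\<bar> \<le> \<bar>a n x\<bar> * cmod (?b x - ?c x) + \<bar>a n x\<bar> * cmod (?c x)" by (simp add: distrib_left)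
    qed
    also have "\<dots> = (LINT x|lborel. \<bar>a n x\<bar> * cmod (?b x - ?c x)) + (LINT x|lborel. \<bar>a n x\<bar> * cmod (?c x))"
      using i1 i2 by simp
    also have "(LINT x|lborel. \<bar>a n x\<bar> * cmod (?b x - ?c x)) \<le> L2norm (a n) * L2norm (\<lambda>x. ?b x - ?c x)"
      using L2_Cauchy_Schwarz[OF a(1) square_integrable_diff[OF sb cutoff_L2[OF sb]], of n] by simp
    also have "\<dots> \<le> R * L2norm (\<lambda>x. ?b x - ?c x)" by (intro mult_right_mono a) simp
    finally show ?thesis using N M[OF that] by linarith
  qed
  then show "\<exists>no. \<forall>n\<ge>no. norm ((LINT x|lborel. \<bar>a n x\<bar> * \<bar>b x\<bar>) - 0) < e" by (intro exI[of _ M]) auto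
qed

text \<open>Each condition on \<open>q\<close> has one task: evenness keeps functions real, the
  positive lower bound embeds the form domain into \<open>L^2\<close>, and square integrability of 1
  / sqrt q embeds it into the bounded functions.\<close>

locale weight =
  fixes q :: "real \<Rightarrow> real" and q0 :: real
  assumes qm [measurable]: "q \<in> borel_measurable borel" and q_even: "q (- k) = q k"
    and q0: "q0 > 0" and q_ge: "q0 \<le> q k" and inv_sqrt_q: "square_integrable (\<lambda>k. 1 / sqrt (q k))"
begin

lemma q_pos: "q k > 0" using q0 q_ge[of k] by linarith

text \<open>With \<open>G\<close> equal to \<open>sqrt q\<close> times the Fourier transform of \<open>u\<close>, the quadratic functional with
  symbol \<open>q\<close> is the squared \<open>L\<^sup>2\<close> norm of \<open>G\<close>, up to the factor \<open>2 \<pi>\<close>, and \<open>u = T G\<close>. The transform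
  \<open>dv G\<close> is integrable, so that \<open>T G\<close> is defined pointwise; the point evaluation at \<open>x\<close> is the
  inner product with \<open>evk x\<close>.\<close>

definition dv :: "(real \<Rightarrow> complex) \<Rightarrow> real \<Rightarrow> complex" where
  "dv G k = complex_of_real (1 / sqrt (q k)) * G k"

definition T :: "(real \<Rightarrow> complex) \<Rightarrow> real \<Rightarrow> real" where
  "T G x = Re (ft (dv G) (- x)) / (2 * pi)"

definition evk :: "real \<Rightarrow> real \<Rightarrow> complex" where
  "evk x k = complex_of_real (1 / (2 * pi) * (1 / sqrt (q k))) * exp (- (\<i> * of_real k * of_real x))"

text \<open>The common norm of all point evaluations, hence the constant of the embedding into the
  bounded functions.\<close>

definition C1 :: real where "C1 = L2norm (\<lambda>k. 1 / sqrt (q k)) / (2 * pi)"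

lemma C1_nonneg: "0 \<le> C1" by (simp add: C1_def)

lemma cmod_dv: "cmod (dv G k) = cmod (G k) / sqrt (q k)"
  using q_pos[of k] by (simp add: dv_def norm_mult norm_divide)

lemma cmod_dv_le: "cmod (dv G k) \<le> 1 / sqrt q0 * cmod (G k)"
  unfolding cmod_dv using q0 q_ge[of k] by (simp add: frac_le)

lemma dv_measurable: "G \<in> borel_measurable lborel \<Longrightarrow> dv G \<in> borel_measurable lborel"
  unfolding dv_def[abs_def] by simp

lemma dv_L2:
  assumes G: "square_integrable G"
  shows "square_integrable (dv G)" "L2norm (dv G) \<le> L2norm G / sqrt q0"
proof -
  have m: "dv G \<in> borel_measurable lborel" by (rule dv_measurable[OF square_integrableD[OF G]])
  show "square_integrable (dv G)"
    by (rule square_integrable_bound[OF G m, where c="1 / sqrt q0"]) (use cmod_dv_le in auto)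
  have "L2norm (dv G) \<le> L2norm (\<lambda>k. complex_of_real (1 / sqrt q0) * G k)"
    using cmod_dv_le q0 by (intro L2norm_mono square_integrable_cmult G m) (auto simp: norm_mult norm_divide)
  also have "\<dots> = L2norm G / sqrt q0" unfolding L2norm_cmult using q0 by (simp add: norm_divide)
  finally show "L2norm (dv G) \<le> L2norm G / sqrt q0" .
qed

lemma dv_L1:
  assumes G: "square_integrable G"
  shows "integrable lborel (dv G)"
proof (rule Bochner_Integration.integrable_bound[OF integrable_norm_mult[OF inv_sqrt_q G]])
  show "dv G \<in> borel_measurable lborel" by (rule dv_measurable[OF square_integrableD[OF G]])
qed (use q_pos in \<open>auto simp: cmod_dv less_imp_le abs_mult\<close>)

lemma evk_L2: "square_integrable (evk x)" "L2norm (evk x) = C1"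
proof -
  have n: "cmod (evk x k) = 1 / (2 * pi) * (1 / sqrt (q k))" for x k
    using q_pos[of k] by (simp add: evk_def norm_mult norm_divide)
  have "evk x \<in> borel_measurable lborel" unfolding evk_def[abs_def]
    by (intro borel_measurable_times borel_measurable_of_real) (auto intro!: borel_measurable_continuous_onI continuous_intros)
  then show "square_integrable (evk x)"
    by (rule square_integrable_bound[OF inv_sqrt_q, where c="1 / (2 * pi)"]) (use q_pos in \<open>auto simp: n less_imp_le\<close>)
  have "L2norm (evk x) = L2norm (\<lambda>k. (1 / (2 * pi)) *\<^sub>R (1 / sqrt (q k)))"
    using q_pos by (intro L2norm_cong_norm) (simp add: n less_imp_le)
  then show "L2norm (evk x) = C1" unfolding L2norm_scaleR C1_def by simp
qed

lemma T_eq_rip: "T G x = rip G (evk x)"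
proof -
  have "G k * cnj (evk x k) = complex_of_real (1 / (2 * pi)) * (exp (- (\<i> * of_real (- x) * of_real k)) * dv G k)" for k
    by (simp add: evk_def dv_def exp_cnj mult_ac)
  then have "(LINT k|lborel. G k * cnj (evk x k)) = complex_of_real (1 / (2 * pi)) * ft (dv G) (- x)"
    unfolding ft_def by (simp only: integral_mult_right_zero)
  then show ?thesis unfolding rip_def T_def by simp
qed

lemma T_bound: "square_integrable G \<Longrightarrow> \<bar>T G x\<bar> \<le> C1 * L2norm G"
  unfolding T_eq_rip using rip_bound[OF _ evk_L2(1), of G x] by (simp add: evk_L2(2) mult.commute)

lemma T_measurable: "square_integrable G \<Longrightarrow> T G \<in> borel_measurable borel"
proof -
  assume G: "square_integrable G"
  have [measurable]: "dv G \<in> borel_measurable borel" using dv_measurable[OF square_integrableD[OF G]] by simp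
  show ?thesis unfolding T_def[abs_def] by measurable
qed

lemma T_L2:
  assumes G: "square_integrable G"
  shows "square_integrable (T G)" "L2norm (T G) \<le> L2norm (dv G) / sqrt (2 * pi)"
proof -
  note P = Plancherel_L1_L2[OF dv_L1[OF G] dv_L2(1)[OF G]]
  have s: "square_integrable (\<lambda>x. ft (dv G) (- x))" by (rule square_integrable_reflect[OF P(1)])
  have le: "\<bar>T G x\<bar> \<le> 1 / (2 * pi) * cmod (ft (dv G) (- x))" for x
    unfolding T_def using abs_Re_le_cmod[of "ft (dv G) (- x)"] by (simp add: divide_right_mono)
  have m: "T G \<in> borel_measurable lborel" using T_measurable[OF G] by simp
  show "square_integrable (T G)"
    by (rule square_integrable_bound[OF s m, where c="1 / (2 * pi)"]) (use le in auto)
  have "L2norm (T G) \<le> L2norm (\<lambda>x. complex_of_real (1 / (2 * pi)) * ft (dv G) (- x))"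
    using le by (intro L2norm_mono square_integrable_cmult s m) (auto simp: norm_mult norm_divide)
  also have "\<dots> = 1 / (2 * pi) * (sqrt (2 * pi) * L2norm (dv G))"
    unfolding L2norm_cmult L2norm_reflect P(2) by (simp add: norm_divide)
  also have "\<dots> = L2norm (dv G) / sqrt (2 * pi)"
    using real_div_sqrt[of "2 * pi"] by (simp add: field_simps)
  finally show "L2norm (T G) \<le> L2norm (dv G) / sqrt (2 * pi)" .
qed

text \<open>The constant of the embedding into \<open>L^2\<close>.\<close>

definition C2 :: real where "C2 = 1 / sqrt q0 / sqrt (2 * pi)"

lemma C2_nonneg: "0 \<le> C2" using q0 by (simp add: C2_def)

lemma T_L2norm_le: "square_integrable G \<Longrightarrow> L2norm (T G) \<le> C2 * L2norm G"
  using order_trans[OF T_L2(2) divide_right_mono[OF dv_L2(2)]] by (simp add: C2_def)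

lemma T_add:
  "square_integrable G \<Longrightarrow> square_integrable H \<Longrightarrow> T (\<lambda>k. G k + H k) x = T G x + T H x"
  unfolding T_eq_rip by (intro rip_add_left evk_L2)

lemma T_diff:
  "square_integrable G \<Longrightarrow> square_integrable H \<Longrightarrow> T (\<lambda>k. G k - H k) x = T G x - T H x"
  unfolding T_eq_rip by (intro rip_diff_left evk_L2)

lemma T_scale: "T (\<lambda>k. complex_of_real c * G k) x = c * T G x"
  unfolding T_eq_rip by (rule rip_cmult_left)

lemma T_shift: "T (\<lambda>k. exp (\<i> * of_real k * of_real y) * G k) x = T G (x + y)"
proof -
  have "exp (- (\<i> * of_real (- x) * of_real k)) * dv (\<lambda>k. exp (\<i> * of_real k * of_real y) * G k) k
     = exp (- (\<i> * of_real (- (x + y)) * of_real k)) * dv G k" for k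
  proof -
    have "exp (- (\<i> * of_real (- x) * of_real k)) * exp (\<i> * of_real k * of_real y)
      = exp (- (\<i> * complex_of_real (- (x + y)) * complex_of_real k))"
      by (simp add: exp_add[symmetric] algebra_simps)
    then show ?thesis by (simp add: dv_def mult_ac)
  qed
  then show ?thesis unfolding T_def ft_def by simp
qed

text \<open>For hermitian \<open>G\<close> the inverse transform is already real, so the real part
  in \<open>T\<close> loses nothing. It agrees almost everywhere with the preimage from
  \<open>is_fourier_inverse\<close>, as the integral and the \<open>L^2\<close> limit define the
  same transform.\<close>

lemma T_fourier:
  assumes G: "square_integrable G" and h: "hermitian G"
  shows "is_fourier (\<lambda>x. complex_of_real (T G x)) (dv G)"
proof -
  let ?g = "dv G"
  note g1 = dv_L1[OF G] and g2 = dv_L2(1)[OF G]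
  have hg: "hermitian ?g" unfolding dv_def[abs_def] by (rule hermitian_mult_even[OF h]) (simp add: q_even)
  have [measurable]: "?g \<in> borel_measurable borel" using square_integrableD[OF g2] by simp
  have "cnj (ft ?g (- x)) = ft ?g (- x)" for x
  proof -
    have "cnj (ft ?g (- x)) = ft (\<lambda>k. cnj (?g k)) x" using ft_cnj[of ?g x] by simp
    also have "\<dots> = ft (\<lambda>k. ?g (- k)) x"
      unfolding ft_def
      by (intro integral_cong_AE, measurable, use hg[unfolded hermitian_def] in eventually_elim, simp)
    also have "\<dots> = ft ?g (- x)"
      unfolding ft_def by (subst integral_reflect_lborel[symmetric]) simp
    finally show ?thesis .
  qed
  then have re: "complex_of_real (T G x) = complex_of_real (1 / (2 * pi)) * ft ?g (- x)" for x
  proof -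
    have "complex_of_real (Re (ft ?g (- x))) = ft ?g (- x)"
      by (rule of_real_Re) (use \<open>\<And>x. cnj (ft ?g (- x)) = ft ?g (- x)\<close> in \<open>simp add: Reals_cnj_iff\<close>)
    then show ?thesis unfolding T_def by simp
  qed
  note F = is_fourier_fourier[OF g2]
  have sF: "square_integrable (fourier ?g)" by (rule is_fourier_L2[OF F])
  note P = Plancherel_L1_L2(1)[OF g1 g2]
  have d: "AE x in lborel. fourier ?g x = ft ?g x" by (rule is_fourier_unique[OF g2 F is_fourier_ft[OF g1 g2]])
  have "L2norm (\<lambda>x. fourier ?g (- x) - ft ?g (- x)) = L2norm (\<lambda>x. fourier ?g x - ft ?g x)"
    by (rule L2norm_reflect[of "\<lambda>x. fourier ?g x - ft ?g x"])
  also have "\<dots> = L2norm (\<lambda>x::real. 0 :: complex)"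
  proof (rule L2norm_cong_AE)
    show "AE x in lborel. fourier ?g x - ft ?g x = 0" using d by eventually_elim simp
  qed (use square_integrableD[OF sF] square_integrableD[OF P] in measurable)
  also have "\<dots> = 0" unfolding L2norm_def by simp
  finally have z: "L2norm (\<lambda>x. fourier ?g (- x) - ft ?g (- x)) = 0" .
  have "AE x in lborel. fourier ?g (- x) - ft ?g (- x) = 0"
    by (rule L2norm_eq_0[OF _ z]) (intro square_integrable_diff square_integrable_reflect sF P)
  then have eq: "AE x in lborel. complex_of_real (1 / (2 * pi)) * fourier ?g (- x) = complex_of_real (T G x)"
    by eventually_elim (simp add: re)
  have s1: "square_integrable (\<lambda>x. complex_of_real (1 / (2 * pi)) * fourier ?g (- x))"
    by (intro square_integrable_cmult square_integrable_reflect sF)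
  have m: "(\<lambda>x. complex_of_real (T G x)) \<in> borel_measurable lborel" using T_measurable[OF G] by simp
  show ?thesis
    by (rule is_fourier_cong_AE(2)[OF s1 is_fourier_inverse[OF g2] m square_integrableD[OF g2] eq]) simp
qed

lemma evk_continuous:
  assumes "(y :: nat \<Rightarrow> real) \<longlonglongrightarrow> x"
  shows "(\<lambda>n. L2norm (\<lambda>k. evk x k - evk (y n) k)) \<longlonglongrightarrow> 0"
proof (rule L2_tendsto_dominated[where h="\<lambda>k. (1 / pi) *\<^sub>R (1 / sqrt (q k))"])
  show "square_integrable (\<lambda>k. (1 / pi) *\<^sub>R (1 / sqrt (q k)))" by (rule square_integrable_scaleR[OF inv_sqrt_q])
  show "(\<lambda>k. evk x k - evk (y n) k) \<in> borel_measurable lborel" for n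
    by (intro square_integrableD square_integrable_diff evk_L2)
  have n: "cmod (evk x k) = 1 / (2 * pi) * (1 / sqrt (q k))" for x k
    using q_pos[of k] by (simp add: evk_def norm_mult norm_divide)
  show "AE k in lborel. cmod (evk x k - evk (y n) k) \<le> norm ((1 / pi) *\<^sub>R (1 / sqrt (q k)))" for n
  proof (rule AE_I2)
    fix k
    have "cmod (evk x k - evk (y n) k) \<le> cmod (evk x k) + cmod (evk (y n) k)" by (rule norm_triangle_ineq4)
    also have "\<dots> = norm ((1 / pi) *\<^sub>R (1 / sqrt (q k)))" unfolding n using q_pos[of k] by simp
    finally show "cmod (evk x k - evk (y n) k) \<le> norm ((1 / pi) *\<^sub>R (1 / sqrt (q k)))" .
  qed
  show "AE k in lborel. (\<lambda>n. evk x k - evk (y n) k) \<longlonglongrightarrow> 0"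
  proof (rule AE_I2)
    fix k
    have "(\<lambda>n. evk x k - evk (y n) k) \<longlonglongrightarrow> evk x k - evk x k"
      unfolding evk_def by (intro tendsto_intros assms)
    then show "(\<lambda>n. evk x k - evk (y n) k) \<longlonglongrightarrow> 0" by simp
  qed
qed

text \<open>Only countably many evaluations can serve as tests, hence the rationals. The functions
  \<open>evk x\<close> depend continuously on x in norm, so bounded sequences are equicontinuous and
  convergence extends to all points.\<close>

lemma T_pointwise:
  assumes H: "\<And>n. square_integrable (H n)" "\<And>n. L2norm (H n) \<le> R" and C: "square_integrable C"
    and lim: "\<And>x. x \<in> \<rat> \<Longrightarrow> (\<lambda>n::nat. T (H n) x) \<longlonglongrightarrow> T C x"
  shows "(\<lambda>n. T (H n) x) \<longlonglongrightarrow> T C x"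
proof (rule LIMSEQ_I)
  fix e :: real assume e: "e > 0"
  define S where "S = R + L2norm C"
  have S: "0 \<le> S" "R \<le> S" "L2norm C \<le> S"
    unfolding S_def using H(2)[of 0] L2norm_nonneg[of "H 0"] L2norm_nonneg[of C] by linarith+
  have "\<exists>y\<in>\<rat>. \<bar>y - x\<bar> < 1 / real (Suc n)" for n
    using Rats_dense_in_real[of x "x + 1 / real (Suc n)"] by (force simp: Bex_def)
  then have "\<forall>n. \<exists>y. y \<in> \<rat> \<and> \<bar>y - x\<bar> < 1 / real (Suc n)" by blast
  from choice[OF this] obtain y where y: "\<forall>n. y n \<in> \<rat> \<and> \<bar>y n - x\<bar> < 1 / real (Suc n)" ..
  have "y \<longlonglongrightarrow> x"
  proof (rule LIM_zero_cancel, rule Lim_null_comparison)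
    show "(\<lambda>n. 1 / real (Suc n)) \<longlonglongrightarrow> 0" by (rule LIMSEQ_inverse_real_of_nat[unfolded inverse_eq_divide])
    show "\<forall>\<^sub>F n in sequentially. norm (y n - x) \<le> 1 / real (Suc n)" using y by (simp add: less_imp_le)
  qed
  from tendsto_mult[OF tendsto_const evk_continuous[OF this], of S]
  have "(\<lambda>n. S * L2norm (\<lambda>k. evk x k - evk (y n) k)) \<longlonglongrightarrow> 0" by simp
  from tendsto_0_ge_less[OF this, of "e / 3"] e
  obtain n where n: "S * L2norm (\<lambda>k. evk x k - evk (y n) k) < e / 3" by auto
  have close: "\<bar>T G x - T G (y n)\<bar> < e / 3" if "square_integrable G" "L2norm G \<le> S" for G
  proof -
    have "\<bar>T G x - T G (y n)\<bar> = \<bar>rip G (\<lambda>k. evk x k - evk (y n) k)\<bar>"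
      unfolding T_eq_rip by (simp add: rip_diff_right evk_L2 that)
    also have "\<dots> \<le> L2norm G * L2norm (\<lambda>k. evk x k - evk (y n) k)"
      by (intro rip_bound square_integrable_diff evk_L2 that)
    also have "\<dots> \<le> S * L2norm (\<lambda>k. evk x k - evk (y n) k)" by (intro mult_right_mono that) simp
    finally show ?thesis using n by linarith
  qed
  have "y n \<in> \<rat>" using y by simp
  from LIMSEQ_D[OF lim[OF this], of "e / 3"] e
  obtain N where N: "\<And>m. m \<ge> N \<Longrightarrow> norm (T (H m) (y n) - T C (y n)) < e / 3" by auto
  have "norm (T (H m) x - T C x) < e" if "m \<ge> N" for m
    using close[OF H(1)[of m] order_trans[OF H(2)[of m] S(2)]] close[OF C S(3)] N[OF that]
    unfolding real_norm_def by linarith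
  then show "\<exists>no. \<forall>n\<ge>no. norm (T (H n) x - T C x) < e" by blast
qed

end

section \<open>Compactness of minimizing sequences\<close>

text \<open>Strict concavity of the power: splitting the constraint into two positive parts costs
  more in total. This excludes dichotomy.\<close>

lemma powr_add_gt_1:
  fixes x s :: real
  assumes "0 < x" "x < 1" "0 < s" "s < 1"
  shows "1 < x powr s + (1 - x) powr s"
proof -
  have "x powr 1 < x powr s" "(1 - x) powr 1 < (1 - x) powr s"
    using assms by (intro powr_less_mono'; simp)+
  then show ?thesis using assms by simp
qed

locale variational = weight +
  fixes F f :: "real \<Rightarrow> real" and p L :: real
  assumes p: "p > 1" and L: "L \<ge> 0"
    and hom: "\<And>t s. t > 0 \<Longrightarrow> F (t * s) = t powr (p + 1) * F s"
    and der: "\<And>s. (F has_real_derivative f s) (at s)"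
    and F_bound: "\<And>s. \<bar>F s\<bar> \<le> L * \<bar>s\<bar> powr (p + 1)" and f_bound: "\<And>s. \<bar>f s\<bar> \<le> L * \<bar>s\<bar> powr p"
begin

definition K :: "(real \<Rightarrow> complex) \<Rightarrow> real" where "K G = K_fun p F (T G)"

text \<open>The constant of \<open>primitive_almost_additive\<close> for functions bounded by
  \<open>B\<close>; it also serves in the quadratic bound for \<open>F\<close>.\<close>

definition D :: "real \<Rightarrow> real" where "D B = (L * 2 powr p + L) * B powr (p - 1)"

lemma D_nonneg: "0 \<le> D B"
  using L by (simp add: D_def)

lemma F_measurable [measurable]: "F \<in> borel_measurable borel"
proof (rule borel_measurable_continuous_onI)
  show "continuous_on UNIV F"
    using der by (intro continuous_at_imp_continuous_on) (blast intro: DERIV_isCont)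
qed

text \<open>On bounded arguments the surplus p - 1 of the degree over 2 goes into the constant,
  which makes \<open>F\<close> integrable along bounded functions in \<open>L^2\<close>.\<close>

lemma F_quadratic: "\<bar>s\<bar> \<le> B \<Longrightarrow> \<bar>F s\<bar> \<le> D B * s\<^sup>2"
proof -
  assume s: "\<bar>s\<bar> \<le> B"
  have "\<bar>s\<bar> powr (p + 1) = \<bar>s\<bar> powr (p - 1) * s\<^sup>2"
    using powr_add[of "\<bar>s\<bar>" "p - 1" 2] by (cases "s = 0") (auto simp: add.commute)
  also have "\<dots> \<le> B powr (p - 1) * s\<^sup>2" using s p by (intro mult_right_mono powr_mono2) auto
  finally have "L * \<bar>s\<bar> powr (p + 1) \<le> L * (B powr (p - 1) * s\<^sup>2)" using L by (intro mult_left_mono)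
  also have "\<dots> \<le> (L * 2 powr p + L) * (B powr (p - 1) * s\<^sup>2)" using L by (intro mult_right_mono) auto
  finally show ?thesis using F_bound[of s] by (simp add: D_def mult.assoc)
qed

lemma T_square_integral:
  "square_integrable G \<Longrightarrow> (LINT x|lborel. (T G x)\<^sup>2) = (L2norm (T G))\<^sup>2"
  by (simp add: L2norm_sq)

lemma T_square_integrable: "square_integrable G \<Longrightarrow> integrable lborel (\<lambda>x. (T G x)\<^sup>2)"
  using square_integrable_sqD[OF T_L2(1)] by simp

lemma F_T_integrable:
  assumes G: "square_integrable G"
  shows "integrable lborel (\<lambda>x. F (T G x))"
proof (rule Bochner_Integration.integrable_bound)
  have [measurable]: "T G \<in> borel_measurable borel" by (rule T_measurable[OF G])
  show "(\<lambda>x. F (T G x)) \<in> borel_measurable lborel" by measurable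
  show "integrable lborel (\<lambda>x. D (C1 * L2norm G) * (T G x)\<^sup>2)" using T_square_integrable[OF G] by simp
  show "AE x in lborel. norm (F (T G x)) \<le> norm (D (C1 * L2norm G) * (T G x)\<^sup>2)"
    using F_quadratic[OF T_bound[OF G]] D_nonneg by (auto simp: abs_mult)
qed

lemma K_bound:
  assumes G: "square_integrable G" and B: "\<And>x. \<bar>T G x\<bar> \<le> B"
  shows "\<bar>K G\<bar> \<le> (p + 1) * D B * (L2norm (T G))\<^sup>2"
proof -
  have "\<bar>LINT x|lborel. F (T G x)\<bar> \<le> (LINT x|lborel. D B * (T G x)\<^sup>2)"
  proof (rule order_trans[OF integral_abs_bound integral_mono])
    show "integrable lborel (\<lambda>x. \<bar>F (T G x)\<bar>)" using F_T_integrable[OF G] by simp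
    show "integrable lborel (\<lambda>x. D B * (T G x)\<^sup>2)" using T_square_integrable[OF G] by simp
  qed (rule F_quadratic[OF B])
  also have "\<dots> = D B * (L2norm (T G))\<^sup>2" by (simp add: T_square_integral[OF G])
  finally have "(p + 1) * \<bar>LINT x|lborel. F (T G x)\<bar> \<le> (p + 1) * (D B * (L2norm (T G))\<^sup>2)"
    using p by (intro mult_left_mono) auto
  then show ?thesis using p unfolding K_def K_fun_def by (simp add: abs_mult mult.assoc add.commute[of 1])
qed

lemma K_almost_additive:
  assumes G: "square_integrable G" and H: "square_integrable H"
    and B: "\<And>x. \<bar>T G x\<bar> \<le> B" "\<And>x. \<bar>T H x\<bar> \<le> B"
  shows "\<bar>K (\<lambda>k. G k + H k) - K G - K H\<bar> \<le> (p + 1) * D B * (LINT x|lborel. \<bar>T G x\<bar> * \<bar>T H x\<bar>)"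
proof -
  have GH: "square_integrable (\<lambda>k. G k + H k)" by (intro square_integrable_add G H)
  note i = F_T_integrable[OF GH] F_T_integrable[OF G] F_T_integrable[OF H]
  have ip: "integrable lborel (\<lambda>x. \<bar>T G x\<bar> * \<bar>T H x\<bar>)"
    using integrable_norm_mult[OF T_L2(1)[OF G] T_L2(1)[OF H]] by simp
  let ?I = "LINT x|lborel. F (T (\<lambda>k. G k + H k) x) - F (T G x) - F (T H x)"
  have "\<bar>?I\<bar> \<le> (LINT x|lborel. D B * (\<bar>T G x\<bar> * \<bar>T H x\<bar>))"
  proof (rule order_trans[OF integral_abs_bound integral_mono])
    show "integrable lborel (\<lambda>x. \<bar>F (T (\<lambda>k. G k + H k) x) - F (T G x) - F (T H x)\<bar>)" using i by simp
    show "integrable lborel (\<lambda>x. D B * (\<bar>T G x\<bar> * \<bar>T H x\<bar>))" using ip by simp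
    fix x show "\<bar>F (T (\<lambda>k. G k + H k) x) - F (T G x) - F (T H x)\<bar> \<le> D B * (\<bar>T G x\<bar> * \<bar>T H x\<bar>)"
      unfolding T_add[OF G H] D_def by (rule primitive_almost_additive[OF der p L F_bound f_bound B])
  qed
  also have "\<dots> = D B * (LINT x|lborel. \<bar>T G x\<bar> * \<bar>T H x\<bar>)" by simp
  finally have "(p + 1) * \<bar>?I\<bar> \<le> (p + 1) * (D B * (LINT x|lborel. \<bar>T G x\<bar> * \<bar>T H x\<bar>))"
    using p by (intro mult_left_mono) auto
  moreover have "K (\<lambda>k. G k + H k) - K G - K H = - (p + 1) * ?I"
    unfolding K_def K_fun_def using i by (simp add: algebra_simps)
  ultimately show ?thesis using p by (simp add: abs_mult mult.assoc add.commute[of 1])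
qed

text \<open>Almost additivity with Cauchy-Schwarz, and the quadratic bound for the added part. It
  gives continuity of \<open>K\<close> and the first-order estimate for perturbations of the
  minimizer.\<close>

lemma K_Lipschitz:
  assumes G: "square_integrable G" and H: "square_integrable H"
    and B: "\<And>x. \<bar>T G x\<bar> \<le> B" "\<And>x. \<bar>T H x\<bar> \<le> B"
  shows "\<bar>K (\<lambda>k. G k + H k) - K G\<bar> \<le> (p + 1) * D B * ((L2norm (T G) + L2norm (T H)) * L2norm (T H))"
proof -
  have "(LINT x|lborel. \<bar>T G x\<bar> * \<bar>T H x\<bar>) \<le> L2norm (T G) * L2norm (T H)"
    using L2_Cauchy_Schwarz[OF T_L2(1)[OF G] T_L2(1)[OF H]] by simp
  then have "(p + 1) * D B * (LINT x|lborel. \<bar>T G x\<bar> * \<bar>T H x\<bar>) \<le> (p + 1) * D B * (L2norm (T G) * L2norm (T H))"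
    using p D_nonneg[of B] by (intro mult_left_mono) auto
  then have "\<bar>K (\<lambda>k. G k + H k) - K G\<bar> \<le> (p + 1) * D B * (L2norm (T G) * L2norm (T H)) + (p + 1) * D B * (L2norm (T H))\<^sup>2"
    using K_almost_additive[OF G H B] K_bound[OF H B(2)] by linarith
  then show ?thesis by (simp add: algebra_simps power2_eq_square)
qed

lemma K_scale: "c > 0 \<Longrightarrow> K (\<lambda>k. complex_of_real c * G k) = c powr (p + 1) * K G"
  unfolding K_def K_fun_def T_scale by (simp add: hom)

lemma K_shift: "K (\<lambda>k. exp (\<i> * of_real k * of_real y) * G k) = K G"
  unfolding K_def K_fun_def T_shift using integral_shift[of "\<lambda>x. F (T G x)" y] by simp

lemma K_tendsto:
  assumes G: "square_integrable G" and H: "\<And>n. square_integrable (H n)"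
    and lim: "(\<lambda>n::nat. L2norm (\<lambda>k. G k - H n k)) \<longlonglongrightarrow> 0"
  shows "(\<lambda>n. K (H n)) \<longlonglongrightarrow> K G"
proof (rule LIM_zero_cancel, rule Lim_null_comparison)
  define B where "B = C1 * (L2norm G + 1)"
  let ?d = "\<lambda>n. C2 * L2norm (\<lambda>k. G k - H n k)"
  have "(\<lambda>n. (p + 1) * D B * ((L2norm (T G) + ?d n) * ?d n)) \<longlonglongrightarrow> (p + 1) * D B * ((L2norm (T G) + C2 * 0) * (C2 * 0))"
    by (intro tendsto_intros lim)
  then show "(\<lambda>n. (p + 1) * D B * ((L2norm (T G) + ?d n) * ?d n)) \<longlonglongrightarrow> 0" by simp
  have "\<forall>\<^sub>F n in sequentially. L2norm (\<lambda>k. G k - H n k) < 1" by (rule order_tendstoD(2)[OF lim]) simp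
  then show "\<forall>\<^sub>F n in sequentially. norm (K (H n) - K G) \<le> (p + 1) * D B * ((L2norm (T G) + ?d n) * ?d n)"
  proof eventually_elim
    case (elim n)
    let ?E = "\<lambda>k. H n k - G k"
    have E: "square_integrable ?E" by (intro square_integrable_diff G H)
    have nE: "L2norm ?E = L2norm (\<lambda>k. G k - H n k)" by (rule L2norm_minus_commute)
    have "C1 * L2norm G \<le> B" "C1 * L2norm ?E \<le> B"
      unfolding B_def nE using elim C1_nonneg L2norm_nonneg[of G] by (intro mult_left_mono; linarith)+
    then have "\<bar>T G x\<bar> \<le> B" "\<bar>T ?E x\<bar> \<le> B" for x
      using T_bound[OF G, of x] T_bound[OF E, of x] by linarith+
    from K_Lipschitz[OF G E this]
    have "\<bar>K (H n) - K G\<bar> \<le> (p + 1) * D B * ((L2norm (T G) + L2norm (T ?E)) * L2norm (T ?E))" by simp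
    also have "\<dots> \<le> (p + 1) * D B * ((L2norm (T G) + ?d n) * ?d n)"
      using T_L2norm_le[OF E] p D_nonneg[of B] C2_nonneg unfolding nE
      by (intro mult_left_mono mult_mono add_left_mono) (auto intro!: mult_nonneg_nonneg add_nonneg_nonneg)
    finally show ?case by simp
  qed
qed

text \<open>Almost additivity, applied to the remainder and \<open>C\<close>. The defect is an
  integral of the product of their moduli, which vanishes because the remainder is bounded and tends
  to zero pointwise.\<close>

lemma Brezis_Lieb:
  assumes C: "square_integrable C" and H: "\<And>n. square_integrable (H n)" "\<And>n. L2norm (H n) \<le> R"
    and lim: "\<And>x. (\<lambda>n::nat. T (H n) x) \<longlonglongrightarrow> T C x" and Kl: "\<And>n. K (H n) = l"
  shows "(\<lambda>n. K (\<lambda>k. H n k - C k)) \<longlonglongrightarrow> - K C + l"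
proof (rule LIM_zero_cancel, rule Lim_null_comparison)
  let ?W = "\<lambda>n k. H n k - C k"
  define S where "S = R + L2norm C"
  define B where "B = C1 * S"
  have W: "square_integrable (?W n)" for n by (intro square_integrable_diff H C)
  have nW: "L2norm (?W n) \<le> S" for n
    using L2norm_triangle[OF H(1) square_integrable_scaleR[OF C, of "-1"], of n] H(2)[of n]
    unfolding L2norm_scaleR S_def by simp
  have CS: "L2norm C \<le> S" unfolding S_def using H(2)[of 0] L2norm_nonneg[of "H 0"] by linarith
  have bW: "\<bar>T (?W n) x\<bar> \<le> B" for n x
    using T_bound[OF W, of n x] mult_left_mono[OF nW[of n] C1_nonneg] unfolding B_def by linarith
  have bC: "\<bar>T C x\<bar> \<le> B" for x
    using T_bound[OF C, of x] mult_left_mono[OF CS C1_nonneg] unfolding B_def by linarith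
  have "(\<lambda>n. LINT x|lborel. \<bar>T (?W n) x\<bar> * \<bar>T C x\<bar>) \<longlonglongrightarrow> 0"
  proof (rule integral_mult_tendsto_0)
    show "square_integrable (T (?W n))" "square_integrable (T C)" for n by (rule T_L2(1)[OF W], rule T_L2(1)[OF C])
    show "L2norm (T (?W n)) \<le> C2 * S" for n
      using order_trans[OF T_L2norm_le[OF W] mult_left_mono[OF nW C2_nonneg]] .
    show "\<bar>T (?W n) x\<bar> \<le> B" for n x by (rule bW)
    show "(\<lambda>n. T (?W n) x) \<longlonglongrightarrow> 0" for x
      unfolding T_diff[OF H(1) C] using tendsto_diff[OF lim[of x] tendsto_const[of "T C x"]] by simp
  qed
  from tendsto_mult[OF tendsto_const this, of "(p + 1) * D B"]
  show "(\<lambda>n. (p + 1) * D B * (LINT x|lborel. \<bar>T (?W n) x\<bar> * \<bar>T C x\<bar>)) \<longlonglongrightarrow> 0" by simp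
  have "\<bar>K (?W n) - (- K C + l)\<bar> \<le> (p + 1) * D B * (LINT x|lborel. \<bar>T (?W n) x\<bar> * \<bar>T C x\<bar>)" for n
    using K_almost_additive[OF W C bW bC, of n] Kl[of n] by (simp add: abs_le_iff)
  then show "\<forall>\<^sub>F n in sequentially. norm (K (?W n) - (- K C + l)) \<le> (p + 1) * D B * (LINT x|lborel. \<bar>T (?W n) x\<bar> * \<bar>T C x\<bar>)"
    by simp
qed

text \<open>If all values are at most c, then \<open>K G\<close> is at most A times c^(p - 1), where
  A depends only on the norm bound. As p > 1, a small c contradicts \<open>K G = l\<close>; the
  chosen one leaves A l / (A + 1).\<close>

lemma nonvanishing:
  assumes l: "l > 0"
  shows "\<exists>c>0. \<forall>G. square_integrable G \<longrightarrow> L2norm G \<le> R \<longrightarrow> K G = l \<longrightarrow> (\<exists>x. c \<le> \<bar>T G x\<bar>)"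
proof -
  define A where "A = (p + 1) * (L * 2 powr p + L) * (C2 * R)\<^sup>2"
  have A: "0 \<le> A" unfolding A_def using p L by simp
  define c where "c = (l / (A + 1)) powr (1 / (p - 1))"
  have c: "c > 0" unfolding c_def using l A by simp
  have cp: "c powr (p - 1) = l / (A + 1)" unfolding c_def using p l A by (simp add: powr_powr)
  have "\<exists>x. c \<le> \<bar>T G x\<bar>" if G: "square_integrable G" "L2norm G \<le> R" and K: "K G = l" for G
  proof (rule ccontr)
    assume "\<not> ?thesis"
    then have "\<bar>T G x\<bar> \<le> c" for x by (meson linear)
    from K_bound[OF G(1) this] have "l \<le> (p + 1) * D c * (L2norm (T G))\<^sup>2" using K l by simp
    also have "\<dots> \<le> (p + 1) * D c * (C2 * R)\<^sup>2"
      using order_trans[OF T_L2norm_le[OF G(1)] mult_left_mono[OF G(2) C2_nonneg]] p D_nonneg[of c]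
      by (intro mult_left_mono power_mono) auto
    also have "\<dots> = A * (l / (A + 1))" unfolding D_def cp A_def by (simp add: mult_ac)
    also have "\<dots> < l" using A l by (simp add: field_simps)
    finally show False by simp
  qed
  with c show ?thesis by blast
qed

theorem minimizing_sequence_compact:
  assumes l: "l > 0"
    and LB: "\<And>G. square_integrable G \<Longrightarrow> hermitian G \<Longrightarrow> 0 < K G \<Longrightarrow>
       m * (K G / l) powr (2 / (p + 1)) \<le> (L2norm G)\<^sup>2"
    and G: "\<And>n. square_integrable (G n)" "\<And>n. hermitian (G n)" "\<And>n. K (G n) = l"
    and lim: "(\<lambda>n. (L2norm (G n))\<^sup>2) \<longlonglongrightarrow> m"
  shows "\<exists>(r :: nat \<Rightarrow> nat) y C. strict_mono r \<and> square_integrable C \<and> hermitian C \<and> K C = l \<and> (L2norm C)\<^sup>2 = m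
    \<and> (\<lambda>n. L2norm (\<lambda>k. exp (\<i> * of_real k * of_real (y n)) * G (r n) k - C k)) \<longlonglongrightarrow> 0"
proof -
  have "(\<lambda>n. L2norm (G n)) \<longlonglongrightarrow> sqrt m" using tendsto_real_sqrt[OF lim] by simp
  then have "Bseq (\<lambda>n. L2norm (G n))" by (intro convergent_imp_Bseq convergentI)
  then obtain R where R: "\<And>n. L2norm (G n) \<le> R" by (auto simp: Bseq_def)
  obtain c0 where c0: "c0 > 0" "\<And>G. square_integrable G \<Longrightarrow> L2norm G \<le> R \<Longrightarrow> K G = l \<Longrightarrow> \<exists>x. c0 \<le> \<bar>T G x\<bar>"
    using nonvanishing[OF l, of R] by blast
  have "\<forall>n. \<exists>x. c0 \<le> \<bar>T (G n) x\<bar>" using c0(2)[OF G(1) R G(3)] by blast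
  from choice[OF this] obtain y where y: "\<forall>n. c0 \<le> \<bar>T (G n) (y n)\<bar>" ..
  define H where "H n k = exp (\<i> * of_real k * of_real (y n)) * G n k" for n k
  have H: "square_integrable (H n)" "L2norm (H n) = L2norm (G n)" "hermitian (H n)" "K (H n) = l" for n
    unfolding H_def[abs_def] using G R
    by (auto intro: square_integrable_modulate hermitian_modulate simp: L2norm_modulate K_shift)
  have HR: "L2norm (H n) \<le> R" for n using R H(2) by simp
  \<comment> \<open>Enumerates the evaluations at rational points as weak tests.\<close>
  define E where "E i = evk (from_nat_into \<rat> i)" for i
  have E: "square_integrable (E i)" for i unfolding E_def by (rule evk_L2)
  from L2_weak_subsequence[where G=H and E=E, OF H(1) HR E]
  obtain r c C where r: "strict_mono (r :: nat \<Rightarrow> nat)" and C: "square_integrable C"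
    and CE: "\<forall>i. (\<lambda>n. rip (H (r n)) (E i)) \<longlonglongrightarrow> rip C (E i)" and CC: "(\<lambda>n. rip (H (r n)) C) \<longlonglongrightarrow> (L2norm C)\<^sup>2"
    and ch: "\<forall>n. c n \<in> midhull (range H)" and cC: "(\<lambda>n. L2norm (\<lambda>x. c n x - C x)) \<longlonglongrightarrow> 0"
    by (elim exE conjE)
  have hC: "hermitian C"
  proof (rule hermitian_L2_limit[OF _ _ C cC])
    show "square_integrable (c n)" for n using midhull_L2(1)[OF ch[rule_format, of n], of R] H(1) HR by auto
    show "hermitian (c n)" for n using hermitian_midhull[OF ch[rule_format, of n]] H(3) by auto
  qed
  have pt: "(\<lambda>n. T (H (r n)) x) \<longlonglongrightarrow> T C x" for x
  proof (rule T_pointwise[OF H(1) HR C])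
    fix x :: real assume "x \<in> \<rat>"
    then obtain i where "from_nat_into \<rat> i = x" using from_nat_into_surj[OF countable_rat] by blast
    then show "(\<lambda>n. T (H (r n)) x) \<longlonglongrightarrow> T C x"
      using CE[rule_format, of i] unfolding T_eq_rip E_def by simp
  qed
  \<comment> \<open>The translations have put a point where the modulus is at least
    \<open>c0\<close> at the origin, and pointwise convergence preserves the bound.\<close>
  have "c0 \<le> \<bar>T C 0\<bar>"
  proof (rule LIMSEQ_le_const[OF tendsto_rabs[OF pt]])
    have "c0 \<le> \<bar>T (H n) 0\<bar>" for n using y unfolding H_def[abs_def] T_shift by simp
    then show "\<exists>N. \<forall>n\<ge>N. c0 \<le> \<bar>T (H (r n)) 0\<bar>" by blast
  qed
  with T_bound[OF C, of 0] c0(1) have "L2norm C \<noteq> 0" by auto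
  then have nC: "0 < (L2norm C)\<^sup>2" by simp
  define W where "W n k = H (r n) k - C k" for n k
  have W: "square_integrable (W n)" "hermitian (W n)" for n
    unfolding W_def[abs_def] by (intro square_integrable_diff hermitian_diff H C hC)+
  have limr: "(\<lambda>n. (L2norm (H (r n)))\<^sup>2) \<longlonglongrightarrow> m"
    using LIMSEQ_subseq_LIMSEQ[OF lim r] by (simp add: H(2) o_def)
  \<comment> \<open>The pairing with \<open>C\<close> tends to the squared norm of \<open>C\<close>,
    so the cross term turns the sum of the energies into a difference.\<close>
  have limW: "(\<lambda>n. (L2norm (W n))\<^sup>2) \<longlonglongrightarrow> m - (L2norm C)\<^sup>2"
  proof -
    have "(\<lambda>n. (L2norm (H (r n)))\<^sup>2 + (L2norm C)\<^sup>2 - 2 * rip (H (r n)) C) \<longlonglongrightarrow> m + (L2norm C)\<^sup>2 - 2 * (L2norm C)\<^sup>2"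
      by (intro tendsto_intros limr CC)
    then show ?thesis unfolding W_def[abs_def] L2norm_diff_sq_rip[OF H(1) C] by simp
  qed
  have KW: "(\<lambda>n. K (W n)) \<longlonglongrightarrow> - K C + l"
    unfolding W_def[abs_def] by (rule Brezis_Lieb[OF C H(1) HR pt H(4)])
  define s where "s = 2 / (p + 1)"
  have s: "0 < s" "s < 1" using p by (auto simp: s_def)
  have mW: "0 \<le> m - (L2norm C)\<^sup>2"
    by (rule LIMSEQ_le_const[OF limW]) simp
  then have m: "0 < m" using nC by linarith
  \<comment> \<open>The lower bound for the remainder, in the limit. \<open>K C < l\<close> makes
    \<open>K (W n)\<close> eventually positive, as \<open>LB\<close> demands.\<close>
  have above: "m * ((l - K C) / l) powr s \<le> m - (L2norm C)\<^sup>2" if "K C < l"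
  proof (rule tendsto_le[OF sequentially_bot limW])
    show "(\<lambda>n. m * (K (W n) / l) powr s) \<longlonglongrightarrow> m * ((l - K C) / l) powr s"
      using KW that l by (intro tendsto_intros tendsto_powr') (auto simp: algebra_simps)
    have "\<forall>\<^sub>F n in sequentially. 0 < K (W n)" using that by (intro order_tendstoD(1)[OF KW]) simp
    then show "\<forall>\<^sub>F n in sequentially. m * (K (W n) / l) powr s \<le> (L2norm (W n))\<^sup>2"
      unfolding s_def by eventually_elim (rule LB[OF W])
  qed
  \<comment> \<open>Otherwise the remainder would carry at least the full constraint
    \<open>l\<close> and cost at least \<open>m\<close>, although the nonzero \<open>C\<close> has
    already used part of that energy.\<close>
  have pos: "0 < K C"
  proof (rule ccontr)
    assume "\<not> 0 < K C"
    then have "K C < l" and "1 \<le> (l - K C) / l" using l by auto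
    then have "m * 1 \<le> m * ((l - K C) / l) powr s"
      using s m by (intro mult_left_mono ge_one_powr_ge_zero) auto
    with above[OF \<open>K C < l\<close>] nC show False by simp
  qed
  have below: "m * (K C / l) powr s \<le> (L2norm C)\<^sup>2"
    unfolding s_def by (rule LB[OF C hC pos])
  \<comment> \<open>Dichotomy: by strict concavity the two lower bounds add up to more than
    \<open>m\<close>, whereas the energies add up to exactly \<open>m\<close>.\<close>
  have "\<not> K C < l"
  proof
    assume less: "K C < l"
    have "1 < (K C / l) powr s + (1 - K C / l) powr s"
      using pos less l s by (intro powr_add_gt_1) auto
    also have "1 - K C / l = (l - K C) / l" using l by (simp add: field_simps)
    finally have "m * 1 < m * ((K C / l) powr s + ((l - K C) / l) powr s)"
      using m by (intro mult_strict_left_mono)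
    with above[OF less] below show False by (simp add: distrib_left)
  qed
  then have "1 \<le> (K C / l) powr s" using l s by (intro ge_one_powr_ge_zero) auto
  then have "m * 1 \<le> m * (K C / l) powr s" using m by (intro mult_left_mono) auto
  with below mW have Cm: "(L2norm C)\<^sup>2 = m" by simp
  \<comment> \<open>An excess over \<open>l\<close> would force the energy of \<open>C\<close>
    strictly above \<open>m\<close>.\<close>
  have KC: "K C = l"
  proof (rule ccontr)
    assume "K C \<noteq> l"
    with \<open>\<not> K C < l\<close> have "1 < K C / l" using l by simp
    then have "1 powr s < (K C / l) powr s" using s by (intro powr_less_mono2) auto
    then have "m * 1 < m * (K C / l) powr s" using m by (intro mult_strict_left_mono) auto
    with below Cm show False by simp
  qed
  have "(\<lambda>n. L2norm (W n)) \<longlonglongrightarrow> 0"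
    using tendsto_real_sqrt[OF limW] Cm by simp
  then have "(\<lambda>n. L2norm (\<lambda>k. exp (\<i> * of_real k * of_real (y (r n))) * G (r n) k - C k)) \<longlonglongrightarrow> 0"
    unfolding W_def[abs_def] H_def .
  with r C hC KC Cm show ?thesis by (intro exI[of _ r] exI[of _ "\<lambda>n. y (r n)"] exI[of _ C] conjI)
qed

section \<open>Regularity of the minimizer\<close>

text \<open>Comparing the minimizer \<open>C\<close> with \<open>C - t H\<close>, where \<open>H\<close> is a frequency truncation of
  \<open>q C\<close>, replaces the Euler-Lagrange equation: it bounds the pairing of \<open>C\<close> and \<open>H\<close> by the
  \<open>L\<^sup>2\<close> norm of \<open>T H\<close>.\<close>

theorem minimizer_regularity:
  assumes l: "l > 0"
    and LB: "\<And>G. square_integrable G \<Longrightarrow> hermitian G \<Longrightarrow> 0 < K G \<Longrightarrow>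
       m * (K G / l) powr (2 / (p + 1)) \<le> (L2norm G)\<^sup>2"
    and C: "square_integrable C" "hermitian C" "K C = l" "(L2norm C)\<^sup>2 = m"
  shows "square_integrable (\<lambda>k. complex_of_real (sqrt (q k)) * C k)"
proof -
  note [measurable] = square_integrableD[OF C(1)]
  \<comment> \<open>The summand 1 leaves room for the perturbation t H, which is uniformly below 1
    for small t.\<close>
  define B where "B = C1 * L2norm C + 1"
  define A where "A = (p + 1) * D B / l"
  have A: "0 \<le> A" unfolding A_def using p D_nonneg[of B] l by simp
  have m: "0 \<le> m" using C(4) by (metis zero_le_power2)
  \<comment> \<open>After division by t, the quadratic term in \<open>H\<close> disappears as t
    tends to zero, while the change of \<open>K\<close> contributes only through the norm of
    \<open>T H\<close>.\<close>
  have key: "2 * rip C H \<le> m * A * (L2norm (T C) * L2norm (T H))" if H: "square_integrable H" "hermitian H" for H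
  proof -
    define t where "t n = 1 / real (Suc n)" for n
    have t: "t n > 0" for n by (simp add: t_def)
    have t0: "t \<longlonglongrightarrow> 0" unfolding t_def by (rule LIMSEQ_inverse_real_of_nat[unfolded inverse_eq_divide])
    let ?V = "\<lambda>n k. complex_of_real (- t n) * H k"
    have V: "square_integrable (?V n)" "hermitian (?V n)" for n
      by (intro square_integrable_cmult H hermitian_mult_even[OF H(2)] refl)+
    have TV: "L2norm (T (?V n)) = t n * L2norm (T H)" for n
    proof -
      have "T (?V n) = (\<lambda>x. (- t n) *\<^sub>R T H x)" by (intro ext) (simp only: T_scale real_scaleR_def)
      then show ?thesis using t[of n] by (simp only: L2norm_scaleR abs_minus abs_of_pos)
    qed
    have b: "(\<lambda>n. A * ((L2norm (T C) + t n * L2norm (T H)) * (t n * L2norm (T H)))) \<longlonglongrightarrow> A * ((L2norm (T C) + 0 * L2norm (T H)) * (0 * L2norm (T H)))"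
      by (intro tendsto_intros t0)
    have small: "\<forall>\<^sub>F n in sequentially. A * ((L2norm (T C) + t n * L2norm (T H)) * (t n * L2norm (T H))) < 1"
      by (rule order_tendstoD(2)[OF b]) simp
    have c: "(\<lambda>n. t n * (C1 * L2norm H)) \<longlonglongrightarrow> 0 * (C1 * L2norm H)" by (intro tendsto_intros t0)
    have small2: "\<forall>\<^sub>F n in sequentially. t n * (C1 * L2norm H) < 1" by (rule order_tendstoD(2)[OF c]) simp
    have "\<forall>\<^sub>F n in sequentially. 2 * rip C H \<le> t n * (L2norm H)\<^sup>2 + m * A * ((L2norm (T C) + t n * L2norm (T H)) * L2norm (T H))"
      using small small2
    proof eventually_elim
      case (elim n)
      let ?x = "A * ((L2norm (T C) + t n * L2norm (T H)) * (t n * L2norm (T H)))"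
      let ?CV = "\<lambda>k. C k + ?V n k"
      have B1: "\<bar>T C x\<bar> \<le> B" for x using T_bound[OF C(1), of x] by (simp add: B_def)
      have B2: "\<bar>T (?V n) x\<bar> \<le> B" for x
      proof -
        have "\<bar>T (?V n) x\<bar> = t n * \<bar>T H x\<bar>" unfolding T_scale using t[of n] by (simp add: abs_mult)
        also have "\<dots> \<le> t n * (C1 * L2norm H)" using t[of n] T_bound[OF H(1)] by (intro mult_left_mono) auto
        also have "\<dots> \<le> B"
          unfolding B_def using elim(2) mult_nonneg_nonneg[OF C1_nonneg L2norm_nonneg[of C]] by linarith
        finally show ?thesis .
      qed
      have "l * ?x = (p + 1) * D B * ((L2norm (T C) + t n * L2norm (T H)) * (t n * L2norm (T H)))"
        unfolding A_def using l by simp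
      then have "\<bar>K ?CV - l\<bar> \<le> l * ?x"
        using K_Lipschitz[OF C(1) V(1) B1 B2] unfolding TV C(3) by (simp only:)
      then have "l * (1 - ?x) \<le> K ?CV" unfolding right_diff_distrib by linarith
      then have K1: "1 - ?x \<le> K ?CV / l" using l by (simp only: pos_le_divide_eq mult.commute)
      then have "0 < K ?CV / l" using elim(1) by linarith
      then have pos: "0 < K ?CV" using l by (simp only: zero_less_divide_iff) linarith
      \<comment> \<open>The exponent is below one, so for a base in the unit interval the power
        dominates the base; for a larger base it is at least one.\<close>
      have "1 - ?x \<le> (K ?CV / l) powr (2 / (p + 1))"
      proof (cases "K ?CV / l \<le> 1")
        case True
        have "(K ?CV / l) powr 1 \<le> (K ?CV / l) powr (2 / (p + 1))"
          using True p pos l by (intro powr_mono') auto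
        then show ?thesis using K1 pos l by simp
      next
        case False
        then have "1 \<le> (K ?CV / l) powr (2 / (p + 1))" using p by (intro ge_one_powr_ge_zero) auto
        moreover have "0 \<le> ?x" using A t[of n] by (simp add: add_nonneg_nonneg)
        ultimately show ?thesis by linarith
      qed
      then have "m * (1 - ?x) \<le> m * (K ?CV / l) powr (2 / (p + 1))" using m by (intro mult_left_mono)
      also have "\<dots> \<le> (L2norm ?CV)\<^sup>2"
        by (rule LB[OF square_integrable_add[OF C(1) V(1)] hermitian_add[OF C(2) V(2)] pos])
      also have "(L2norm ?CV)\<^sup>2 = m + (t n)\<^sup>2 * (L2norm H)\<^sup>2 - 2 * t n * rip C H"
      proof -
        have "?CV = (\<lambda>k. C k - complex_of_real (t n) * H k)" by (intro ext) simp
        moreover have "rip C (\<lambda>k. complex_of_real (t n) * H k) = t n * rip C H"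
          using rip_cmult_left[of "t n" H C] by (simp add: rip_commute[of C])
        ultimately show ?thesis
          using L2norm_diff_sq_rip[OF C(1) square_integrable_cmult[OF H(1)], of "complex_of_real (t n)"] C(4)
          by (simp add: L2norm_cmult power_mult_distrib)
      qed
      finally have "t n * (2 * rip C H) \<le> t n * (t n * (L2norm H)\<^sup>2 + m * A * ((L2norm (T C) + t n * L2norm (T H)) * L2norm (T H)))"
        by (simp add: algebra_simps power2_eq_square)
      then show ?case using t[of n] by simp
    qed
    moreover have "(\<lambda>n. t n * (L2norm H)\<^sup>2 + m * A * ((L2norm (T C) + t n * L2norm (T H)) * L2norm (T H)))
       \<longlonglongrightarrow> 0 * (L2norm H)\<^sup>2 + m * A * ((L2norm (T C) + 0 * L2norm (T H)) * L2norm (T H))"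
      by (intro tendsto_intros t0)
    ultimately have "2 * rip C H \<le> 0 * (L2norm H)\<^sup>2 + m * A * ((L2norm (T C) + 0 * L2norm (T H)) * L2norm (T H))"
      by (intro tendsto_le[OF sequentially_bot _ tendsto_const[of "2 * rip C H"]])
    then show ?thesis by simp
  qed
  define M where "M = m * A * (L2norm (T C) / sqrt (2 * pi)) / 2"
  have M: "0 \<le> M" unfolding M_def using m A by simp
  define g where "g n k = complex_of_real (if q k \<le> real n then sqrt (q k) else 0) * C k" for n k
  have gm: "g n \<in> borel_measurable lborel" for n
    unfolding g_def[abs_def] by measurable
  have g: "square_integrable (g n)" for n
  proof (rule square_integrable_bound[OF C(1) gm, where c="sqrt (real n)"])
    show "AE k in lborel. cmod (g n k) \<le> sqrt (real n) * cmod (C k)"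
      using q_pos by (auto simp: g_def norm_mult less_imp_le intro!: AE_I2 mult_right_mono)
  qed
  have "L2norm (g n) \<le> M" for n
  proof -
    \<comment> \<open>On the set where q is at most n, \<open>H\<close> is q C and
      \<open>g n\<close> is sqrt q times C. The pairing of \<open>C\<close> with \<open>H\<close> is
      the squared norm of \<open>g n\<close>, whereas \<open>T H\<close> is bounded by the first
      power of that norm, because dividing \<open>H\<close> by sqrt q gives back \<open>g n\<close>.
      One power cancels and a bound independent of \<open>n\<close> remains.\<close>
    define H where "H k = complex_of_real (if q k \<le> real n then q k else 0) * C k" for k
    have Hm: "H \<in> borel_measurable lborel" unfolding H_def[abs_def] by measurable
    have H: "square_integrable H"
    proof (rule square_integrable_bound[OF C(1) Hm, where c="real n"])
      show "AE k in lborel. cmod (H k) \<le> real n * cmod (C k)"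
        using q_pos by (auto simp: H_def norm_mult less_imp_le intro!: AE_I2 mult_right_mono)
    qed
    have hH: "hermitian H" unfolding H_def[abs_def] by (rule hermitian_mult_even[OF C(2)]) (simp add: q_even)
    have "rip C H = (L2norm (g n))\<^sup>2"
    proof -
      have "C k * cnj (H k) = complex_of_real ((cmod (g n k))\<^sup>2)" for k
        using q_pos[of k] by (simp add: H_def g_def norm_mult power_mult_distrib complex_norm_square mult_ac del: of_real_power)
      then have "rip C H = Re (LINT k|lborel. complex_of_real ((cmod (g n k))\<^sup>2))" unfolding rip_def by simp
      then show ?thesis unfolding integral_complex_of_real L2norm_sq by simp
    qed
    moreover have "L2norm (T H) \<le> L2norm (g n) / sqrt (2 * pi)"
    proof -
      have "cmod (dv H k) = cmod (g n k)" for k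
      proof -
        have "q k / sqrt (q k) = sqrt (q k)" using q_pos[of k] by (simp add: real_div_sqrt)
        then have "q k * c / sqrt (q k) = sqrt (q k) * c" for c by (metis times_divide_eq_left)
        then show ?thesis using q_pos[of k] unfolding cmod_dv by (simp add: H_def g_def norm_mult)
      qed
      then have "L2norm (dv H) = L2norm (g n)" by (rule L2norm_cong_norm)
      then show ?thesis using T_L2(2)[OF H] by simp
    qed
    then have "m * A * (L2norm (T C) * L2norm (T H)) \<le> m * A * (L2norm (T C) * (L2norm (g n) / sqrt (2 * pi)))"
      using m A by (intro mult_left_mono) auto
    ultimately have "2 * (L2norm (g n))\<^sup>2 \<le> 2 * (M * L2norm (g n))"
      using key[OF H hH] by (simp add: M_def mult_ac)
    then have "L2norm (g n) * L2norm (g n) \<le> M * L2norm (g n)" by (simp add: power2_eq_square)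
    then show ?thesis
      using M L2norm_nonneg[of "g n"] by (cases "L2norm (g n) = 0") (auto simp: mult_le_cancel_right)
  qed
  then show ?thesis
  proof (rule L2norm_Fatou(1)[OF g])
    show "AE k in lborel. (\<lambda>n. g n k) \<longlonglongrightarrow> complex_of_real (sqrt (q k)) * C k"
    proof (rule AE_I2, rule tendsto_eventually)
      fix k
      obtain N where "q k \<le> real N" using real_arch_simple by blast
      then have "\<forall>n\<ge>N. g n k = complex_of_real (sqrt (q k)) * C k" by (auto simp: g_def)
      then show "\<forall>\<^sub>F n in sequentially. g n k = complex_of_real (sqrt (q k)) * C k"
        unfolding eventually_sequentially by blast
    qed
  qed measurable
qed

end

section \<open>Existence of minimizers\<close>

lemma integrable_inverse_1_plus_sq: "integrable lborel (\<lambda>x::real. 1 / (1 + x\<^sup>2))"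
  using integrable_inverse_1_plus_square by (simp add: set_integrable_def inverse_eq_divide)

text \<open>\<open>q_eq\<close> ties the abstract weight to the functional, and
  \<open>q_coercive\<close> makes it dominate the squared symbols in \<open>H_norm\<close>.\<close>

locale coercive_variational = variational +
  fixes \<kappa> \<alpha> \<beta> \<gamma> \<delta> cs :: real
  assumes \<kappa>: "\<kappa> > 0" and q_coercive: "k \<noteq> 0 \<Longrightarrow> \<kappa> * (1 / k\<^sup>2 + 1 + k\<^sup>2) \<le> q k"
    and q_eq: "q k = Qsym (cs - \<alpha>) \<beta> \<gamma> \<delta> k"
begin

text \<open>The representative of u in \<open>L^2\<close>: \<open>T\<close> maps it back to u almost
  everywhere.\<close>

definition amp :: "(real \<Rightarrow> real) \<Rightarrow> real \<Rightarrow> complex" where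
  "amp u k = complex_of_real (sqrt (q k)) * fourier_real u k"

lemma dv_amp: "dv (amp u) = fourier_real u"
proof
  fix k show "dv (amp u) k = fourier_real u k"
    using q_pos[of k] by (simp add: dv_def amp_def)
qed

lemma amp_props:
  assumes u: "u \<in> H_space"
  shows "square_integrable (amp u)" "hermitian (amp u)"
    "(L2norm (amp u))\<^sup>2 = 2 * pi * I_fun \<alpha> \<beta> \<gamma> \<delta> cs u" "K (amp u) = K_fun p F u"
proof -
  note su = H_spaceD(1)[OF u]
  have [measurable]: "fourier_real u \<in> borel_measurable borel" "u \<in> borel_measurable borel"
    using square_integrableD[OF fourier_real_L2[OF su]] square_integrableD[OF su] by auto
  have n: "(cmod (amp u k))\<^sup>2 = Qsym (cs - \<alpha>) \<beta> \<gamma> \<delta> k * (cmod (fourier_real u k))\<^sup>2" for k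
    using q_pos[of k] by (simp add: amp_def norm_mult power_mult_distrib q_eq[symmetric])
  have m: "amp u \<in> borel_measurable lborel" unfolding amp_def[abs_def] by measurable
  show sq: "square_integrable (amp u)"
    unfolding square_integrable_def n using m I_fun_fourier(2)[OF u] by simp
  show h: "hermitian (amp u)"
    unfolding amp_def[abs_def] using fourier_real_hermitian[OF su]
    by (intro hermitian_mult_even) (simp_all add: hermitian_def q_even)
  show "(L2norm (amp u))\<^sup>2 = 2 * pi * I_fun \<alpha> \<beta> \<gamma> \<delta> cs u"
    unfolding L2norm_sq n I_fun_fourier(1)[OF u] ..
  have s: "square_integrable (\<lambda>x. complex_of_real (T (amp u) x))" "square_integrable (\<lambda>x. complex_of_real (u x))"
    using T_L2(1)[OF sq] su by (simp_all add: square_integrable_of_real_iff)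
  have "AE x in lborel. complex_of_real (T (amp u) x) = complex_of_real (u x)"
    by (rule is_fourier_inj[OF s(1) T_fourier[OF sq h] s(2)]) (simp add: dv_amp is_fourier_fourier_real[OF su])
  then have "AE x in lborel. F (T (amp u) x) = F (u x)" by eventually_elim simp
  moreover have "T (amp u) \<in> borel_measurable borel" by (rule T_measurable[OF sq])
  ultimately have "(LINT x|lborel. F (T (amp u) x)) = (LINT x|lborel. F (u x))"
    by (intro integral_cong_AE) auto
  then show "K (amp u) = K_fun p F u" by (simp add: K_def K_fun_def)
qed

text \<open>Coercivity is stated away from the origin; \<open>m 0 = 0\<close> keeps the estimate
  valid at every point.\<close>

lemma symbol_le:
  assumes m: "\<And>k. k \<noteq> 0 \<Longrightarrow> (cmod (m k))\<^sup>2 \<le> 1 / k\<^sup>2 + 1 + k\<^sup>2" "m 0 = 0"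
  shows "cmod (m k * dv G k) \<le> 1 / sqrt \<kappa> * cmod (G k)"
proof (cases "k = 0")
  case False
  have "\<kappa> * (cmod (m k))\<^sup>2 \<le> q k"
    using mult_left_mono[OF m(1)[OF False], of \<kappa>] q_coercive[OF False] \<kappa> by linarith
  then have "sqrt (\<kappa> * (cmod (m k))\<^sup>2) \<le> sqrt (q k)" by (rule real_sqrt_le_mono)
  then have "sqrt \<kappa> * cmod (m k) \<le> sqrt (q k)" by (simp add: real_sqrt_mult)
  then have "sqrt \<kappa> * cmod (m k) * cmod (G k) \<le> sqrt (q k) * cmod (G k)" by (rule mult_right_mono) simp
  then show ?thesis using \<kappa> q_pos[of k] by (simp add: norm_mult cmod_dv field_simps)
qed (use m(2) \<kappa> in simp)

lemma symbols_le:
  fixes k :: real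
  assumes "k \<noteq> 0"
  shows "(cmod (dx_symbol k))\<^sup>2 \<le> 1 / k\<^sup>2 + 1 + k\<^sup>2" "(cmod (dx_inv_symbol k))\<^sup>2 \<le> 1 / k\<^sup>2 + 1 + k\<^sup>2"
    "(cmod (half_symbol k))\<^sup>2 \<le> 1 / k\<^sup>2 + 1 + k\<^sup>2"
proof -
  have n: "0 \<le> 1 / k\<^sup>2" "0 \<le> k\<^sup>2" by simp_all
  have b: "\<bar>k\<bar> \<le> 1 + k\<^sup>2" using sum_squares_bound[of "\<bar>k\<bar>" 1] abs_ge_zero[of k] by simp
  show "(cmod (dx_symbol k))\<^sup>2 \<le> 1 / k\<^sup>2 + 1 + k\<^sup>2"
    unfolding cmod_symbols power2_abs using n by linarith
  show "(cmod (dx_inv_symbol k))\<^sup>2 \<le> 1 / k\<^sup>2 + 1 + k\<^sup>2"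
    unfolding cmod_symbols power_divide power2_abs using n by simp
  show "(cmod (half_symbol k))\<^sup>2 \<le> 1 / k\<^sup>2 + 1 + k\<^sup>2"
    unfolding cmod_symbols real_sqrt_pow2[OF abs_ge_zero] using n b by linarith
qed

text \<open>Bounds each term of \<open>H_norm\<close> by the norm of the amplitude, so that
  convergence of amplitudes implies convergence in \<open>H_norm\<close>.\<close>

lemma L2norm_op_le:
  assumes w: "square_integrable w" and G: "square_integrable G"
    and F: "is_fourier (\<lambda>x. complex_of_real (w x)) (dv G)"
    and m: "m \<in> borel_measurable borel" "\<And>k. m (- k) = cnj (m k)"
      "\<And>k. k \<noteq> 0 \<Longrightarrow> (cmod (m k))\<^sup>2 \<le> 1 / k\<^sup>2 + 1 + k\<^sup>2" "m 0 = 0"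
  shows "L2norm (fourier_op m w) \<le> L2norm G / (sqrt \<kappa> * sqrt (2 * pi))"
proof -
  note [measurable] = m(1)
  have [measurable]: "fourier_real w \<in> borel_measurable borel" using square_integrableD[OF fourier_real_L2[OF w]] by simp
  have mm: "(\<lambda>k. m k * fourier_real w k) \<in> borel_measurable lborel" by measurable
  have le: "AE k in lborel. cmod (m k * fourier_real w k) \<le> 1 / sqrt \<kappa> * cmod (G k)"
    using fourier_real_AE[OF w F]
  proof eventually_elim
    case (elim k)
    show ?case unfolding elim using m(3,4) by (rule symbol_le)
  qed
  have sq: "square_integrable (\<lambda>k. m k * fourier_real w k)" by (rule square_integrable_bound[OF G mm le])
  have "L2norm (\<lambda>k. m k * fourier_real w k) \<le> L2norm (\<lambda>k. complex_of_real (1 / sqrt \<kappa>) * G k)"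
  proof (rule L2norm_mono[OF square_integrable_cmult[OF G] mm])
    have "cmod (complex_of_real (1 / sqrt \<kappa>) * G k) = 1 / sqrt \<kappa> * cmod (G k)" for k
      using \<kappa> by (simp add: norm_mult norm_divide)
    then show "AE k in lborel. cmod (m k * fourier_real w k) \<le> cmod (complex_of_real (1 / sqrt \<kappa>) * G k)"
      using le by simp
  qed
  also have "\<dots> = L2norm G / sqrt \<kappa>" unfolding L2norm_cmult using \<kappa> by (simp add: norm_divide)
  finally show ?thesis
    unfolding L2norm_fourier_op[OF w m(1,2) sq] by (simp add: divide_right_mono flip: divide_divide_eq_left)
qed

text \<open>Coercivity contains the weight 1 / k^2 and thus supplies the antiderivative; the Sobolev
  condition of order 3/2 is what has to be assumed.\<close>

lemma T_in_H_space:
  assumes G: "square_integrable G" "hermitian G"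
    and s: "square_integrable (\<lambda>k. complex_of_real ((1 + k\<^sup>2) powr (3/4)) * dv G k)"
  shows "T G \<in> H_space" "2 * pi * I_fun \<alpha> \<beta> \<gamma> \<delta> cs (T G) = (L2norm G)\<^sup>2"
proof -
  note TF = T_fourier[OF G] and sT = T_L2(1)[OF G(1)]
  have [measurable]: "dv G \<in> borel_measurable borel" "fourier_real (T G) \<in> borel_measurable borel"
    using square_integrableD[OF dv_L2(1)[OF G(1)]] square_integrableD[OF fourier_real_L2[OF sT]] by auto
  have [measurable]: "G \<in> borel_measurable borel" using square_integrableD[OF G(1)] by simp
  show H: "T G \<in> H_space"
  proof (rule H_spaceI[OF sT TF s square_integrable_bound[OF G(1)]])
    show "AE k in lborel. cmod (dx_inv_symbol k * dv G k) \<le> 1 / sqrt \<kappa> * cmod (G k)"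
      by (intro AE_I2 symbol_le symbols_le) (simp_all add: dx_inv_symbol_def)
  qed measurable
  have "(LINT k|lborel. Qsym (cs - \<alpha>) \<beta> \<gamma> \<delta> k * (cmod (fourier_real (T G) k))\<^sup>2) = (LINT k|lborel. (cmod (G k))\<^sup>2)"
  proof (rule integral_cong_AE)
    show "AE k in lborel. Qsym (cs - \<alpha>) \<beta> \<gamma> \<delta> k * (cmod (fourier_real (T G) k))\<^sup>2 = (cmod (G k))\<^sup>2"
      using fourier_real_AE[OF sT TF]
    proof eventually_elim
      case (elim k)
      show ?case unfolding elim cmod_dv q_eq[symmetric] using q_pos[of k] by (simp add: power_divide)
    qed
  qed measurable
  then show "2 * pi * I_fun \<alpha> \<beta> \<gamma> \<delta> cs (T G) = (L2norm G)\<^sup>2"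
    unfolding I_fun_fourier(1)[OF H] L2norm_sq .
qed

text \<open>The comparison is with q, not with sqrt q: the left side grows like \<bar>k\<bar>^(3/2),
  sqrt q only like \<bar>k\<bar>. This gap of one factor sqrt q is what
  \<open>minimizer_regularity\<close> closes.\<close>

lemma sobolev_weight_le: "k \<noteq> 0 \<Longrightarrow> (1 + k\<^sup>2) powr (3/4) \<le> q k / \<kappa>"
proof -
  assume k: "k \<noteq> 0"
  have "(1 + k\<^sup>2) powr (3/4) \<le> (1 + k\<^sup>2) powr 1" by (intro powr_mono) auto
  also have "\<dots> \<le> 1 / k\<^sup>2 + 1 + k\<^sup>2" by simp
  also have "\<dots> \<le> q k / \<kappa>" using q_coercive[OF k] \<kappa> by (simp add: pos_le_divide_eq mult.commute)
  finally show ?thesis .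
qed

lemma I_fun_nonneg:
  assumes "u \<in> H_space"
  shows "0 \<le> I_fun \<alpha> \<beta> \<gamma> \<delta> cs u"
proof -
  have "2 * pi * 0 \<le> 2 * pi * I_fun \<alpha> \<beta> \<gamma> \<delta> cs u"
    using zero_le_power2[of "L2norm (amp u)"] unfolding amp_props(3)[OF assms] by simp
  then show ?thesis by (rule mult_le_cancel_left_pos[THEN iffD1, rotated]) simp
qed

text \<open>Nonnegativity of the functional makes the set of its values bounded below, so that
  \<open>Inf\<close> is a genuine lower bound.\<close>

lemma M_inf_le:
  assumes "u \<in> H_space" "K_fun p F u = l"
  shows "M_inf \<alpha> \<beta> \<gamma> \<delta> cs p F l \<le> I_fun \<alpha> \<beta> \<gamma> \<delta> cs u"
  unfolding M_inf_def
proof (rule cInf_lower)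
  show "bdd_below (I_fun \<alpha> \<beta> \<gamma> \<delta> cs ` {u \<in> H_space. K_fun p F u = l})"
    using I_fun_nonneg by (intro bdd_belowI[of _ 0]) auto
qed (use assms in auto)

text \<open>The infimum is over \<open>H_space\<close>, but the limit of a minimizing sequence is at first only in the
  larger form domain. Frequency truncations are dense there and lie in \<open>H_space\<close>.\<close>

lemma M_inf_lower_bound:
  assumes l: "l > 0" and G: "square_integrable G" "hermitian G" "0 < K G"
  shows "2 * pi * M_inf \<alpha> \<beta> \<gamma> \<delta> cs p F l * (K G / l) powr (2 / (p + 1)) \<le> (L2norm G)\<^sup>2"
proof -
  let ?m = "2 * pi * M_inf \<alpha> \<beta> \<gamma> \<delta> cs p F l"
  note [measurable] = square_integrableD[OF G(1)]
  define g where "g n k = complex_of_real (if q k \<le> real n then 1 else 0) * G k" for n k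
  have gm: "g n \<in> borel_measurable lborel" for n unfolding g_def[abs_def] by measurable
  have g: "square_integrable (g n)" for n
    by (rule square_integrable_bound[OF G(1) gm, where c=1]) (simp add: g_def)
  have hg: "hermitian (g n)" for n unfolding g_def[abs_def] by (rule hermitian_mult_even[OF G(2)]) (simp add: q_even)
  have lim: "(\<lambda>n. L2norm (\<lambda>k. G k - g n k)) \<longlonglongrightarrow> 0"
  proof (rule L2_tendsto_dominated[OF _ G(1)])
    show "(\<lambda>k. G k - g n k) \<in> borel_measurable lborel" for n using gm[of n] by measurable
    show "AE k in lborel. cmod (G k - g n k) \<le> cmod (G k)" for n by (simp add: g_def)
    show "AE k in lborel. (\<lambda>n. G k - g n k) \<longlonglongrightarrow> 0"
    proof (rule AE_I2, rule tendsto_eventually)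
      fix k
      obtain N where "q k \<le> real N" using real_arch_simple by blast
      then have "\<forall>n\<ge>N. G k - g n k = 0" by (auto simp: g_def)
      then show "\<forall>\<^sub>F n in sequentially. G k - g n k = 0" unfolding eventually_sequentially by blast
    qed
  qed
  have limK: "(\<lambda>n. K (g n)) \<longlonglongrightarrow> K G" by (rule K_tendsto[OF G(1) g lim])
  have limN: "(\<lambda>n. (L2norm (g n))\<^sup>2) \<longlonglongrightarrow> (L2norm G)\<^sup>2"
    by (intro tendsto_power L2norm_tendsto G g lim)
  have bound: "?m * (K (g n) / l) powr (2 / (p + 1)) \<le> (L2norm (g n))\<^sup>2" if pos: "0 < K (g n)" for n
  proof -
    \<comment> \<open>The scaling that brings the constraint of the truncation to exactly
      \<open>l\<close>.\<close>
    define s where "s = (l / K (g n)) powr (1 / (p + 1))"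
    have s: "s > 0" unfolding s_def using l pos by simp
    let ?h = "\<lambda>k. complex_of_real s * g n k"
    have h: "square_integrable ?h" "hermitian ?h"
      by (intro square_integrable_cmult g hermitian_mult_even[OF hg] refl)+
    have "s powr (p + 1) = l / K (g n)" unfolding s_def using l pos p by (simp add: powr_powr)
    then have Kh: "K ?h = l" using K_scale[OF s, of "g n"] pos by simp
    have [measurable]: "dv ?h \<in> borel_measurable borel" using square_integrableD[OF dv_L2(1)[OF h(1)]] by simp
    \<comment> \<open>The truncation vanishes where q exceeds n, and elsewhere the Sobolev weight is
      at most n / \<kappa>, away from the origin.\<close>
    have "square_integrable (\<lambda>k. complex_of_real ((1 + k\<^sup>2) powr (3/4)) * dv ?h k)"
    proof (rule square_integrable_bound[OF dv_L2(1)[OF h(1)], where c="real n / \<kappa>"])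
      show "AE k in lborel. cmod (complex_of_real ((1 + k\<^sup>2) powr (3/4)) * dv ?h k) \<le> real n / \<kappa> * cmod (dv ?h k)"
        using AE_lborel_singleton[of 0]
      proof eventually_elim
        case (elim k)
        show ?case
        proof (cases "q k \<le> real n")
          case True
          then have "(1 + k\<^sup>2) powr (3/4) \<le> real n / \<kappa>"
            using sobolev_weight_le[OF elim] divide_right_mono[OF True, of \<kappa>] \<kappa> by linarith
          then have "(1 + k\<^sup>2) powr (3/4) * cmod (dv ?h k) \<le> real n / \<kappa> * cmod (dv ?h k)"
            by (rule mult_right_mono) simp
          then show ?thesis by (simp add: norm_mult)
        qed (simp add: dv_def g_def)
      qed
    qed measurable
    note TH = T_in_H_space[OF h this]
    have "?m \<le> 2 * pi * I_fun \<alpha> \<beta> \<gamma> \<delta> cs (T ?h)"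
      using M_inf_le[OF TH(1), of l] Kh by (simp add: K_def)
    also have "\<dots> = s\<^sup>2 * (L2norm (g n))\<^sup>2"
      unfolding TH(2) L2norm_cmult by (simp add: power_mult_distrib)
    finally have "?m * (K (g n) / l) powr (2 / (p + 1)) \<le> s\<^sup>2 * (L2norm (g n))\<^sup>2 * (K (g n) / l) powr (2 / (p + 1))"
      by (rule mult_right_mono) simp
    also have "\<dots> = (L2norm (g n))\<^sup>2"
    proof -
      have "s\<^sup>2 = (l / K (g n)) powr (2 / (p + 1))"
        using powr_add[of "l / K (g n)" "1 / (p + 1)" "1 / (p + 1)"]
        by (simp add: s_def power2_eq_square add_divide_distrib[symmetric])
      moreover have "(l / K (g n)) powr (2 / (p + 1)) * (K (g n) / l) powr (2 / (p + 1)) = 1"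
        using l pos by (simp add: powr_mult[symmetric])
      ultimately show ?thesis by (simp add: mult.assoc mult.left_commute)
    qed
    finally show ?thesis .
  qed
  show ?thesis
  proof (rule tendsto_le[OF sequentially_bot limN])
    show "(\<lambda>n. ?m * (K (g n) / l) powr (2 / (p + 1))) \<longlonglongrightarrow> ?m * (K G / l) powr (2 / (p + 1))"
      using G(3) l by (intro tendsto_intros limK) auto
    have "\<forall>\<^sub>F n in sequentially. 0 < K (g n)" by (rule order_tendstoD(1)[OF limK G(3)])
    then show "\<forall>\<^sub>F n in sequentially. ?m * (K (g n) / l) powr (2 / (p + 1)) \<le> (L2norm (g n))\<^sup>2"
      by eventually_elim (rule bound)
  qed
qed

theorem minimizers_exist:
  assumes l: "l > 0" and u: "\<And>n. u n \<in> H_space" "\<And>n. K_fun p F (u n) = l"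
    and lim: "(\<lambda>n. I_fun \<alpha> \<beta> \<gamma> \<delta> cs (u n)) \<longlonglongrightarrow> M_inf \<alpha> \<beta> \<gamma> \<delta> cs p F l"
  shows "\<exists>(r :: nat \<Rightarrow> nat) (y :: nat \<Rightarrow> real) v.
           strict_mono r \<and> v \<in> H_space
         \<and> (\<lambda>n. H_norm (\<lambda>x. u (r n) (x + y n) - v x)) \<longlonglongrightarrow> 0
         \<and> K_fun p F v = l \<and> I_fun \<alpha> \<beta> \<gamma> \<delta> cs v = M_inf \<alpha> \<beta> \<gamma> \<delta> cs p F l"
proof -
  define m where "m = 2 * pi * M_inf \<alpha> \<beta> \<gamma> \<delta> cs p F l"
  define G where "G n = amp (u n)" for n
  have G: "square_integrable (G n)" "hermitian (G n)" "K (G n) = l"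
    "(L2norm (G n))\<^sup>2 = 2 * pi * I_fun \<alpha> \<beta> \<gamma> \<delta> cs (u n)" for n
    unfolding G_def using amp_props[OF u(1)[of n]] u(2) by auto
  have LB: "m * (K G / l) powr (2 / (p + 1)) \<le> (L2norm G)\<^sup>2"
    if "square_integrable G" "hermitian G" "0 < K G" for G
    unfolding m_def by (rule M_inf_lower_bound[OF l that])
  have limG: "(\<lambda>n. (L2norm (G n))\<^sup>2) \<longlonglongrightarrow> m"
    unfolding G(4) m_def by (intro tendsto_intros lim)
  have "\<exists>(r :: nat \<Rightarrow> nat) y C. strict_mono r \<and> square_integrable C \<and> hermitian C \<and> K C = l \<and> (L2norm C)\<^sup>2 = m
    \<and> (\<lambda>n. L2norm (\<lambda>k. exp (\<i> * of_real k * of_real (y n)) * G (r n) k - C k)) \<longlonglongrightarrow> 0"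
    by (rule minimizing_sequence_compact[OF l LB G(1-3) limG])
  then obtain r y C where r: "strict_mono (r :: nat \<Rightarrow> nat)"
    and C: "square_integrable C" "hermitian C" "K C = l" "(L2norm C)\<^sup>2 = m"
    and conv: "(\<lambda>n. L2norm (\<lambda>k. exp (\<i> * of_real k * of_real (y n)) * G (r n) k - C k)) \<longlonglongrightarrow> 0"
    by (elim exE conjE)
  have reg: "square_integrable (\<lambda>k. complex_of_real (sqrt (q k)) * C k)"
    by (rule minimizer_regularity[OF l LB C])
  have [measurable]: "dv C \<in> borel_measurable borel" using square_integrableD[OF dv_L2(1)[OF C(1)]] by simp
  \<comment> \<open>The Sobolev weight costs a factor q, and q times \<open>dv C\<close> is sqrt q
    times \<open>C\<close>.\<close>
  have "square_integrable (\<lambda>k. complex_of_real ((1 + k\<^sup>2) powr (3/4)) * dv C k)"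
  proof (rule square_integrable_bound[OF reg, where c="1 / \<kappa>"])
    show "AE k in lborel. cmod (complex_of_real ((1 + k\<^sup>2) powr (3/4)) * dv C k)
      \<le> 1 / \<kappa> * cmod (complex_of_real (sqrt (q k)) * C k)"
      using AE_lborel_singleton[of 0]
    proof eventually_elim
      case (elim k)
      have "cmod (complex_of_real ((1 + k\<^sup>2) powr (3/4)) * dv C k) \<le> q k / \<kappa> * cmod (dv C k)"
        using mult_right_mono[OF sobolev_weight_le[OF elim] norm_ge_zero, of "dv C k"] by (simp add: norm_mult)
      also have "\<dots> = 1 / \<kappa> * (q k / sqrt (q k)) * cmod (C k)" unfolding cmod_dv by simp
      also have "q k / sqrt (q k) = sqrt (q k)" using q_pos[of k] by (simp add: real_div_sqrt)
      finally show ?case using q_pos[of k] by (simp add: norm_mult)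
    qed
  qed measurable
  note TC = T_in_H_space[OF C(1,2) this]
  have IC: "I_fun \<alpha> \<beta> \<gamma> \<delta> cs (T C) = M_inf \<alpha> \<beta> \<gamma> \<delta> cs p F l"
    using TC(2) unfolding C(4) m_def by simp
  define W where "W n k = exp (\<i> * of_real k * of_real (y n)) * G (r n) k - C k" for n k
  have W: "square_integrable (W n)" for n
    unfolding W_def[abs_def] by (intro square_integrable_diff square_integrable_modulate G C)
  define w where "w n x = u (r n) (x + y n) - T C x" for n x
  have su: "square_integrable (u n)" for n by (rule H_spaceD(1)[OF u(1)])
  have w: "square_integrable (w n)" for n
    unfolding w_def[abs_def] by (intro square_integrable_diff square_integrable_shift su T_L2 C)
  \<comment> \<open>Translation multiplies the transform by a phase, so \<open>W n\<close>
    represents the difference \<open>w n\<close> of the translate and the limit.\<close>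
  have Fw: "is_fourier (\<lambda>x. complex_of_real (w n x)) (dv (W n))" for n
  proof -
    have 1: "is_fourier (\<lambda>x. complex_of_real (u (r n) (x + y n))) (\<lambda>k. exp (\<i> * of_real k * of_real (y n)) * fourier_real (u (r n)) k)"
      using is_fourier_shift[OF _ is_fourier_fourier_real[OF su], of "r n" "y n"] su
      by (simp add: square_integrable_of_real_iff)
    have 2: "square_integrable (\<lambda>x. complex_of_real (u (r n) (x + y n)))" "square_integrable (\<lambda>x. complex_of_real (T C x))"
      using square_integrable_shift[OF su, of "r n" "y n"] T_L2(1)[OF C(1)] by (simp_all add: square_integrable_of_real_iff)
    have "dv (W n) = (\<lambda>k. exp (\<i> * of_real k * of_real (y n)) * fourier_real (u (r n)) k - dv C k)"
    proof
      fix k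
      have "dv (W n) k = exp (\<i> * of_real k * of_real (y n)) * dv (amp (u (r n))) k - dv C k"
        by (simp add: dv_def W_def G_def right_diff_distrib)
      then show "dv (W n) k = exp (\<i> * of_real k * of_real (y n)) * fourier_real (u (r n)) k - dv C k"
        by (simp only: dv_amp)
    qed
    then show ?thesis
      using is_fourier_diff[OF 2(1) 1 2(2) T_fourier[OF C(1,2)]] by (simp add: w_def[abs_def])
  qed
  have "(\<lambda>n. H_norm (w n)) \<longlonglongrightarrow> 0"
  proof (rule tendsto_sandwich[OF _ _ tendsto_const])
    have "(\<lambda>n. L2norm (W n)) \<longlonglongrightarrow> 0" using conv unfolding W_def[abs_def] .
    from tendsto_mult[OF tendsto_const this, of "3 / (sqrt \<kappa> * sqrt (2 * pi))"]
    show "(\<lambda>n. 3 / (sqrt \<kappa> * sqrt (2 * pi)) * L2norm (W n)) \<longlonglongrightarrow> 0" by simp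
    show "\<forall>\<^sub>F n in sequentially. 0 \<le> H_norm (w n)" by (simp add: H_norm_def)
    have "H_norm (w n) \<le> 3 / (sqrt \<kappa> * sqrt (2 * pi)) * L2norm (W n)" for n
    proof -
      note op = L2norm_op_le[OF w W Fw, of _ n]
      have "L2norm (dx (w n)) \<le> L2norm (W n) / (sqrt \<kappa> * sqrt (2 * pi))"
        by (rule op) (simp_all add: symbols_measurable symbols_cnj symbols_le, simp add: dx_symbol_def)
      moreover have "L2norm (D_half (w n)) \<le> L2norm (W n) / (sqrt \<kappa> * sqrt (2 * pi))"
        by (rule op) (simp_all add: symbols_measurable symbols_cnj symbols_le, simp add: half_symbol_def)
      moreover have "L2norm (dx_inv (w n)) \<le> L2norm (W n) / (sqrt \<kappa> * sqrt (2 * pi))"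
        by (rule op) (simp_all add: symbols_measurable symbols_cnj symbols_le, simp add: dx_inv_symbol_def)
      ultimately show ?thesis unfolding H_norm_def by simp
    qed
    then show "\<forall>\<^sub>F n in sequentially. H_norm (w n) \<le> 3 / (sqrt \<kappa> * sqrt (2 * pi)) * L2norm (W n)" by simp
  qed
  then have "(\<lambda>n. H_norm (\<lambda>x. u (r n) (x + y n) - T C x)) \<longlonglongrightarrow> 0" unfolding w_def[abs_def] .
  with r TC(1) C(3) IC show ?thesis
    unfolding K_def by (intro exI[of _ r] exI[of _ y] exI[of _ "T C"] conjI)
qed

end

theorem theorem5:
  fixes \<alpha> \<beta> \<gamma> \<delta> cs p l :: real
    and f F :: "real \<Rightarrow> real"
    and u :: "nat \<Rightarrow> real \<Rightarrow> real"
  assumes "\<alpha> \<ge> 0" and "\<delta> > 0" and "\<gamma> > 0" and "\<beta> \<noteq> 0" and "cs \<noteq> 0"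
    and "p > 1" and "homogeneous p f"
    and "\<And>s. (F has_real_derivative f s) (at s)" and "F 0 = 0"
    and "(\<beta> < 0 \<and> cs - \<alpha> < 0)
       \<or> (\<beta> < 0 \<and> 0 < cs - \<alpha> \<and> cs - \<alpha> < 2 * sqrt (\<gamma> * \<delta>))
       \<or> (\<beta> > 0 \<and> cs - \<alpha> \<le> - (\<beta>\<^sup>2 / (4 * \<delta>)))
       \<or> (\<beta> > 0 \<and> 4 * \<delta> - \<beta> > 0 \<and> \<beta> ^ 3 < \<gamma> * (4 * \<delta> - \<beta>)\<^sup>2
            \<and> 0 < cs - \<alpha> \<and> cs - \<alpha> < z_plus \<beta> \<gamma> \<delta>)"
    and "l > 0"
    and "\<And>n. u n \<in> H_space" and "\<And>n. K_fun p F (u n) = l"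
    and "(\<lambda>n. I_fun \<alpha> \<beta> \<gamma> \<delta> cs (u n)) \<longlonglongrightarrow> M_inf \<alpha> \<beta> \<gamma> \<delta> cs p F l"
  shows "\<exists>(r :: nat \<Rightarrow> nat) (y :: nat \<Rightarrow> real) v.
           strict_mono r \<and> v \<in> H_space
         \<and> (\<lambda>n. H_norm (\<lambda>x. u (r n) (x + y n) - v x)) \<longlonglongrightarrow> 0
         \<and> K_fun p F v = l \<and> I_fun \<alpha> \<beta> \<gamma> \<delta> cs v = M_inf \<alpha> \<beta> \<gamma> \<delta> cs p F l"
proof -
  obtain e where e: "e > 0" "\<And>k. k > 0 \<Longrightarrow> e \<le> \<gamma> / k\<^sup>2 + \<delta> * k\<^sup>2 - \<beta> * k - (cs - \<alpha>)"
    using symbol_bounded_below[OF assms(2,3,10)] by blast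
  let ?q = "Qsym (cs - \<alpha>) \<beta> \<gamma> \<delta>"
  obtain \<kappa> where \<kappa>: "\<kappa> > 0" "\<And>k. k \<noteq> 0 \<Longrightarrow> \<kappa> * (1 / k\<^sup>2 + 1 + k\<^sup>2) \<le> ?q k"
    using Qsym_coercive[OF assms(2,3) e] by blast
  obtain L where L: "L \<ge> 0" "\<And>s. \<bar>F s\<bar> \<le> L * \<bar>s\<bar> powr (p + 1)" "\<And>s. \<bar>f s\<bar> \<le> L * \<bar>s\<bar> powr p"
    using homogeneous_primitive_bounds(2)[OF assms(7,8,9,6)] by blast
  \<comment> \<open>The 1 is the value of \<open>Qsym\<close> at the origin; elsewhere coercivity
    gives \<kappa>.\<close>
  have ge: "min \<kappa> 1 \<le> ?q k" for k
  proof (cases "k = 0")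
    case False
    have "\<kappa> * 1 \<le> \<kappa> * (1 / k\<^sup>2 + 1 + k\<^sup>2)" using \<kappa>(1) by (intro mult_left_mono) auto
    with \<kappa>(2)[OF False] show ?thesis by linarith
  qed (simp add: Qsym_def)
  have pos: "0 < ?q k" for k using ge[of k] \<kappa>(1) by linarith
  interpret coercive_variational ?q "min \<kappa> 1" F f p L \<kappa> \<alpha> \<beta> \<gamma> \<delta> cs
  proof
    show "square_integrable (\<lambda>k. 1 / sqrt (?q k))"
      unfolding square_integrable_def
    proof
      \<comment> \<open>The reciprocal of the symbol is dominated by a multiple of 1 / (1 +
        k^2).\<close>
      show "integrable lborel (\<lambda>k. (norm (1 / sqrt (?q k)))\<^sup>2)"
      proof (rule Bochner_Integration.integrable_bound)
        show "integrable lborel (\<lambda>k. 1 / \<kappa> * (1 / (1 + k\<^sup>2)))" 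
          using integrable_inverse_1_plus_sq by (rule integrable_mult_right)
        show "AE k in lborel. norm ((norm (1 / sqrt (?q k)))\<^sup>2) \<le> norm (1 / \<kappa> * (1 / (1 + k\<^sup>2)))"
          using AE_lborel_singleton[of 0]
        proof eventually_elim
          case (elim k)
          have "\<kappa> * (1 + k\<^sup>2) \<le> \<kappa> * (1 / k\<^sup>2 + 1 + k\<^sup>2)" using \<kappa>(1) by (intro mult_left_mono) auto
          then have "\<kappa> * (1 + k\<^sup>2) \<le> ?q k" using \<kappa>(2)[OF elim] by linarith
          then have "1 / ?q k \<le> 1 / (\<kappa> * (1 + k\<^sup>2))"
            using \<kappa>(1) pos[of k] by (intro divide_left_mono mult_pos_pos) (auto simp: add_pos_nonneg)
          then show ?case using \<kappa>(1) pos[of k] by (simp add: power_divide less_imp_le add_nonneg_nonneg)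
        qed
      qed measurable
    qed measurable
  qed (use ge \<kappa> L assms homogeneous_primitive_bounds(1)[OF assms(7,8,9,6)] in \<open>simp_all add: Qsym_even\<close>)
  show ?thesis by (rule minimizers_exist[OF assms(11-14)])
qed

end
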